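(* Let $(a,b)\in\{(2,12),(-7,36),(-22,84)\}$. Let $g(u)=-ab(u^2+1)\bigl(b^2(u^4+u^2+1)^3+a^3u^4(u^2+1)^2\bigr)$ and let $E_g^{a,b}: y^2=x^3+ag(u)^2x+bg(u)^3$ over $\mathbb{Q}(u)$. Then $E_g^{a,b}$ has rank two over $\mathbb{Q}(u)$, with free generators the two points $P_g^{a,b}=\left(-\frac{b(u^2+u+1)(u^2-u+1)}{a(u^2+1)}g(u),\ \frac{1}{a^2(u^2+1)^2}g(u)^2\right)$ and $Q_g^{a,b}=\left(-\frac{b(u^2+u+1)(u^2-u+1)}{au^2(u^2+1)}g(u),\ \frac{1}{a^2u^3(u^2+1)^2}g(u)^2\right)$.
   Context: $E_g^{a,b}$ is the quadratic twist by $g$ of the elliptic curve $E^{a,b}: y^2=x^3+ax+b$ over $\mathbb{Q}$. "Free generators" means that $P_g^{a,b},Q_g^{a,b}$ are independent and every point of $E_g^{a,b}(\mathbb{Q}(u))$ is a $\mathbb{Z}$-linear combination of them and torsion points. *)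

theory Defs
  imports "HOL-Computational_Algebra.Polynomial" "HOL-Computational_Algebra.Fraction_Field"
begin

datatype 'a ecpt = Infty | Pt 'a 'a

fun on_curve :: "'a::field \<Rightarrow> 'a \<Rightarrow> 'a ecpt \<Rightarrow> bool" where
  "on_curve A B Infty = True"
| "on_curve A B (Pt x y) = (y ^ 2 = x ^ 3 + A * x + B)"

text \<open>Chord-and-tangent group law (valid for points on a nonsingular curve in characteristic
  different from 2 and 3).\<close>
fun ec_add :: "'a::field \<Rightarrow> 'a ecpt \<Rightarrow> 'a ecpt \<Rightarrow> 'a ecpt" where
  "ec_add A Infty P = P"
| "ec_add A P Infty = P"
| "ec_add A (Pt x1 y1) (Pt x2 y2) =
    (if x1 = x2 \<and> y1 = - y2 then Infty
     else let l = (if x1 = x2 then (3 * x1 ^ 2 + A) / (2 * y1) else (y2 - y1) / (x2 - x1));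
              x3 = l ^ 2 - x1 - x2
          in Pt x3 (l * (x1 - x3) - y1))"

fun ec_neg :: "'a::field ecpt \<Rightarrow> 'a ecpt" where
  "ec_neg Infty = Infty"
| "ec_neg (Pt x y) = Pt x (- y)"

fun ec_nmul :: "'a::field \<Rightarrow> nat \<Rightarrow> 'a ecpt \<Rightarrow> 'a ecpt" where
  "ec_nmul A 0 P = Infty"
| "ec_nmul A (Suc n) P = ec_add A P (ec_nmul A n P)"

definition ec_zmul :: "'a::field \<Rightarrow> int \<Rightarrow> 'a ecpt \<Rightarrow> 'a ecpt" where
  "ec_zmul A k P = (if k \<ge> 0 then ec_nmul A (nat k) P else ec_neg (ec_nmul A (nat (- k)) P))"

fun ec_lincomb :: "'a::field \<Rightarrow> int list \<Rightarrow> 'a ecpt list \<Rightarrow> 'a ecpt" where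
  "ec_lincomb A (c # cs) (P # Ps) = ec_add A (ec_zmul A c P) (ec_lincomb A cs Ps)"
| "ec_lincomb A _ _ = Infty"

definition ec_torsion :: "'a::field \<Rightarrow> 'a \<Rightarrow> 'a ecpt \<Rightarrow> bool" where
  "ec_torsion A B T \<longleftrightarrow> on_curve A B T \<and> (\<exists>n>0. ec_nmul A n T = Infty)"

definition ec_free_generators :: "'a::field \<Rightarrow> 'a \<Rightarrow> 'a ecpt list \<Rightarrow> bool" where
  "ec_free_generators A B Ps \<longleftrightarrow>
     (\<forall>P\<in>set Ps. on_curve A B P) \<and>
     (\<forall>cs. length cs = length Ps \<longrightarrow> ec_lincomb A cs Ps = Infty \<longrightarrow> (\<forall>c\<in>set cs. c = 0)) \<and>
     (\<forall>R. on_curve A B R \<longrightarrow>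
        (\<exists>cs T. length cs = length Ps \<and> ec_torsion A B T \<and> R = ec_add A (ec_lincomb A cs Ps) T))"

definition ec_rank_is :: "'a::field \<Rightarrow> 'a \<Rightarrow> nat \<Rightarrow> bool" where
  "ec_rank_is A B r \<longleftrightarrow> (\<exists>Ps. length Ps = r \<and> ec_free_generators A B Ps)"

type_synonym Qu = "rat poly fract"

definition uu :: Qu where "uu = Fract [:0, 1:] 1"

definition gfun :: "int \<Rightarrow> int \<Rightarrow> Qu" where
  "gfun a b = - of_int a * of_int b * (uu ^ 2 + 1) *
      (of_int b ^ 2 * (uu ^ 4 + uu ^ 2 + 1) ^ 3 + of_int a ^ 3 * uu ^ 4 * (uu ^ 2 + 1) ^ 2)"

definition Pg :: "int \<Rightarrow> int \<Rightarrow> Qu ecpt" where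
  "Pg a b = Pt (- (of_int b * (uu ^ 2 + uu + 1) * (uu ^ 2 - uu + 1)) / (of_int a * (uu ^ 2 + 1)) * gfun a b)
               (1 / (of_int a ^ 2 * (uu ^ 2 + 1) ^ 2) * gfun a b ^ 2)"

definition Qg :: "int \<Rightarrow> int \<Rightarrow> Qu ecpt" where
  "Qg a b = Pt (- (of_int b * (uu ^ 2 + uu + 1) * (uu ^ 2 - uu + 1)) / (of_int a * uu ^ 2 * (uu ^ 2 + 1)) * gfun a b)
               (1 / (of_int a ^ 2 * uu ^ 3 * (uu ^ 2 + 1) ^ 2) * gfun a b ^ 2)"

end

theory Submission
  imports Defs
    "HOL-Computational_Algebra.Polynomial_Factorial"
    "HOL-Computational_Algebra.Field_as_Ring"
    "HOL-Number_Theory.Residues"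
begin

text \<open>
  In each case \<open>x\<^sup>3 + ax + b\<close> has a rational root \<open>e\<close>; put \<open>z = x - eg\<close>, so that the curve becomes
  \<open>y\<^sup>2 = z (z\<^sup>2 + cgz + dg\<^sup>2)\<close> with \<open>c = 3e\<close>, \<open>d = 3e\<^sup>2 + a\<close> and \<open>c\<^sup>2 - 4d = -20\<close>.

  Descent by the 2-isogeny: for a point with \<open>z/g = p/q\<close>, \<open>p\<close> and \<open>q\<close> coprime in \<open>\<int>[u]\<close>, the square class of \<open>z\<close>
  is that of \<open>N = p\<^sup>2 + cpq + dq\<^sup>2\<close>, and \<open>gpqN\<close> is a square.  As \<open>\<int>[u]\<close> is factorial, \<open>N\<close> is a square times a
  product of primes dividing \<open>dg\<close>.  The finitely many possibilities are cut down by specialising \<open>u\<close> to integers and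
  looking at an odd prime that divides the specialised \<open>g\<close> exactly once.  What remains is generated by the classes of
  \<open>P\<close>, \<open>Q\<close> and the 2-torsion point \<open>T\<close>; on the isogenous curve only the class \<open>-5\<close> of its 2-torsion point survives.
  Hence every point is congruent to a combination of \<open>P\<close>, \<open>Q\<close>, \<open>T\<close> modulo doubles.

  The degree \<open>h\<close> of \<open>z/g\<close> as a rational function of \<open>u\<close> satisfies \<open>h(2R) \<ge> 4 h(R)\<close> and
  \<open>h(R+S) + h(R-S) \<le> 2 h(R) + 2 h(S)\<close>, because a twist of a constant curve has no bad places for these formulas.
  Since \<open>g\<close> is squarefree of degree 14 and \<open>g\<close> divides \<open>pqN\<close>, a point with \<open>h < 4\<close> is \<open>0\<close> or \<open>T\<close>; since
  \<open>h(P) = h(Q) = 4\<close>, halving \<open>R \<plusminus> iP \<plusminus> jQ + kT\<close> strictly lowers \<open>h\<close> until \<open>h < 4\<close>.  Independence of \<open>P\<close> and \<open>Q\<close>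
  follows from the independence of their square classes by halving a relation.
\<close>

text \<open>If \<open>x/g\<close> is \<open>X\<close> at \<open>P\<close> and \<open>X/u^2\<close>
  at \<open>Q\<close>, and the values of \<open>x^3 + a*x + b\<close> there differ by the factor
  \<open>u^6\<close>, then \<open>X = -b(u^6-1)/(a(u^4-1))\<close>; up to the fourth power of
  \<open>a(u^2+1)\<close>, \<open>g\<close> is the value at \<open>X\<close>. The substitution
  \<open>u -> 1/u\<close> multiplies \<open>g\<close> by the square \<open>u^(-14)\<close> and
  exchanges \<open>P\<close> and \<open>Q\<close>, so the polynomials attached to \<open>Q\<close>
  are those of \<open>P\<close> reversed. The equation \<open>c^2 - 4d = -20\<close> has the
  solutions \<open>e = -2k\<close>, \<open>a = 5 - 3k^2\<close>, \<open>b = 2k^3 + 10k\<close>; the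
  three cases are \<open>k = 1, 2, 3\<close>.

  The descent runs in \<open>Z[u]\<close> and not in \<open>Q[u]\<close> because the constants of
  \<open>Q\<close> have infinitely many square classes. In \<open>Z[u]\<close> the rational primes
  are primes like the irreducible polynomials, so a square class is a finite vector of exponents mod
  2. Setting \<open>u\<close> to an integer preserves the factorisation, and each local test becomes
  a linear equation on that vector; enough equations leave only the span of the known classes.
  Finiteness of the rank is never presupposed: the degree of \<open>z/g\<close> makes the halving
  terminate.\<close>

subsection \<open>The group law\<close>

text \<open>Relative to the middle point, with \<open>p = x1 - x2\<close> and \<open>q = x3 - x2\<close>, both outer slopes are \<open>U - l\<close> and \<open>U - m\<close> for
  the same \<open>U\<close>, and \<open>(l - m) U = p - q\<close>; everything follows from this.\<close>

lemma slopes_assoc: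
  fixes x1 :: "'a::field"
  assumes A1: "A = 2*l*y2 + l^2*(x1-x2) - (x1^2+x1*x2+x2^2)" and A2: "A = 2*m*y2 + m^2*(x3-x2) - (x2^2+x2*x3+x3^2)"
    and y1: "y1 = y2 + l*(x1-x2)" and y3: "y3 = y2 + m*(x3-x2)"
    and x4: "x4 = l^2-x1-x2" and y4: "y4 = l*(x1-x4)-y1"
    and x5: "x5 = m^2-x2-x3" and y5: "y5 = m*(x2-x5)-y2"
    and n43: "x3-x4 \<noteq> 0" and n15: "x5-x1 \<noteq> 0"
    and l': "l' = (y3-y4)/(x3-x4)" and m': "m' = (y5-y1)/(x5-x1)"
  shows "l'^2 - x4 - x3 = m'^2 - x1 - x5"
    and "l' * (x4 - (l'^2 - x4 - x3)) - y4 = m' * (x1 - (m'^2 - x1 - x5)) - y1"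
proof -
  define p q where "p = x1 - x2" and "q = x3 - x2"
  have x13: "x1 = x2 + p" "x3 = x2 + q" by (simp_all add: p_def q_def)
  define U V where "U = (2*y2 + (l+m)*q)/(x3-x4)" and "V = (2*y2 + (l+m)*p)/(x1-x5)"
  have n15': "x1 - x5 \<noteq> 0" using n15 by auto
  \<comment> \<open>Subtracting the two expressions for \<open>A\<close> is the only place where it
    matters that the three points lie on one curve.\<close>
  have rel: "2*(l-m)*y2 = p*(x3-x4) - q*(x1-x5)"
  proof -
    have "2*(l-m)*y2 - (p*(x3-x4) - q*(x1-x5)) = (2*l*y2 + l^2*(x1-x2) - (x1^2+x1*x2+x2^2)) - (2*m*y2 + m^2*(x3-x2) - (x2^2+x2*x3+x3^2))"
      unfolding x4 x5 x13 by (simp add: algebra_simps power2_eq_square)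
    thus ?thesis unfolding A1[symmetric] A2[symmetric] by simp
  qed
  have ab: "(x1-x5) - (x3-x4) = (l+m)*(l-m)" unfolding x4 x5 by (simp add: algebra_simps power2_eq_square)
  have Ua: "U*(x3-x4) = 2*y2 + (l+m)*q" and Vb: "V*(x1-x5) = 2*y2 + (l+m)*p"
    using n43 n15' by (simp_all add: U_def V_def)
  have "(l-m)*U*(x3-x4) = 2*(l-m)*y2 + ((l+m)*(l-m))*q"
    unfolding mult.assoc[of _ U] Ua by (simp add: algebra_simps)
  also have "\<dots> = (p-q)*(x3-x4)" unfolding rel ab[symmetric] by (simp add: algebra_simps)
  finally have dU: "(l-m)*U = p-q" using n43 by simp
  have "(l-m)*V*(x1-x5) = 2*(l-m)*y2 + ((l+m)*(l-m))*p"
    unfolding mult.assoc[of _ V] Vb by (simp add: algebra_simps)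
  also have "\<dots> = (p-q)*(x1-x5)" unfolding rel ab[symmetric] by (simp add: algebra_simps)
  finally have dV: "(l-m)*V = p-q" using n15' by simp
  \<comment> \<open>\<open>(l-m)*U = p-q\<close> determines \<open>U\<close> unless
    \<open>l = m\<close>; in that case \<open>p = q\<close> and the denominators agree, so the two
    definitions coincide.\<close>
  have UV: "U = V"
  proof (cases "l = m")
    case True
    hence "p = q" using dU by simp
    moreover have "x1 - x5 = x3 - x4" using ab True by simp
    ultimately show ?thesis by (simp add: U_def V_def)
  next
    case False
    thus ?thesis using dU dV by (metis mult_left_cancel right_minus_eq)
  qed
  have "y3 - y4 = (2*y2 + (l+m)*q) - l*(x3-x4)" unfolding y3 y4 y1 x13 by (simp add: algebra_simps)
  hence l'U: "l' = U - l" unfolding l' U_def using n43 by (simp add: field_simps)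
  have "y5 - y1 = - (2*y2 + (l+m)*p) - m*(x5-x1)" unfolding y5 y1 x13 by (simp add: algebra_simps)
  hence "m' = - (2*y2 + (l+m)*p) / (x5-x1) - m" unfolding m' using n15 by (simp add: diff_divide_distrib)
  moreover have "V = - (2*y2 + (l+m)*p) / (x5-x1)"
    unfolding V_def minus_diff_eq[of x5 x1, symmetric] divide_minus_right minus_divide_left ..
  ultimately have m'U: "m' = U - m" unfolding UV by simp
  have 1: "l'^2 - x4 - x3 - (m'^2 - x1 - x5) = 2*((p-q) - (l-m)*U)"
    unfolding l'U m'U x4 x5 x13 by (simp add: algebra_simps power2_eq_square)
  thus x: "l'^2 - x4 - x3 = m'^2 - x1 - x5" using dU by simp
  have x6: "l'^2 - x4 - x3 = x2 + U^2 - 2*U*l + p - q" unfolding l'U x4 x13 by (simp add: algebra_simps power2_eq_square)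
  have x45: "x4 - x5 = (l+m)*(l-m) - (p-q)" using ab unfolding x13 by (simp add: algebra_simps)
  have "l' * (x4 - (x2 + U^2 - 2*U*l + p - q)) - y4 - (m' * (x1 - (x2 + U^2 - 2*U*l + p - q)) - y1) =
      U*(x4-x1) + (2*y2 + (l+m)*p) + (l-m)*(U^2 - 2*U*l + p - q)"
    unfolding l'U m'U y4 y1 x13 by (simp add: algebra_simps power2_eq_square)
  also have "\<dots> = U*(x4-x5) + (l-m)*(U^2 - 2*U*l + p - q)" unfolding Vb[folded UV, symmetric] by (simp add: algebra_simps)
  also have "\<dots> = ((l-m)*U)*(l+m) - U*(p-q) + U*((l-m)*U) - 2*l*((l-m)*U) + (l-m)*(p-q)"
    unfolding x45 by (simp add: algebra_simps power2_eq_square)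
  also have "\<dots> = 0" unfolding dU by (simp add: algebra_simps)
  finally show "l' * (x4 - (l'^2 - x4 - x3)) - y4 = m' * (x1 - (m'^2 - x1 - x5)) - y1"
    unfolding x[symmetric] unfolding x6 by simp
qed

text \<open>Solving for \<open>A\<close> by a divided difference removes \<open>B\<close> and leaves
  a formula without division, which for \<open>x1 = x2\<close> is the tangent relation. Hence
  \<open>slopes_assoc\<close> serves chords and tangents alike.\<close>

lemma chord_slope:
  fixes x1 :: "'a::field"
  assumes "y1^2 = x1^3 + A*x1 + B" "y2^2 = x2^3 + A*x2 + B" "x2 - x1 \<noteq> 0" "l = (y2-y1)/(x2-x1)"
  shows "A = 2*l*y2 + l^2*(x1-x2) - (x1^2+x1*x2+x2^2)" "A = 2*l*y1 + l^2*(x2-x1) - (x1^2+x1*x2+x2^2)" "y2 = y1 + l*(x2-x1)"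
proof -
  show y2: "y2 = y1 + l*(x2-x1)" using assms(3,4) by simp
  have "(x2-x1) * A = y2^2 - y1^2 - x2^3 + x1^3" using assms(1,2) by (simp add: algebra_simps)
  also have "\<dots> = (x2-x1)*(2*l*y1 + l^2*(x2-x1) - (x1^2+x1*x2+x2^2))"
    unfolding y2 by (simp add: algebra_simps power3_eq_cube power2_eq_square)
  finally show A: "A = 2*l*y1 + l^2*(x2-x1) - (x1^2+x1*x2+x2^2)" using assms(3) by simp
  show "A = 2*l*y2 + l^2*(x1-x2) - (x1^2+x1*x2+x2^2)" unfolding y2 A by (simp add: algebra_simps power2_eq_square)
qed

lemma ec_add_chord:
  assumes "x1 \<noteq> x2" "l = (y2 - y1) / (x2 - x1)"
  shows "ec_add A (Pt x1 y1) (Pt x2 y2) = Pt (l^2-x1-x2) (l*(x1-(l^2-x1-x2))-y1)"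
  using assms by (simp add: Let_def)

lemma ec_add_tangent:
  fixes x1 :: "'a::field_char_0"
  assumes "y1 \<noteq> 0" "l = (3*x1^2+A) / (2*y1)"
  shows "ec_add A (Pt x1 y1) (Pt x1 y1) = Pt (l^2-x1-x1) (l*(x1-(l^2-x1-x1))-y1)"
  using assms by (simp add: Let_def)

locale ell_curve =
  fixes A B :: "'a::field_char_0"
  assumes nonsing: "4 * A^3 + 27 * B^2 \<noteq> 0"
begin

abbreviation oc where "oc \<equiv> on_curve A B"
abbreviation ad (infixl "\<^bold>+" 65) where "P \<^bold>+ Q \<equiv> ec_add A P Q"

text \<open>A common zero would be a double root: then \<open>A = -3*x^2\<close>,
  \<open>B = 2*x^3\<close>, and the discriminant vanishes.\<close>

lemma vertical_tangent:
  assumes "0 = x^3 + A*x + B" shows "3*x^2 + A \<noteq> 0"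
proof
  assume "3*x^2 + A = 0"
  hence a: "A = -3*x^2" by (simp add: eq_neg_iff_add_eq_0 add.commute)
  have "(x^3 + A*x) + B = 0" using assms by simp
  from minus_unique[OF this] have "B = - (x^3 + A*x)" by simp
  hence b: "B = 2*x^3" unfolding a by (simp add: algebra_simps power3_eq_cube power2_eq_square)
  have "4*A^3 + 27*B^2 = 0" unfolding a b by (simp add: power_mult_distrib flip: power_mult)
  with nonsing show False by simp
qed

lemma ad_Infty [simp]: "P \<^bold>+ Infty = P" by (cases P) auto

lemma ec_neg_neg [simp]: "ec_neg (ec_neg P) = P" by (cases P) auto

lemma oc_neg [simp]: "oc (ec_neg P) = oc P" by (cases P) auto

text \<open>In the case \<open>line\<close> the relations for \<open>x3\<close> are Vieta's formulas
  for the cubic \<open>x^3 + A*x + B - (l*(x-x1)+y1)^2\<close>. They hold for chord and tangent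
  uniformly, so that most later arguments need not separate the two.\<close>

lemma ad_cases [consumes 2, case_names Infty1 Infty2 opp line]:
  assumes "oc P" "oc Q"
  obtains "P = Infty" | "Q = Infty" | "P \<noteq> Infty" "Q \<noteq> Infty" "P = ec_neg Q"
  | x1 y1 x2 y2 l x3 where "P = Pt x1 y1" "Q = Pt x2 y2" "P \<noteq> ec_neg Q" "P \<^bold>+ Q = Pt x3 (l*(x1-x3)-y1)"
     "y2 = l*(x2-x1)+y1" "x3 = l^2-x1-x2"
     "A - 2*l*(y1 - l*x1) = x1*x2+x1*x3+x2*x3" "(y1-l*x1)^2 - B = x1*x2*x3"
     "l = (if x1 = x2 then (3 * x1 ^ 2 + A) / (2 * y1) else (y2 - y1) / (x2 - x1))"
proof (cases P)
  case Infty thus ?thesis using that by simp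
next
  case P: (Pt x1 y1)
  show ?thesis
  proof (cases Q)
    case Infty thus ?thesis using that by simp
  next
    case Q: (Pt x2 y2)
    have e1: "y1^2 = x1^3 + A*x1 + B" and e2: "y2^2 = x2^3 + A*x2 + B" using assms P Q by auto
    show ?thesis
    proof (cases "P = ec_neg Q")
      case True thus ?thesis using that P Q by simp
    next
      case False
      hence nn: "\<not> (x1 = x2 \<and> y1 = - y2)" using P Q by auto
      define l where "l = (if x1 = x2 then (3 * x1 ^ 2 + A) / (2 * y1) else (y2 - y1) / (x2 - x1))"
      define x3 where "x3 = l^2-x1-x2"
      have s: "P \<^bold>+ Q = Pt x3 (l*(x1-x3)-y1)"
        using nn by (simp add: P Q x3_def l_def Let_def)
      show ?thesis
      proof (cases "x1 = x2")
        case True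
        hence "y1^2 = y2^2" using e1 e2 by simp
        hence y: "y2 = y1" "y1 \<noteq> 0" using nn True by (auto simp: power2_eq_iff)
        have l: "3*x1^2 + A = 2*l*y1" using True y by (simp add: l_def)
        have a: "A = 2*l*y1 - 3*x1^2" using l by (simp add: algebra_simps)
        have b: "B = y1^2 - x1^3 - A*x1" using e1 by simp
        show ?thesis
          apply (rule that(4)[OF P Q False s _ x3_def _ _ l_def])
          unfolding b a x3_def using True y by (simp_all add: algebra_simps power3_eq_cube power2_eq_square)
      next
        case False
        have "l = (y2-y1)/(x2-x1)" using False by (simp add: l_def)
        note cs = chord_slope[OF e1 e2 _ this]
        have l: "y2 = l*(x2-x1)+y1" using cs(3) False by simp
        have a: "A = 2*l*y1 + l^2*(x2-x1) - (x1^2+x1*x2+x2^2)" using cs(2) False by simp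
        have b: "B = y1^2 - x1^3 - A*x1" using e1 by simp
        show ?thesis
          apply (rule that(4)[OF P Q \<open>P \<noteq> ec_neg Q\<close> s l x3_def _ _ l_def])
          unfolding b a x3_def by (simp_all add: algebra_simps power3_eq_cube power2_eq_square)
      qed
    qed
  qed
qed

lemma ad_neg [simp]: "P \<^bold>+ ec_neg P = Infty" "ec_neg P \<^bold>+ P = Infty"
  by (cases P; simp)+

lemma oc_ad [simp]: assumes "oc P" "oc Q" shows "oc (P \<^bold>+ Q)"
  using assms
proof (cases rule: ad_cases)
  case (line x1 y1 x2 y2 l x3)
  have a: "A = x1*x2+x1*x3+x2*x3 + 2*l*(y1 - l*x1)" using line(7) by (simp add: algebra_simps)
  have b: "B = (y1-l*x1)^2 - x1*x2*x3" using line(8) by (simp add: algebra_simps)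
  have x1: "x1 = l^2-x2-x3" using line(6) by (simp add: algebra_simps)
  have "(l*(x1-x3)-y1)^2 = x3^3 + (x1*x2+x1*x3+x2*x3 + 2*l*(y1 - l*x1)) * x3 + ((y1-l*x1)^2 - x1*x2*x3)"
    unfolding x1 by (simp add: algebra_simps power3_eq_cube power2_eq_square)
  thus ?thesis unfolding line(4) on_curve.simps using a b by simp
qed (use assms in auto)

lemma ad_commute: assumes "oc P" "oc Q" shows "P \<^bold>+ Q = Q \<^bold>+ P"
proof (cases P)
  case P: (Pt x1 y1)
  show ?thesis
  proof (cases Q)
    case Q: (Pt x2 y2)
    show ?thesis
    proof (cases "x1 = x2")
      case True
      with assms P Q have "y1^2 = y2^2" by simp
      hence "y1 = y2 \<or> y1 = -y2" by (simp add: power2_eq_iff)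
      with True show ?thesis by (auto simp: P Q)
    next
      case False
      have l: "(y2 - y1) / (x2 - x1) = (y1 - y2) / (x1 - x2)" using False by (simp add: field_simps)
      define l where "l = (y1 - y2) / (x1 - x2)"
      have y: "y2 = y1 - l*(x1-x2)" using False by (simp add: l_def)
      have "P \<^bold>+ Q = Pt (l^2-x1-x2) (l*(x1-(l^2-x1-x2))-y1)"
        using False by (simp add: P Q Let_def l l_def)
      moreover have "Q \<^bold>+ P = Pt (l^2-x2-x1) (l*(x2-(l^2-x2-x1))-y2)"
        using False by (simp add: P Q Let_def l_def)
      ultimately show ?thesis using y by (simp add: algebra_simps)
    qed
  qed (simp add: P)
qed simp

lemma neg_ad: assumes "oc P" "oc Q" shows "ec_neg (P \<^bold>+ Q) = ec_neg P \<^bold>+ ec_neg Q"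
  using assms
proof (cases rule: ad_cases)
  case (line x1 y1 x2 y2 l x3)
  have "(if x1 = x2 then (3 * x1 ^ 2 + A) / (2 * - y1) else (- y2 - - y1) / (x2 - x1)) = -l"
    unfolding line(9) by (simp add: minus_divide_left)
  moreover have "\<not> (x1 = x2 \<and> - y1 = - (- y2))" using line(1-3) by auto
  ultimately have "ec_neg P \<^bold>+ ec_neg Q = Pt ((-l)^2 - x1 - x2) (-l * (x1 - ((-l)^2 - x1 - x2)) - - y1)"
    unfolding line(1,2) by (simp add: Let_def)
  thus ?thesis unfolding line(4) using line(6) by simp
qed auto

lemma ad_eq_Infty: assumes "oc P" "oc Q" "P \<^bold>+ Q = Infty" shows "P = ec_neg Q"
  using assms(1,2)
proof (cases rule: ad_cases)
  case (line x1 y1 x2 y2 l x3)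
  thus ?thesis using assms(3) line(4) by simp
qed (use assms(3) in auto)

text \<open>The reflected line, of slope \<open>-l\<close>, joins \<open>P + Q\<close> to
  \<open>-Q\<close> and returns to \<open>P\<close>; it is a tangent when \<open>x3 = x2\<close>.
  All degenerate cases of associativity are reduced to this instance.\<close>

lemma ad_cancel: assumes "oc P" "oc Q" shows "(P \<^bold>+ Q) \<^bold>+ ec_neg Q = P"
  using assms
proof (cases rule: ad_cases)
  case (line x1 y1 x2 y2 l x3)
  define y3 where "y3 = l*(x1-x3)-y1"
  have a: "A = x1*x2+x1*x3+x2*x3 + 2*l*(y1 - l*x1)" using line(7) by (simp add: algebra_simps)
  show ?thesis
  proof (cases "x3 = x2")
    case True
    have y3: "y3 = -y2" unfolding y3_def True line(5) by (simp add: algebra_simps)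
    have x1: "x1 = l^2-x2-x2" using line(6) True by (simp add: algebra_simps)
    have t: "3*x2^2 + A = 2*l*y2" unfolding a line(5) True x1
      by (simp add: algebra_simps power2_eq_square)
    have "y2 \<noteq> 0" using vertical_tangent[of x2] t assms(2) line(2) by auto
    hence l: "(3*x2^2+A)/(2*y3) = -l" unfolding t y3 by simp
    have "P \<^bold>+ Q \<^bold>+ ec_neg Q = Pt ((-l)^2-x2-x2) (-l*(x2-((-l)^2-x2-x2)) - - y2)"
      unfolding line(4) y3_def[symmetric] unfolding True line(2) y3 ec_neg.simps
      by (rule ec_add_tangent) (use \<open>y2 \<noteq> 0\<close> l y3 in simp_all)
    also have "\<dots> = Pt x1 y1" unfolding power2_minus x1[symmetric] using line(5) by (simp add: algebra_simps)
    finally show ?thesis using line(1) by simp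
  next
    case False
    have x1: "l^2-x3-x2 = x1" using line(6) by (simp add: algebra_simps)
    have "(- y2 - y3) = (-l)*(x2-x3)" unfolding y3_def line(5) by (simp add: algebra_simps)
    hence l: "(- y2 - y3) / (x2-x3) = -l" using False by simp
    have "P \<^bold>+ Q \<^bold>+ ec_neg Q = Pt ((-l)^2-x3-x2) (-l*(x3-((-l)^2-x3-x2)) - y3)"
      unfolding line(4) y3_def[symmetric] unfolding line(2) ec_neg.simps
      by (rule ec_add_chord) (use False l in simp_all)
    also have "\<dots> = Pt x1 y1" unfolding power2_minus x1 by (simp add: y3_def algebra_simps)
    finally show ?thesis using line(1) by simp
  qed
qed auto

lemma ad_cancel': assumes "oc P" "oc Q" shows "(P \<^bold>+ ec_neg Q) \<^bold>+ Q = P"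
  using ad_cancel[OF assms(1), of "ec_neg Q"] assms by simp

lemma ad_eq_self: assumes "oc P" "oc Q" "P \<^bold>+ Q = Q" shows "P = Infty"
  using ad_cancel[OF assms(1,2)] assms by simp

lemma x_eq_cases: assumes "oc (Pt x y)" "oc (Pt x y')" shows "Pt x y = Pt x y' \<or> Pt x y = ec_neg (Pt x y')"
proof -
  have "y^2 = y'^2" using assms by simp
  thus ?thesis by (auto simp: power2_eq_iff)
qed

text \<open>The exclusions make the abscissas distinct in all four additions, so each of them is a
  chord.\<close>

lemma assoc_chord:
  assumes "oc P" "oc Q" "oc R" "P \<noteq> Infty" "Q \<noteq> Infty" "R \<noteq> Infty"
    "P \<noteq> Q" "P \<noteq> ec_neg Q" "Q \<noteq> R" "Q \<noteq> ec_neg R" "P \<^bold>+ Q \<noteq> R" "P \<^bold>+ Q \<noteq> ec_neg R"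
    "P \<noteq> Q \<^bold>+ R" "P \<noteq> ec_neg (Q \<^bold>+ R)"
  shows "(P \<^bold>+ Q) \<^bold>+ R = P \<^bold>+ (Q \<^bold>+ R)"
proof -
  obtain x1 y1 x2 y2 x3 y3 where P: "P = Pt x1 y1" and Q: "Q = Pt x2 y2" and R: "R = Pt x3 y3"
    using assms(4-6) by (metis ecpt.exhaust)
  have n: "x1 \<noteq> x2" "x2 \<noteq> x3" using assms P Q R x_eq_cases by metis+
  define l x4 y4 m x5 y5 where "l = (y2-y1)/(x2-x1)" and "x4 = l^2-x1-x2" and "y4 = l*(x1-x4)-y1"
    and "m = (y3-y2)/(x3-x2)" and "x5 = m^2-x2-x3" and "y5 = m*(x2-x5)-y2"
  note defs = this
  have PQ: "P \<^bold>+ Q = Pt x4 y4" and QR: "Q \<^bold>+ R = Pt x5 y5"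
    using n by (simp_all add: P Q R Let_def defs)
  have n2: "x4 \<noteq> x3" using assms(11,12) oc_ad[OF assms(1,2)] assms(3) unfolding PQ R by (metis x_eq_cases)
  have n3: "x1 \<noteq> x5" using assms(13,14) oc_ad[OF assms(2,3)] assms(1) unfolding QR P by (metis x_eq_cases)
  have e: "y1^2 = x1^3 + A*x1 + B" "y2^2 = x2^3 + A*x2 + B" "y3^2 = x3^3 + A*x3 + B"
    using assms P Q R by auto
  have n': "x2 - x1 \<noteq> 0" "x3 - x2 \<noteq> 0" "x3 - x4 \<noteq> 0" "x5 - x1 \<noteq> 0" using n n2 n3 by auto
  note s1 = chord_slope[OF e(1,2) n'(1) defs(1)] and s2 = chord_slope[OF e(2,3) n'(2) defs(4)]
  have "y1 = y2 + l*(x1-x2)" using s1(3) by (simp add: algebra_simps)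
  note c = slopes_assoc[OF s1(1) s2(2) this s2(3) defs(2,3,5,6) n'(3,4) refl refl]
  show ?thesis unfolding PQ QR unfolding P R
    unfolding ec_add_chord[OF n2 refl] ec_add_chord[OF n3 refl] by (intro arg_cong2[of _ _ _ _ Pt] c)
qed

text \<open>Only the addition \<open>P + P\<close> is a tangent here; the other three are
  chords.\<close>

lemma assoc_tangent:
  assumes "oc P" "oc R" "P \<noteq> Infty" "R \<noteq> Infty"
    "P \<noteq> ec_neg P" "P \<noteq> R" "P \<noteq> ec_neg R" "P \<^bold>+ P \<noteq> R" "P \<^bold>+ P \<noteq> ec_neg R"
    "P \<noteq> P \<^bold>+ R" "P \<noteq> ec_neg (P \<^bold>+ R)"
  shows "(P \<^bold>+ P) \<^bold>+ R = P \<^bold>+ (P \<^bold>+ R)"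
proof -
  obtain x1 y1 x3 y3 where P: "P = Pt x1 y1" and R: "R = Pt x3 y3"
    using assms(3-4) by (metis ecpt.exhaust)
  have n: "x1 \<noteq> x3" using assms P R x_eq_cases by metis
  have y: "y1 \<noteq> 0" using assms(5) P by auto
  define l x4 y4 m x5 y5 where "l = (3*x1^2+A)/(2*y1)" and "x4 = l^2-x1-x1" and "y4 = l*(x1-x4)-y1"
    and "m = (y3-y1)/(x3-x1)" and "x5 = m^2-x1-x3" and "y5 = m*(x1-x5)-y1"
  note defs = this
  have PQ: "P \<^bold>+ P = Pt x4 y4" and QR: "P \<^bold>+ R = Pt x5 y5"
    using n y by (simp_all add: P R Let_def defs)
  have n2: "x4 \<noteq> x3" using assms(8,9) oc_ad[OF assms(1,1)] assms(2) unfolding PQ R by (metis x_eq_cases)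
  have n3: "x1 \<noteq> x5" using assms(10,11) oc_ad[OF assms(1,2)] assms(1) unfolding QR unfolding P by (metis x_eq_cases)
  have e: "y1^2 = x1^3 + A*x1 + B" "y3^2 = x3^3 + A*x3 + B"
    using assms P R by auto
  have n': "2 * y1 \<noteq> 0" "x3 - x1 \<noteq> 0" "x3 - x4 \<noteq> 0" "x5 - x1 \<noteq> 0" using n n2 n3 y by auto
  note s2 = chord_slope[OF e n'(2) defs(4)]
  have "2*l*y1 = 3*x1^2+A" using n'(1) defs(1) by simp
  hence a: "A = 2*l*y1 + l^2*(x1-x1) - (x1^2+x1*x1+x1^2)" by (simp add: algebra_simps power2_eq_square)
  have "y1 = y1 + l*(x1-x1)" by simp
  note c = slopes_assoc[OF a s2(2) this s2(3) defs(2,3,5,6) n'(3,4) refl refl]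
  show ?thesis unfolding PQ QR unfolding P R
    unfolding ec_add_chord[OF n2 refl] ec_add_chord[OF n3 refl] by (intro arg_cong2[of _ _ _ _ Pt] c)
qed

lemma assoc_degen:
  assumes "oc P" "oc Q" "oc R"
    "P = Infty \<or> Q = Infty \<or> R = Infty \<or> P = ec_neg Q \<or> Q = ec_neg R \<or> P \<^bold>+ Q = ec_neg R \<or> P = ec_neg (Q \<^bold>+ R)"
  shows "(P \<^bold>+ Q) \<^bold>+ R = P \<^bold>+ (Q \<^bold>+ R)"
  using assms(4)
proof (elim disjE)
  assume h: "P = ec_neg Q"
  have "(R \<^bold>+ Q) \<^bold>+ ec_neg Q = R" using ad_cancel assms by simp
  thus ?thesis using h assms ad_commute[of Q R] ad_commute[of "R \<^bold>+ Q" "ec_neg Q"] by simp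
next
  assume h: "Q = ec_neg R"
  show ?thesis using h assms ad_cancel'[of P R] by simp
next
  assume h: "P \<^bold>+ Q = ec_neg R"
  hence "R = ec_neg (Q \<^bold>+ P)" using assms ad_commute by (metis ec_neg_neg)
  hence "R \<^bold>+ Q = ec_neg P" using neg_ad[of Q P] ad_cancel'[of "ec_neg P" Q] assms
    ad_commute[of "ec_neg P" "ec_neg Q"] by simp
  thus ?thesis using h assms ad_commute[of R Q] by simp
next
  assume h: "P = ec_neg (Q \<^bold>+ R)"
  hence "P \<^bold>+ Q = ec_neg R" using neg_ad[of Q R] ad_cancel'[of "ec_neg R" Q] assms
    ad_commute[of "ec_neg R" "ec_neg Q"] by simp
  thus ?thesis using h by simp
qed simp_all

text \<open>The delicate case is \<open>R = P + P\<close>, where the outer addition on the left is a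
  tangent too. Applying the generic case to \<open>R\<close> and \<open>-P\<close> gives
  \<open>(R + R) - P = R + P\<close>, and adding \<open>P\<close> finishes unless
  \<open>R + R = -P\<close>.\<close>

lemma assoc_double:
  assumes "oc P" "oc R"
  shows "(P \<^bold>+ P) \<^bold>+ R = P \<^bold>+ (P \<^bold>+ R)"
proof -
  have gen: "(P \<^bold>+ P) \<^bold>+ R = P \<^bold>+ (P \<^bold>+ R)" if "oc P" "oc R" "P \<^bold>+ P \<noteq> R" for P R
  proof (cases "P = R \<or> P = P \<^bold>+ R")
    case True
    thus ?thesis using that ad_commute[of "P \<^bold>+ P" P] ad_eq_self[of R P] ad_commute[of P R] by auto
  next
    case False
    thus ?thesis using assoc_degen[of P P R] assoc_tangent[of P R] that by blast
  qed
  show ?thesis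
  proof (cases "P \<^bold>+ P = R")
    case True
    note R = this[symmetric]
    have RP: "R \<^bold>+ ec_neg P = P" unfolding R using ad_cancel assms by simp
    show ?thesis
    proof (cases "R \<^bold>+ R = ec_neg P")
      case False
      have "(R \<^bold>+ R) \<^bold>+ ec_neg P = R \<^bold>+ P"
        using gen[of R "ec_neg P"] False assms RP by simp
      hence "R \<^bold>+ R = (R \<^bold>+ P) \<^bold>+ P" using ad_cancel'[of "R \<^bold>+ R" P] assms by simp
      thus ?thesis unfolding True using ad_commute assms by simp
    next
      \<comment> \<open>Here \<open>5P = 0\<close>, and both sides are computed to be
        \<open>-P\<close> directly.\<close>
      case True
      have "P = ec_neg R \<^bold>+ ec_neg R" using neg_ad[of R R] assms True by simp
      hence "P \<^bold>+ R = ec_neg R" using ad_cancel'[of "ec_neg R" R] assms by simp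
      hence "P \<^bold>+ (P \<^bold>+ R) = P \<^bold>+ ec_neg R" by simp
      also have "\<dots> = ec_neg (R \<^bold>+ ec_neg P)" using neg_ad[of R "ec_neg P"] ad_commute[of "ec_neg R" P] assms by simp
      also have "\<dots> = R \<^bold>+ R" using RP True by simp
      finally show ?thesis using R by simp
    qed
  qed (use gen assms in simp)
qed

text \<open>After doubling, chords and degenerate cases there remain \<open>R = P + Q\<close> and
  its mirror image \<open>P = Q + R\<close>, where an outer addition is a tangent. Writing
  \<open>Q = R - P\<close> turns them into \<open>assoc_double\<close> for \<open>R\<close> and
  \<open>-P\<close>.\<close>

theorem ad_assoc:
  assumes "oc P" "oc Q" "oc R"
  shows "(P \<^bold>+ Q) \<^bold>+ R = P \<^bold>+ (Q \<^bold>+ R)"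
proof -
  have sum: "P \<^bold>+ (Q \<^bold>+ R) = R \<^bold>+ R" if "oc P" "oc Q" "oc R" "R = P \<^bold>+ Q" for P Q R
  proof -
    have "R \<^bold>+ ec_neg P = Q" using ad_cancel[of Q P] ad_commute that by simp
    hence "(R \<^bold>+ R) \<^bold>+ ec_neg P = R \<^bold>+ Q" using assoc_double[of R "ec_neg P"] that by simp
    hence "R \<^bold>+ R = (R \<^bold>+ Q) \<^bold>+ P" using ad_cancel'[of "R \<^bold>+ R" P] that by simp
    thus ?thesis using that(1-3) ad_commute by simp
  qed
  consider "P = Q" | "Q = R" | "R = P \<^bold>+ Q" | "P = Q \<^bold>+ R" | "P \<noteq> Q" "Q \<noteq> R" "P \<^bold>+ Q \<noteq> R" "P \<noteq> Q \<^bold>+ R" by blast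
  thus ?thesis
  proof cases
    case 1 thus ?thesis using assoc_double assms by simp
  next
    case 2 thus ?thesis using assoc_double[of R P] assms ad_commute by simp
  next
    case 3 thus ?thesis using sum[OF assms] by simp
  next
    case 4
    have "R \<^bold>+ (Q \<^bold>+ P) = P \<^bold>+ P" using sum[of R Q P] 4 assms ad_commute[of Q R] by simp
    thus ?thesis using 4 assms ad_commute by simp
  next
    case 5 thus ?thesis using assoc_degen[OF assms] assoc_chord[OF assms] by blast
  qed
qed

section \<open>The abelian group of points and its multiples\<close>

definition EG :: "'a ecpt monoid" where
  "EG = \<lparr>carrier = {P. oc P}, mult = ec_add A, one = Infty\<rparr>"

lemma EG_simps [simp]: "carrier EG = {P. oc P}" "mult EG = ec_add A" "one EG = Infty"
  by (simp_all add: EG_def)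

sublocale EG: comm_group EG
proof (rule groupI[THEN group.group_comm_groupI])
  show "\<exists>y\<in>carrier EG. y \<otimes>\<^bsub>EG\<^esub> x = \<one>\<^bsub>EG\<^esub>" if "x \<in> carrier EG" for x
    using that by (intro bexI[of _ "ec_neg x"]) auto
next
  show "x \<otimes>\<^bsub>EG\<^esub> y \<otimes>\<^bsub>EG\<^esub> z = x \<otimes>\<^bsub>EG\<^esub> (y \<otimes>\<^bsub>EG\<^esub> z)"
    if "x \<in> carrier EG" "y \<in> carrier EG" "z \<in> carrier EG" for x y z
    unfolding EG_simps by (rule ad_assoc) (use that in auto)
next
  show "x \<otimes>\<^bsub>EG\<^esub> y = y \<otimes>\<^bsub>EG\<^esub> x" if "x \<in> carrier EG" "y \<in> carrier EG" for x y
    unfolding EG_simps by (rule ad_commute) (use that in auto)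
qed auto

lemma EG_inv [simp]: "oc P \<Longrightarrow> inv\<^bsub>EG\<^esub> P = ec_neg P"
  by (rule EG.inv_equality) auto

lemma ec_nmul_eq: "oc P \<Longrightarrow> ec_nmul A n P = P [^]\<^bsub>EG\<^esub> n"
proof (induction n)
  case (Suc n)
  have "ec_nmul A (Suc n) P = P \<^bold>+ P [^]\<^bsub>EG\<^esub> n" using Suc by simp
  also have "\<dots> = P [^]\<^bsub>EG\<^esub> n \<^bold>+ P"
    by (rule ad_commute) (use Suc.prems EG.nat_pow_closed[of P n] in auto)
  finally show ?case by simp
qed simp

lemma ec_zmul_eq: assumes "oc P" shows "ec_zmul A k P = P [^]\<^bsub>EG\<^esub> k"
proof -
  have "oc (P [^]\<^bsub>EG\<^esub> nat (-k))" using EG.nat_pow_closed[of P "nat (-k)"] assms by simp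
  from EG_inv[OF this] show ?thesis
    unfolding ec_zmul_def int_pow_def2 ec_nmul_eq[OF assms] by (simp only: not_le[symmetric] if_not_P if_P split: if_split) blast
qed

lemma oc_zmul [simp]: "oc P \<Longrightarrow> oc (ec_zmul A k P)"
  using EG.int_pow_closed[of P k] by (simp add: ec_zmul_eq)

lemma zmul_add: "oc P \<Longrightarrow> ec_zmul A (k + l) P = ec_zmul A k P \<^bold>+ ec_zmul A l P"
  using EG.int_pow_mult[of P k l] by (simp add: ec_zmul_eq)

lemma zmul_0 [simp]: "ec_zmul A 0 P = Infty" and zmul_1 [simp]: "ec_zmul A 1 P = P"
  and zmul_m1 [simp]: "ec_zmul A (-1) P = ec_neg P"
  by (simp_all add: ec_zmul_def)

lemma ad_left_commute:
  assumes "oc P" "oc Q" "oc R" shows "P \<^bold>+ (Q \<^bold>+ R) = Q \<^bold>+ (P \<^bold>+ R)"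
proof -
  have "P \<^bold>+ (Q \<^bold>+ R) = (P \<^bold>+ Q) \<^bold>+ R" by (rule ad_assoc[symmetric]) fact+
  also have "P \<^bold>+ Q = Q \<^bold>+ P" by (rule ad_commute) fact+
  also have "(Q \<^bold>+ P) \<^bold>+ R = Q \<^bold>+ (P \<^bold>+ R)" by (rule ad_assoc) fact+
  finally show ?thesis .
qed

end

subsection \<open>Square classes\<close>

text \<open>A prime of \<open>N\<close> that divides no \<open>f i\<close> does not divide
  \<open>M\<close>, so it divides \<open>N\<close> to an even power and goes into \<open>t\<close>;
  the other primes are associates of some \<open>f i\<close>. The induction removes them one by
  one.\<close>

lemma square_class_decomposition:
  fixes N M w :: "'a::factorial_semiring" and n :: nat
  assumes "N \<noteq> 0" "N * M = w^2"
    and "\<And>i. i < n \<Longrightarrow> prime_elem (f i)"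
    and "\<And>p. prime_elem p \<Longrightarrow> p dvd N \<Longrightarrow> p dvd M \<Longrightarrow> \<exists>i<n. p dvd f i"
  shows "\<exists>e v t. is_unit v \<and> N = v * (\<Prod>i<n. f i ^ e i) * t^2"
  using assms(1,2,4)
proof (induction "size (prime_factorization N)" arbitrary: N M w rule: less_induct)
  case less
  show ?case
  proof (cases "is_unit N")
    case True
    show ?thesis by (rule exI[of _ "\<lambda>_. 0"], rule exI[of _ N], rule exI[of _ 1]) (use True in simp)
  next
    case False
    obtain p where p: "p dvd N" "prime p" using prime_divisor_exists[OF \<open>N \<noteq> 0\<close> False] by auto
    hence pe: "prime_elem p" "p \<noteq> 0" by auto
    obtain N' where N': "N = p * N'" using p by auto
    have nz: "N' \<noteq> 0" using less.prems N' by auto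
    have sz: "size (prime_factorization N') < size (prime_factorization N)"
      unfolding N' using nz p pe by (simp add: prime_factorization_mult prime_factorization_prime)
    show ?thesis
    proof (cases "\<exists>i<n. p dvd f i")
      case True
      then obtain i where i: "i < n" "p dvd f i" by blast
      have "irreducible (f i)" using assms(3)[OF i(1)] prime_elem_imp_irreducible by blast
      hence "f i dvd p" using i(2) p(2) by (metis irreducibleD' not_prime_unit)
      then obtain u where u: "p = f i * u" by auto
      have "is_unit u"
      proof -
        obtain r where r: "f i = p * r" using i(2) by auto
        have "p * (r * u) = p * 1" using u r by (metis mult.assoc mult.right_neutral)
        hence "r * u = 1" using pe(2) by (simp only: mult_cancel_left) auto
        thus ?thesis by (metis dvd_triv_right)
      qed
      \<comment> \<open>Moving \<open>p\<close> from \<open>N\<close> to \<open>M\<close> keeps the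
        product a square; the enlarged second factor acquires no common prime other than those
        dividing some \<open>f i\<close>.\<close>
      have "\<exists>e v t. is_unit v \<and> N' = v * (\<Prod>i<n. f i ^ e i) * t^2"
      proof (rule less.hyps[OF sz nz])
        show "N' * (M * p) = w^2" using less.prems(2) unfolding N' by (simp add: ac_simps)
        show "\<exists>i<n. q dvd f i" if q: "prime_elem q" "q dvd N'" "q dvd M * p" for q
        proof (cases "q dvd M")
          case True
          thus ?thesis using less.prems(3)[of q] q N' by auto
        next
          case False
          hence "q dvd p" using q prime_elem_dvd_mult_iff by blast
          thus ?thesis using i dvd_trans by blast
        qed
      qed
      then obtain e v t where e: "is_unit v" "N' = v * (\<Prod>i<n. f i ^ e i) * t^2" by blast
      have "N = (v * u) * (\<Prod>k<n. f k ^ (e(i := Suc (e i))) k) * t^2"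
      proof -
        have "(\<Prod>k<n. f k ^ (e(i := Suc (e i))) k) = f i ^ Suc (e i) * (\<Prod>k\<in>{..<n}-{i}. f k ^ e k)"
          using i by (subst prod.remove[OF finite_lessThan, of i]) (auto intro!: prod.cong)
        also have "\<dots> = f i * (\<Prod>k<n. f k ^ e k)"
          using i by (simp add: prod.remove[of "{..<n}" i] ac_simps)
        finally show ?thesis unfolding N' e(2) u by (simp add: ac_simps)
      qed
      thus ?thesis using e(1) \<open>is_unit u\<close> by (metis is_unit_mult_iff)
    next
      case False
      hence nM: "\<not> p dvd M" using less.prems(3)[of p] p pe by blast
      have "p dvd w^2" unfolding less.prems(2)[symmetric] using p by simp
      hence "p dvd w" using pe prime_elem_dvd_power by blast
      then obtain w' where w': "w = p * w'" by auto
      have "p * (N' * M) = p * (p * w'^2)" using less.prems(2) unfolding N' w' by (simp add: power2_eq_square ac_simps)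
      hence 1: "N' * M = p * w'^2" using pe by simp
      hence "p dvd N'" using nM pe by (metis dvd_triv_left prime_elem_dvd_multD)
      then obtain N2 where N2: "N' = p * N2" by auto
      have "p * (N2 * M) = p * w'^2" using 1 unfolding N2 by (simp add: ac_simps)
      hence 2: "N2 * M = w'^2" using pe(2) by simp
      have nz2: "N2 \<noteq> 0" using nz N2 by auto
      have "size (prime_factorization N2) < size (prime_factorization N)"
        using sz unfolding N2 using nz2 p pe by (simp add: prime_factorization_mult prime_factorization_prime)
      from less.hyps[OF this nz2 2] less.prems(3) N' N2
      obtain e v t where e: "is_unit v" "N2 = v * (\<Prod>i<n. f i ^ e i) * t^2" by (metis dvd_mult)
      have "N = v * (\<Prod>i<n. f i ^ e i) * (p*t)^2"
        unfolding N' N2 e(2) by (simp add: power2_eq_square ac_simps)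
      thus ?thesis using e by blast
    qed
  qed
qed

subsection \<open>Euler's character\<close>

lemma fermat_int:
  fixes p a :: int
  assumes "prime p" "\<not> p dvd a"
  shows "[a ^ nat (p - 1) = 1] (mod p)"
proof -
  have p0: "p > 0" using prime_gt_0_int[OF assms(1)] .
  have np: "prime (nat p)" using iffD1[OF prime_int_nat_transfer assms(1)] by blast
  have "\<not> p dvd a mod p" using assms by (simp add: dvd_mod_iff)
  hence "\<not> nat p dvd nat (a mod p)" using p0 by (simp add: nat_dvd_iff)
  from fermat_theorem[OF np this] have "[int (nat (a mod p)) ^ (nat p - 1) = 1] (mod int (nat p))"
    by (metis cong_int_iff of_nat_1 of_nat_power)
  hence "[(a mod p) ^ nat (p - 1) = 1] (mod p)" using p0 by (simp add: nat_diff_distrib)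
  thus ?thesis by (simp add: cong_def power_mod)
qed

text \<open>With \<open>h = (p-1)/2\<close>, the residue of \<open>x^h\<close> is the quadratic
  character of \<open>x\<close> (Euler). In this form it is visibly multiplicative, is 1 on squares
  prime to \<open>p\<close> by Fermat, and can be evaluated by computation.\<close>

locale odd_prime =
  fixes p :: int and h :: nat
  assumes prime: "prime p" and odd: "p = 2 * int h + 1"
begin

lemma h_pos: "h > 0"
  using prime odd by (cases h) auto

lemma dvd_mult_iff: "p dvd x * y \<longleftrightarrow> p dvd x \<or> p dvd y"
  using prime by (rule prime_dvd_mult_iff)

lemma chi_square: "\<not> p dvd x \<Longrightarrow> [(x^2)^h = 1] (mod p)"
  using fermat_int[OF prime, of x] odd by (simp add: power_mult[symmetric] nat_mult_distrib)

lemma chi_square_mult: "\<not> p dvd x \<Longrightarrow> [(x^2 * y)^h = y^h] (mod p)"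
  using cong_mult[OF chi_square[of x] cong_refl[of "y^h"]] by (simp add: power_mult_distrib)

lemma chi_eq_1I:
  assumes "\<not> p dvd x" "[y = x^2] (mod p)" shows "[y^h = 1] (mod p)"
  using cong_trans[OF cong_pow[OF assms(2), of h] chi_square[OF assms(1)]] .

lemma minus_one: "\<not> [-1 = (1::int)] (mod p)"
proof
  assume "[-1 = (1::int)] (mod p)"
  hence "p dvd 2" by (simp add: cong_iff_dvd_diff)
  hence "p \<le> 2" by (rule zdvd_imp_le) simp
  thus False using odd h_pos by linarith
qed

section \<open>Local square classes at a prime dividing the twist exactly once\<close>

context
  fixes G G' a0 b0 c d N n n' t y :: int and i :: nat
  assumes G: "G = p * G'" "\<not> p dvd G'" and d: "\<not> p dvd d" "[d^h = 1] (mod p)"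
    and N: "N = a0^2 + c*a0*b0 + d*b0^2" "N \<noteq> 0" and sq: "G * a0 * b0 * N = y^2"
    and n: "N = n * t^2" "n = p^i * n'" "\<not> p dvd n'"
begin

text \<open>A twist by \<open>G\<close> with \<open>p\<close> dividing \<open>G\<close> exactly once has additive reduction at \<open>p\<close>, so a local point is
  congruent to a 2-torsion point.  This pins down the square class of \<open>N\<close> modulo \<open>p\<close>.\<close>

lemma local_square_class:
  "even i \<and> [n'^h = 1] (mod p) \<or>
    odd i \<and> (\<exists>a b. \<not> p dvd a \<and> \<not> p dvd b \<and> p dvd a^2 + c*a*b + d*b^2 \<and> [(n' * G' * a * b)^h = 1] (mod p))"
proof -
  have pp: "prime_elem p" "\<not> is_unit p" using prime by auto
  \<comment> \<open>Values of coprime polynomials at an integer need not be coprime, so their gcd is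
    split off first.\<close>
  define g where "g = gcd a0 b0"
  have g0: "g \<noteq> 0" using N by (auto simp: g_def)
  obtain a b where "a0 = a * g" "b0 = b * g" "coprime a b"
    using gcd_coprime_exists[of a0 b0] g0 unfolding g_def by blast
  hence ab: "a0 = g * a" "b0 = g * b" "coprime a b" by (simp_all only: mult.commute)
  define N1 where "N1 = a^2 + c*a*b + d*b^2"
  have N1: "N = g^2 * N1" unfolding N ab N1_def by (simp add: algebra_simps power2_eq_square)
  hence N10: "N1 \<noteq> 0" using N by auto
  have "(g^2)^2 * (G*a*b*N1) = y^2" using sq unfolding N1 ab by (simp add: algebra_simps power2_eq_square)
  hence "g^2 dvd y" by (metis dvd_triv_left pos2 pow_divides_pow_iff)
  then obtain y1 where y1: "y = g^2 * y1" by auto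
  have sq1: "G*a*b*N1 = y1^2" using \<open>(g^2)^2 * (G*a*b*N1) = y^2\<close> g0 unfolding y1 by (simp add: power_mult_distrib)
  have t0: "t \<noteq> 0" using n N by auto
  obtain gg g' where g': "g = p^gg * g'" "\<not> p dvd g'" using multiplicity_decompose'[OF g0 pp(2)] by metis
  obtain tt t' where t': "t = p^tt * t'" "\<not> p dvd t'" using multiplicity_decompose'[OF t0 pp(2)] by metis
  obtain j N' where N': "N1 = p^j * N'" "\<not> p dvd N'" using multiplicity_decompose'[OF N10 pp(2)] by metis
  have unique: "k = l \<and> x = z" if "p^k * x = p^l * z" "\<not> p dvd x" "\<not> p dvd z" for k l x z
  proof -
    have aux: "\<not> k < l" if "p^k * x = p^l * z" "\<not> p dvd x" for k l x z
    proof
      assume "k < l"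
      hence "p^l = p^k * p^(l-k)" by (simp flip: power_add)
      hence "x = p^(l-k) * z" using that prime by auto
      thus False using that \<open>k < l\<close> by (simp add: dvd_power)
    qed
    have "k = l" using aux[OF that(1,2)] aux[OF that(1)[symmetric] that(3)] by simp
    thus ?thesis using that(1) prime by auto
  qed
  \<comment> \<open>\<open>g^2 * N1\<close> and \<open>n * t^2\<close> are the same number:
    comparing powers of \<open>p\<close> gives \<open>i\<close> the parity of \<open>j\<close>, and
    comparing the prime-to-\<open>p\<close> parts gives \<open>n'\<close> and \<open>N'\<close> the
    same character.\<close>
  have "p^(2*gg+j) * (g'^2*N') = p^(i+2*tt) * (n' * t'^2)"
    using N1 n unfolding g' t' N' by (simp add: power_add power_mult algebra_simps power2_eq_square)
  hence e1: "2*gg+j = i+2*tt" "g'^2*N' = n' * t'^2"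
    using unique[of "2*gg+j" "g'^2*N'" "i+2*tt" "n' * t'^2"] g' t' N' n prime by (auto simp: dvd_mult_iff prime_dvd_power_iff)
  have chiN: "[n'^h = N'^h] (mod p)"
    using chi_square_mult[OF g'(2), of N'] chi_square_mult[OF t'(2), of n'] unfolding e1(2)
    by (metis cong_sym cong_trans mult.commute)
  show ?thesis
  proof (cases "j = 0")
    case True
    \<comment> \<open>Now \<open>p\<close> divides \<open>y1\<close>, so \<open>p^2\<close> divides
      \<open>G*a*b*N1\<close>, and since \<open>p\<close> divides \<open>G\<close> only once it
      divides \<open>a\<close> or \<open>b\<close>. Then \<open>N1\<close> is congruent to
      \<open>d*b^2\<close> or to \<open>a^2\<close>, both of character 1.\<close>
    have "even i" using e1(1) True by presburger
    have "\<not> p dvd N1" using N' True by simp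
    have "p dvd y1^2" unfolding sq1[symmetric] G by simp
    hence "p dvd y1" using prime prime_dvd_power by blast
    hence "p^2 dvd y1^2" by (rule dvd_power_same)
    hence "p * p dvd p * (G' * (a * b * N1))" unfolding sq1[symmetric] G by (simp add: power2_eq_square mult.assoc)
    hence "p dvd G' * (a * b * N1)" using prime by simp
    hence "p dvd a \<or> p dvd b" using G(2) \<open>\<not> p dvd N1\<close> by (simp add: dvd_mult_iff)
    hence "[N1^h = 1] (mod p)"
    proof
      assume a: "p dvd a"
      hence "\<not> p dvd b" using ab(3) prime by (meson coprime_common_divisor not_prime_unit)
      have "N1 - b^2 * d = a * (a + c*b)" by (simp add: N1_def algebra_simps power2_eq_square)
      hence "[N1 = b^2 * d] (mod p)" using a by (simp add: cong_iff_dvd_diff)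
      thus ?thesis using chi_square_mult[OF \<open>\<not> p dvd b\<close>] d(2) by (meson cong_pow cong_trans)
    next
      assume b: "p dvd b"
      hence "\<not> p dvd a" using ab(3) prime by (meson coprime_common_divisor not_prime_unit)
      have "N1 - a^2 = b * (c*a + d*b)" by (simp add: N1_def algebra_simps power2_eq_square)
      hence "[N1 = a^2] (mod p)" using b by (simp add: cong_iff_dvd_diff)
      thus ?thesis using chi_eq_1I \<open>\<not> p dvd a\<close> by blast
    qed
    thus ?thesis using \<open>even i\<close> chiN True N' cong_trans by auto
  next
    case False
    hence pN1: "p dvd N1" using N' by simp
    have na: "\<not> p dvd a"
    proof
      assume a: "p dvd a"
      have "d*b^2 = N1 - a * (a + c*b)" by (simp add: N1_def algebra_simps power2_eq_square)
      hence "p dvd d*b^2" using a pN1 by simp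
      hence "p dvd b" using d prime by (simp add: dvd_mult_iff prime_dvd_power_iff)
      thus False using a ab(3) prime by (meson coprime_common_divisor not_prime_unit)
    qed
    have nb: "\<not> p dvd b"
    proof
      assume b: "p dvd b"
      have "a^2 = N1 - b * (c*a + d*b)" by (simp add: N1_def algebra_simps power2_eq_square)
      hence "p dvd a^2" using b pN1 by simp
      thus False using na prime prime_dvd_power by blast
    qed
    have y10: "y1 \<noteq> 0" using sq1 G na nb N10 prime by auto
    obtain yy y' where y': "y1 = p^yy * y'" "\<not> p dvd y'" using multiplicity_decompose'[OF y10 pp(2)] by metis
    have "p^(1+j) * (G'*a*b*N') = p^(2*yy) * y'^2" using sq1 unfolding G N' y'
      by (simp add: power_add power_mult algebra_simps power2_eq_square)
    hence e2: "1+j = 2*yy" "G'*a*b*N' = y'^2"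
      using unique[of "1+j" "G'*a*b*N'" "2*yy" "y'^2"] y' N' na nb G prime by (auto simp: dvd_mult_iff prime_dvd_power_iff)
    have "odd i" using e1(1) e2(1) by presburger
    have "[(G'*a*b)^h * N'^h = 1] (mod p)"
      using chi_square[OF y'(2)] unfolding e2(2)[symmetric] by (simp add: power_mult_distrib)
    hence "[(G'*a*b)^h * n'^h = 1] (mod p)"
      using cong_mult[OF cong_refl chiN] cong_trans by blast
    hence "[(n' * G' * a * b)^h = 1] (mod p)" by (simp add: power_mult_distrib ac_simps)
    thus ?thesis using \<open>odd i\<close> na nb pN1 unfolding N1_def by blast
  qed
qed

text \<open>With a nonresidue as discriminant the quadratic has no root modulo \<open>p\<close>,
  which rules out the second alternative of \<open>local_square_class\<close>.\<close>

lemma local_inert: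
  assumes D: "[(c^2-4*d)^h = -1] (mod p)"
  shows "even i \<and> [n'^h = 1] (mod p)"
proof -
  have False if ab: "\<not> p dvd a" "\<not> p dvd b" "p dvd a^2 + c*a*b + d*b^2" for a b
  proof -
    have "(2*a+c*b)^2 - b^2*(c^2-4*d) = 4*(a^2 + c*a*b + d*b^2)" by (simp add: algebra_simps power2_eq_square)
    hence 1: "[(2*a+c*b)^2 = b^2*(c^2-4*d)] (mod p)" using ab(3) by (metis cong_iff_dvd_diff dvd_mult)
    from cong_pow[OF this, of h] chi_square_mult[OF ab(2), of "c^2-4*d"] D
    have 2: "[((2*a+c*b)^2)^h = -1] (mod p)" by (meson cong_trans)
    show False
    proof (cases "p dvd 2*a+c*b")
      case True
      hence "p dvd (2*a+c*b)^(2*h)" using h_pos by (meson dvd_power dvd_trans nat_0_less_mult_iff pos2)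
      hence "[((2*a+c*b)^2)^h = 0] (mod p)" by (simp add: cong_0_iff power_mult)
      hence "[-1 = (0::int)] (mod p)" using 2 by (meson cong_sym cong_trans)
      thus False using prime by (metis cong_0_iff dvd_minus_iff not_prime_unit)
    next
      case False
      from chi_square[OF this] 2 have "[-1 = (1::int)] (mod p)" by (meson cong_sym cong_trans)
      thus False using minus_one by simp
    qed
  qed
  thus ?thesis using local_square_class by blast
qed

text \<open>In the odd case \<open>a\<close> is congruent to \<open>r*b\<close> or
  \<open>r'*b\<close>, so \<open>a*b\<close> has the character of \<open>r\<close> or of
  \<open>r'\<close>; these agree because \<open>r*r'\<close> is congruent to \<open>d\<close>, of
  character 1. The exponent \<open>i\<close> on \<open>G'*r\<close> merges the even and the odd case
  into one condition.\<close>

lemma local_split: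
  assumes r: "p dvd r + r' + c" "p dvd r * r' - d"
  shows "[(n' * (G'*r)^i)^h = 1] (mod p)"
proof -
  have nr: "\<not> p dvd r" "\<not> p dvd r'" using r(2) d(1) by (metis dvd_diff_right_iff dvd_mult dvd_mult2)+
  have GR: "\<not> p dvd (G'*r)^k" for k using G(2) nr prime by (metis dvd_mult_iff prime_dvd_power)
  consider "even i" "[n'^h = 1] (mod p)" |
    a b where "odd i" "\<not> p dvd a" "\<not> p dvd b" "p dvd a^2 + c*a*b + d*b^2" "[(n' * G' * a * b)^h = 1] (mod p)"
    using local_square_class by blast
  thus ?thesis
  proof cases
    case 1
    then obtain k where "i = 2*k" by auto
    hence "[((G'*r)^i)^h = 1] (mod p)" using chi_square[OF GR, of k] by (simp add: power_mult ac_simps)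
    from cong_mult[OF 1(2) this] show ?thesis by (simp add: power_mult_distrib)
  next
    case 2
    have "(a^2 + c*a*b + d*b^2) - (a - r*b)*(a-r'*b) = (r+r'+c)*a*b - (r*r'-d)*b^2"
      by (simp add: algebra_simps power2_eq_square)
    hence "p dvd (a^2 + c*a*b + d*b^2) - (a - r*b)*(a-r'*b)" using r by simp
    hence "p dvd (a - r*b)*(a-r'*b)" using 2(4) by (simp add: dvd_diff_right_iff)
    hence "p dvd a - r*b \<or> p dvd a - r'*b" by (simp add: dvd_mult_iff)
    hence "[(a*b)^h = r^h] (mod p)"
    proof
      assume "p dvd a - r*b"
      hence "[a*b = (r*b)*b] (mod p)" by (intro cong_mult cong_refl) (simp add: cong_iff_dvd_diff)
      hence "[a*b = b^2*r] (mod p)" by (simp add: power2_eq_square ac_simps)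
      thus ?thesis using chi_square_mult[OF 2(3), of r] by (meson cong_pow cong_trans)
    next
      assume "p dvd a - r'*b"
      hence "[a*b = (r'*b)*b] (mod p)" by (intro cong_mult cong_refl) (simp add: cong_iff_dvd_diff)
      hence "[a*b = b^2*r'] (mod p)" by (simp add: power2_eq_square ac_simps)
      hence 1: "[(a*b)^h = r'^h] (mod p)" using chi_square_mult[OF 2(3), of r'] by (meson cong_pow cong_trans)
      have "[(r*r')^h = d^h] (mod p)" using r(2) by (intro cong_pow) (simp add: cong_iff_dvd_diff)
      hence "[r^h*r'^h = 1] (mod p)" using d(2) by (metis cong_trans power_mult_distrib)
      moreover have "[r^h * r^h = 1] (mod p)" using chi_square[OF nr(1)] by (simp add: power2_eq_square power_mult_distrib)
      ultimately have "[r^h * r'^h = r^h * r^h] (mod p)" by (meson cong_sym cong_trans)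
      moreover have "coprime (r^h) p" using nr(1) prime by (metis coprime_commute prime_dvd_power prime_imp_coprime)
      ultimately have "[r'^h = r^h] (mod p)" using cong_mult_lcancel by blast
      thus ?thesis using 1 cong_trans by blast
    qed
    from cong_mult[OF cong_refl[of "(n'*G')^h"] this]
    have "[(n'*G'*r)^h = (n'*G'*a*b)^h] (mod p)" by (simp add: power_mult_distrib mult.assoc cong_sym)
    hence 3: "[(n'*G'*r)^h = 1] (mod p)" using 2(5) by (rule cong_trans)
    obtain k where i: "i = 2*k+1" using 2(1) by (elim oddE)
    have "n' * (G'*r)^i = ((G'*r)^k)^2 * (n'*G'*r)" unfolding i power_add power_even_eq power_one_right
      by (simp only: ac_simps)
    thus ?thesis using cong_trans[OF chi_square_mult[OF GR[of k], of "n'*G'*r"] 3] by (simp only:)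
  qed
qed

end

text \<open>Turns a multiplicative condition into a linear equation modulo 2: a factor contributes
  its exponent exactly when it is a nonresidue, as marked by \<open>s\<close>.\<close>

lemma parity_of_character:
  fixes v :: "nat \<Rightarrow> int" and e :: "nat \<Rightarrow> nat" and s :: "nat \<Rightarrow> bool"
  assumes "[prod (\<lambda>i. v i ^ e i) {..<n} ^ h = 1] (mod p)" "\<And>i. i < n \<Longrightarrow> v i ^ h mod p = (if s i then p - 1 else 1)"
  shows "even (\<Sum>i<n. if s i then e i else 0)"
proof -
  have fac: "[(v i ^ e i)^h = (-1)^(if s i then e i else 0)] (mod p)" if "i < n" for i
  proof -
    have "[v i ^ h = (if s i then p - 1 else 1)] (mod p)"
      unfolding assms(2)[OF that, symmetric] cong_def by simp
    moreover have "[(if s i then p - 1 else 1) = (if s i then -1 else 1)] (mod p)"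
      by (simp add: cong_iff_dvd_diff)
    ultimately have "[v i ^ h = (if s i then -1 else 1)] (mod p)" using cong_trans by blast
    hence "[(v i ^ h) ^ e i = (if s i then -1 else 1) ^ e i] (mod p)" by (rule cong_pow)
    moreover have "(v i ^ h) ^ e i = (v i ^ e i) ^ h" by (metis mult.commute power_mult)
    moreover have "(if s i then -1 else 1) ^ e i = ((-1)::int)^(if s i then e i else 0)" by simp
    ultimately show ?thesis by (simp only:)
  qed
  define a b where "a = prod (\<lambda>i. (v i ^ e i)^h) {..<n}" and "b = prod (\<lambda>i. (-1::int)^(if s i then e i else 0)) {..<n}"
  have "[a = b] (mod p)" unfolding a_def b_def by (intro cong_prod) (use fac in auto)
  moreover have "[a = 1] (mod p)" using assms(1) unfolding a_def by (simp only: prod_power_distrib)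
  ultimately have "[b = 1] (mod p)" by (meson cong_sym cong_trans)
  moreover have "b = (-1)^(\<Sum>i<n. if s i then e i else 0)" unfolding b_def by (rule power_sum[symmetric])
  ultimately have *: "[(-1)^(\<Sum>i<n. if s i then e i else 0) = (1::int)] (mod p)" by simp
  show ?thesis
  proof (rule ccontr)
    assume "odd (\<Sum>i<n. if s i then e i else 0)"
    thus False using * minus_one by simp
  qed
qed

end

subsection \<open>Polynomials with integer coefficients\<close>

definition emb :: "int poly \<Rightarrow> Qu" where
  "emb p = to_fract (map_poly rat_of_int p)"

lemma emb_add [simp]: "emb (p + q) = emb p + emb q"
  and emb_diff [simp]: "emb (p - q) = emb p - emb q"
  and emb_uminus [simp]: "emb (- p) = - emb p"
  and emb_0 [simp]: "emb 0 = 0"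
  and emb_1 [simp]: "emb 1 = 1"
proof -
  have "map_poly rat_of_int (p + q) = map_poly of_int p + map_poly of_int q"
    "map_poly rat_of_int (p - q) = map_poly of_int p - map_poly of_int q"
    "map_poly rat_of_int (- p) = - map_poly of_int p"
    by (simp_all add: poly_eq_iff coeff_map_poly)
  thus "emb (p + q) = emb p + emb q" "emb (p - q) = emb p - emb q" "emb (- p) = - emb p" "emb 0 = 0" "emb 1 = 1"
    by (simp_all add: emb_def)
qed

lemma emb_mult [simp]: "emb (p * q) = emb p * emb q"
proof -
  have "map_poly rat_of_int (p * q) = map_poly of_int p * map_poly of_int q"
    by (simp add: poly_eq_iff coeff_map_poly coeff_mult)
  thus ?thesis by (simp add: emb_def)
qed

lemma emb_power [simp]: "emb (p ^ n) = emb p ^ n"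
  by (induction n) simp_all

lemma emb_eq_0_iff [simp]: "emb p = 0 \<longleftrightarrow> p = 0"
  by (simp add: emb_def map_poly_eq_0_iff)

lemma emb_eq_iff [simp]: "emb p = emb q \<longleftrightarrow> p = q"
  using emb_eq_0_iff[of "p - q"] by (simp del: emb_eq_0_iff)

lemma emb_const: "emb [:a:] = of_int a"
proof -
  have n: "emb (of_nat n) = of_nat n" for n by (induction n) simp_all
  have "emb (of_int a) = of_int a" by (cases a rule: int_diff_cases) (simp add: n)
  thus ?thesis by (simp add: of_int_poly)
qed

lemma emb_pCons: "emb (pCons a p) = of_int a + uu * emb p"
proof -
  have u: "emb [:0, 1:] = uu" by (simp add: emb_def uu_def map_poly_pCons to_fract_def)
  have "pCons a p = [:a:] + [:0, 1:] * p" by simp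
  hence "emb (pCons a p) = emb [:a:] + emb [:0, 1:] * emb p" by (metis emb_add emb_mult)
  thus ?thesis unfolding u emb_const .
qed

lemma clear_denominators:
  fixes p :: "rat poly"
  shows "\<exists>m q. m \<noteq> 0 \<and> Polynomial.smult (of_int m) p = map_poly rat_of_int q \<and> degree q = degree p"
proof (induction p)
  case 0
  show ?case by (rule exI[of _ 1], rule exI[of _ 0]) simp
next
  case (pCons a p)
  then obtain m q where mq: "m \<noteq> 0" "Polynomial.smult (of_int m) p = map_poly rat_of_int q" "degree q = degree p" by blast
  obtain r s where "quotient_of a = (r, s)" by (cases "quotient_of a")
  hence rs: "a = of_int r / of_int s" "s \<noteq> 0" using quotient_of_div quotient_of_denom_pos[of a r s] by auto
  have 1: "Polynomial.smult (of_int (s*m)) (pCons a p) = map_poly rat_of_int (pCons (r*m) (Polynomial.smult s q))"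
    unfolding of_int_mult smult_smult[symmetric] smult_pCons mq(2)
    using rs by (simp add: map_poly_pCons map_poly_smult)
  have "p = 0 \<longleftrightarrow> q = 0" using mq(1,2) by (metis map_poly_eq_0_iff of_int_0 of_int_eq_0_iff smult_eq_0_iff)
  hence "degree (pCons (r*m) (Polynomial.smult s q)) = degree (pCons a p)" using mq rs by simp
  thus ?case using 1 mq rs by (metis mult_eq_0_iff)
qed

lemma emb_quotient:
  fixes P Q :: "rat poly"
  assumes "Q \<noteq> 0"
  obtains p q where "q \<noteq> 0" "Fract P Q = emb p / emb q" "degree p = degree P" "degree q = degree Q"
proof -
  obtain m p where p: "m \<noteq> 0" "Polynomial.smult (of_int m) P = map_poly rat_of_int p" "degree p = degree P"
    using clear_denominators by blast
  obtain n q where q: "n \<noteq> 0" "Polynomial.smult (of_int n) Q = map_poly rat_of_int q" "degree q = degree Q"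
    using clear_denominators by blast
  have q0: "q \<noteq> 0" using q(1,2) assms by (metis map_poly_0 of_int_eq_0_iff smult_eq_0_iff)
  have "emb (Polynomial.smult n p) / emb (Polynomial.smult m q) = Fract (map_poly rat_of_int (Polynomial.smult n p)) (map_poly rat_of_int (Polynomial.smult m q))"
    by (simp add: emb_def to_fract_def)
  also have "map_poly rat_of_int (Polynomial.smult n p) = Polynomial.smult (of_int (n*m)) P"
    unfolding of_int_mult smult_smult[symmetric] p(2) by (simp add: map_poly_smult)
  also have "map_poly rat_of_int (Polynomial.smult m q) = Polynomial.smult (of_int (n*m)) Q"
    unfolding mult.commute[of n m] of_int_mult smult_smult[symmetric] q(2) by (simp add: map_poly_smult)
  also have "Fract (Polynomial.smult (of_int (n*m)) P) (Polynomial.smult (of_int (n*m)) Q) = Fract P Q"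
    using p(1) q(1) assms by (simp add: eq_fract)
  finally show ?thesis using that[of "Polynomial.smult m q" "Polynomial.smult n p"] q0 p q by simp
qed

text \<open>Coprimality is meant in \<open>Z[u]\<close>, so common integer factors are cancelled as
  well; the descent treats them as primes.\<close>

lemma emb_coprime_quotient:
  obtains p q where "q \<noteq> 0" "X = emb p / emb q" "coprime p q"
proof -
  obtain P Q where "X = Fract P Q" "Q \<noteq> 0" by (cases X) auto
  then obtain p q where pq: "q \<noteq> 0" "X = emb p / emb q" using emb_quotient by metis
  define g where "g = gcd p q"
  have "g \<noteq> 0" using pq by (simp add: g_def)
  then obtain p' q' where *: "p = p' * g" "q = q' * g" "coprime p' q'"
    using gcd_coprime_exists[of p q] unfolding g_def by blast
  have "X = emb p' / emb q'" "q' \<noteq> 0" using pq * \<open>g \<noteq> 0\<close> by auto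
  thus ?thesis using that *(3) by blast
qed

text \<open>\<open>Z[u]\<close> is factorial, hence integrally closed: the square root of a
  polynomial cannot have a denominator.\<close>

lemma emb_square:
  assumes "emb M = Y^2" obtains w where "M = w^2" "Y = emb w"
proof -
  obtain a b where ab: "b \<noteq> 0" "Y = emb a / emb b" using emb_coprime_quotient by metis
  have "emb (M * b^2) = emb (a^2)" using assms ab by (simp add: field_simps)
  hence eq: "M * b^2 = a^2" by (simp only: emb_eq_iff)
  hence "b dvd a" by (metis dvd_triv_right pos2 pow_divides_pow_iff)
  then obtain w where w: "a = b * w" by auto
  have "M = w^2" using eq ab unfolding w by (simp add: power_mult_distrib)
  moreover have "Y = emb w" using ab w by simp
  ultimately show ?thesis using that by blast
qed

lemma coprime_no_common_root:
  fixes P Q :: "int poly"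
  assumes "coprime P Q" shows "poly P u \<noteq> 0 \<or> poly Q u \<noteq> 0"
proof (rule ccontr)
  assume "\<not> ?thesis"
  hence "[:-u, 1:] dvd P" "[:-u, 1:] dvd Q" by (simp_all add: poly_eq_0_iff_dvd)
  hence "[:-u, 1:] dvd 1" using assms coprime_common_divisor by blast
  thus False by (simp add: is_unit_poly_iff)
qed

text \<open>Completing the square shows that a zero with \<open>b\<close> nonzero would make the
  discriminant a square.\<close>

lemma binary_form_anisotropic:
  fixes a b c d :: int
  assumes "\<And>k. k^2 \<noteq> c^2 - 4*d" "a^2 + c*a*b + d*b^2 = 0" shows "a = 0 \<and> b = 0"
proof -
  have eq: "(2*a+c*b)^2 = (c^2-4*d) * b^2 + 4*(a^2 + c*a*b + d*b^2)" by (simp add: algebra_simps power2_eq_square)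
  have "b = 0"
  proof (rule ccontr)
    assume b: "b \<noteq> 0"
    have "b^2 dvd (2*a+c*b)^2" unfolding eq assms(2) by simp
    hence "b dvd 2*a+c*b" by simp
    then obtain k where k: "2*a+c*b = b*k" by (elim dvdE)
    have "b^2 * k^2 = b^2 * (c^2-4*d)" using eq unfolding assms(2) k by (simp add: power_mult_distrib)
    hence "k^2 = c^2-4*d" using b by simp
    thus False using assms(1) by blast
  qed
  thus ?thesis using assms(2) by simp
qed

section \<open>Exponent vectors of square classes and their tests at a prime\<close>

definition powlist :: "'a::comm_monoid_mult list \<Rightarrow> nat list \<Rightarrow> 'a" where
  "powlist fs es = (\<Prod>i<length fs. (fs ! i) ^ (es ! i))"

text \<open>The linear form attached to a quadratic character; \<open>True\<close> marks an entry of
  character -1.\<close>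

definition marked_sum :: "bool list \<Rightarrow> nat list \<Rightarrow> nat" where
  "marked_sum ss es = (\<Sum>i<length ss. if ss ! i then es ! i else 0)"

text \<open>A point with \<open>z/g = P/Q\<close>, together with the square class of its
  \<open>N\<close> written as an exponent vector \<open>es\<close> over the candidate primes
  \<open>fs\<close>. Only the parities of \<open>es\<close> matter for the class.\<close>

locale descent_datum =
  fixes c d :: int and G P Q N w t :: "int poly" and fs :: "int poly list" and es :: "nat list"
  assumes cop: "coprime P Q" and N: "N = P^2 + [:c:] * P * Q + [:d:] * Q^2"
    and sq: "G * P * Q * N = w^2" and fac: "N = powlist fs es * t^2"
    and nonsquare: "\<And>k. k^2 \<noteq> c^2 - 4*d"
begin

text \<open>A nonzero value at every integer gives \<open>N\<close> a finite valuation at every test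
  prime.\<close>

lemma N_root: "poly N u \<noteq> 0"
proof
  assume "poly N u = 0"
  hence "poly P u ^ 2 + c * poly P u * poly Q u + d * poly Q u ^ 2 = 0" by (simp add: N)
  hence "poly P u = 0 \<and> poly Q u = 0" using binary_form_anisotropic nonsquare by blast
  thus False using coprime_no_common_root[OF cop] by blast
qed

text \<open>The prime \<open>p\<close> divides \<open>G(u)\<close> exactly once and enters through
  the single factor \<open>fs ! j\<close>; \<open>vs\<close> holds the values of the factors at
  \<open>u\<close> with that \<open>p\<close> removed. Asking that \<open>d\<close> be a residue
  makes the classes of the point at infinity and of the 2-torsion point equal at \<open>p\<close>.
  Residues are reduced before powering to keep the evaluation small.\<close>

context
  fixes p u G' :: int and h j :: nat and vs :: "int list" and ss :: "bool list"
  assumes p: "prime p" "p = 2 * int h + 1"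
    and G': "poly G u = p * G'" "\<not> p dvd G'"
    and d: "(d mod p)^h mod p = 1"
    and vs: "map (\<lambda>f. poly f u) fs = vs[j := p * vs ! j]" "j < length fs"
begin

interpretation odd_prime p h by unfold_locales fact+

lemma unit_not_dvd:
  assumes "v ^ h mod p = 1 \<or> v ^ h mod p = p - 1" shows "\<not> p dvd v"
proof
  assume "p dvd v"
  hence "p dvd v ^ h" using h_pos by (meson dvd_power dvd_trans)
  hence "v ^ h mod p = 0" by simp
  thus False using assms prime_gt_1_int[OF p(1)] by auto
qed

lemma d_unit: "\<not> p dvd d" "[d^h = 1] (mod p)"
  using unit_not_dvd[of d] d[unfolded power_mod] prime_gt_1_int[OF p(1)] by (simp_all add: cong_def)

lemma length_vs: "length vs = length fs"
  using arg_cong[OF vs(1), of length] by simp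

lemma eval_N:
  assumes "\<forall>v\<in>set vs. \<not> p dvd v"
  shows "poly N u = poly (powlist fs es) u * poly t u ^ 2"
    "poly (powlist fs es) u = p ^ (es!j) * powlist vs es" "\<not> p dvd powlist vs es"
    "poly N u = poly P u ^ 2 + c * poly P u * poly Q u + d * poly Q u ^ 2"
    "poly G u * poly P u * poly Q u * poly N u = poly w u ^ 2"
proof -
  show "poly N u = poly (powlist fs es) u * poly t u ^ 2" unfolding fac by simp
  have ev: "poly (fs ! i) u = (if i = j then p else 1) * vs ! i" if "i < length fs" for i
    using arg_cong[OF vs(1), of "\<lambda>l. l ! i"] that length_vs vs(2) by (simp add: nth_list_update)
  have "poly (powlist fs es) u = (\<Prod>i<length fs. ((if i = j then p else 1) * vs ! i) ^ (es ! i))"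
    unfolding powlist_def by (simp add: poly_prod ev)
  also have "\<dots> = (\<Prod>i<length fs. if i = j then p ^ (es!i) else 1) * powlist vs es"
    unfolding powlist_def length_vs prod.distrib[symmetric] by (intro prod.cong refl) (auto simp: power_mult_distrib)
  also have "(\<Prod>i<length fs. if i = j then p ^ (es!i) else 1) = p ^ (es!j)"
    using vs(2) by simp
  finally show "poly (powlist fs es) u = p ^ (es!j) * powlist vs es" .
  have "\<not> p dvd (vs ! i) ^ (es ! i)" if "i < length vs" for i
    using assms that prime_dvd_power[OF p(1)] by (meson nth_mem)
  thus "\<not> p dvd powlist vs es"
    unfolding powlist_def using p(1) by (auto simp: prime_dvd_prod_iff)
  show "poly N u = poly P u ^ 2 + c * poly P u * poly Q u + d * poly Q u ^ 2" by (simp add: N)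
  show "poly G u * poly P u * poly Q u * poly N u = poly w u ^ 2"
    using arg_cong[OF sq, of "\<lambda>f. poly f u"] by simp
qed

lemma parity_list:
  assumes "[powlist vs es ^ h = 1] (mod p)" "map (\<lambda>v. v ^ h mod p) vs = map (\<lambda>b. if b then p - 1 else 1) ss"
  shows "even (marked_sum ss es)"
proof -
  have l: "length ss = length vs" using arg_cong[OF assms(2), of length] by simp
  show ?thesis unfolding marked_sum_def l
  proof (rule parity_of_character)
    show "[(\<Prod>i<length vs. vs ! i ^ es ! i) ^ h = 1] (mod p)" using assms(1) unfolding powlist_def .
    show "vs ! i ^ h mod p = (if ss ! i then p - 1 else 1)" if "i < length vs" for i
      using arg_cong[OF assms(2), of "\<lambda>l. l ! i"] that l by simp
  qed
qed

lemma units_of_map: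
  assumes "map (\<lambda>v. v ^ h mod p) vs = map (\<lambda>b. if b then p - 1 else 1) ss"
  shows "\<forall>v\<in>set vs. \<not> p dvd v"
proof
  fix v assume "v \<in> set vs"
  hence "v ^ h mod p \<in> set (map (\<lambda>v. v ^ h mod p) vs)" by simp
  hence "v ^ h mod p = 1 \<or> v ^ h mod p = p - 1" unfolding assms by auto
  thus "\<not> p dvd v" by (rule unit_not_dvd)
qed

text \<open>One prime yields two equations: the factor containing \<open>p\<close> has an even
  exponent, and the rest of the product is a residue.\<close>

lemma test_inert:
  assumes D: "((c^2-4*d) mod p)^h mod p = p - 1"
    and ss: "map (\<lambda>v. (v mod p) ^ h mod p) vs = map (\<lambda>b. if b then p - 1 else 1) ss"
  shows "even (es ! j)" "even (marked_sum ss es)"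
proof -
  note D = D[unfolded power_mod] and ss = ss[unfolded power_mod]
  note ev = eval_N[OF units_of_map[OF ss]]
  have "[(c^2-4*d)^h = p - 1] (mod p)" unfolding D[symmetric] cong_def by simp
  moreover have "[p - 1 = - 1] (mod p)" by (simp add: cong_iff_dvd_diff)
  ultimately have D': "[(c^2-4*d)^h = - 1] (mod p)" by (rule cong_trans)
  have *: "even (es ! j) \<and> [powlist vs es ^ h = 1] (mod p)"
    by (rule local_inert[OF G' d_unit ev(4) N_root ev(5) ev(1) ev(2) ev(3) D'])
  thus "even (es ! j)" by blast
  show "even (marked_sum ss es)" using parity_list[OF _ ss] * by blast
qed

text \<open>Entry \<open>j\<close> is multiplied by \<open>G'*r\<close> because the condition of
  \<open>local_split\<close> contains \<open>(G'*r)^i\<close> with \<open>i = es ! j\<close>; it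
  then has the same shape as the inert one.\<close>

lemma test_split:
  assumes r: "p dvd r + r' + c" "p dvd r * r' - d"
    and nd: "list_all (\<lambda>v. \<not> p dvd v) vs"
    and ss: "map (\<lambda>v. (v mod p) ^ h mod p) (vs[j := vs ! j * (G' * r)]) = map (\<lambda>b. if b then p - 1 else 1) ss"
  shows "even (marked_sum ss es)"
proof -
  note ss = ss[unfolded power_mod]
  have nd': "\<forall>v\<in>set vs. \<not> p dvd v" using nd by (simp add: list_all_iff)
  note ev = eval_N[OF nd']
  have *: "[(powlist vs es * (G' * r) ^ (es ! j)) ^ h = 1] (mod p)"
    by (rule local_split[OF G' d_unit ev(4) N_root ev(5) ev(1) ev(2) ev(3) r])
  have jl: "j < length vs" using vs(2) length_vs by simp
  have "powlist (vs[j := vs ! j * (G' * r)]) es = (\<Prod>i<length vs. vs ! i ^ es ! i * (if i = j then (G' * r) ^ (es ! i) else 1))"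
    unfolding powlist_def length_list_update using jl
    by (intro prod.cong refl) (auto simp: nth_list_update power_mult_distrib)
  also have "\<dots> = powlist vs es * (G' * r) ^ (es ! j)"
    unfolding powlist_def prod.distrib using jl by simp
  finally have **: "powlist (vs[j := vs ! j * (G' * r)]) es = powlist vs es * (G' * r) ^ (es ! j)" .
  define vs' where "vs' = vs[j := vs ! j * (G' * r)]"
  have l: "length ss = length vs'" using arg_cong[OF ss, of length] by (simp add: vs'_def)
  show ?thesis unfolding marked_sum_def l
  proof (rule parity_of_character)
    show "[(\<Prod>i<length vs'. vs' ! i ^ es ! i) ^ h = 1] (mod p)"
      using *[folded **] unfolding powlist_def vs'_def .
    show "vs' ! i ^ h mod p = (if ss ! i then p - 1 else 1)" if "i < length vs'" for i
      using arg_cong[OF ss, of "\<lambda>l. l ! i"] that l unfolding vs'_def by simp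
  qed
qed

end

end

subsection \<open>Irreducible integer polynomials\<close>

lemma nonsquare_between:
  fixes k n r :: int
  assumes "0 \<le> r" "r^2 < n" "n < (r+1)^2" shows "k^2 \<noteq> n"
proof
  assume k: "k^2 = n"
  have "r < \<bar>k\<bar>" using assms(1,2) k by (metis abs_ge_zero power2_abs power2_less_imp_less)
  moreover have "\<bar>k\<bar> < r + 1" using assms(1,3) k by (metis add_nonneg_nonneg power2_abs power2_less_imp_less zero_le_one)
  ultimately show False by simp
qed

lemma binary_form_pos:
  fixes A B C X Y :: int
  assumes "B^2 < 4*A*C" "Y \<noteq> 0" shows "A*X^2 + B*X*Y + C*Y^2 \<noteq> 0"
proof
  assume 0: "A*X^2 + B*X*Y + C*Y^2 = 0"
  have "(2*A*X+B*Y)^2 + (4*A*C-B^2)*Y^2 = 4*A*(A*X^2 + B*X*Y + C*Y^2)" by (simp add: algebra_simps power2_eq_square)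
  moreover have "(4*A*C-B^2)*Y^2 > 0" using assms by simp
  ultimately show False using 0 by (metis add_nonneg_pos less_irrefl mult_zero_right zero_le_power2)
qed

lemma poly_of_degree_1: "degree b \<le> 1 \<Longrightarrow> b = [:poly.coeff b 0, poly.coeff b 1:]"
  and poly_of_degree_2: "degree b \<le> 2 \<Longrightarrow> b = [:poly.coeff b 0, poly.coeff b 1, poly.coeff b 2:]"
  and poly_of_degree_3: "degree b \<le> 3 \<Longrightarrow> b = [:poly.coeff b 0, poly.coeff b 1, poly.coeff b 2, poly.coeff b 3:]"
  by (auto simp: poly_eq_iff coeff_pCons numeral_2_eq_2 numeral_3_eq_3 coeff_eq_0 split: nat.split)

lemma const_factor_unit:
  fixes a b :: "int poly"
  assumes "content (a * b) = 1" "degree a = 0" shows "is_unit a"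
proof -
  obtain k where k: "a = [:k:]" using assms(2) degree_eq_zeroE by blast
  have "[:k:] dvd a * b" unfolding k by (rule dvd_triv_left)
  hence "k dvd 1" unfolding const_poly_dvd_iff_dvd_content assms(1) .
  thus ?thesis by (simp add: k is_unit_const_poly_iff)
qed

lemma irreducible_quadratic:
  fixes A B C :: int
  assumes "B^2 < 4*A*C" "content [:C, B, A:] = 1" shows "irreducible [:C, B, A:]"
proof (rule irreducibleI)
  have A0: "A \<noteq> 0" using assms(1) by auto
  show "[:C, B, A:] \<noteq> 0" using A0 by simp
  show "\<not> is_unit [:C, B, A:]" using A0 by (simp add: is_unit_poly_iff)
  fix a b assume ab: "[:C, B, A:] = a * b"
  have "a \<noteq> 0" "b \<noteq> 0" using ab A0 by auto
  hence deg: "degree a + degree b = 2" using arg_cong[OF ab, of degree] A0 by (simp add: degree_mult_eq)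
  show "is_unit a \<or> is_unit b"
  proof (cases "degree a = 0 \<or> degree b = 0")
    case True
    thus ?thesis using const_factor_unit[of a b] const_factor_unit[of b a] assms(2) ab by (auto simp: mult.commute)
  next
    case False
    hence "degree a = 1" "degree b = 1" using deg by linarith+
    define x y z v where "x = poly.coeff a 0" and "y = poly.coeff a 1" and "z = poly.coeff b 0" and "v = poly.coeff b 1"
    have "a = [:x, y:]" "b = [:z, v:]"
      using poly_of_degree_1[of a] poly_of_degree_1[of b] \<open>degree a = 1\<close> \<open>degree b = 1\<close>
      unfolding x_def y_def z_def v_def by simp_all
    hence e: "C = x*z" "B = x*v+y*z" "A = y*v" using ab by simp_all
    have "y \<noteq> 0" using e A0 by auto
    from binary_form_pos[OF assms(1) this, of "-x"] show ?thesis unfolding e by (simp add: algebra_simps power2_eq_square)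
  qed
qed

text \<open>Negative \<open>B^2 - 4*A*C\<close> excludes real roots, hence linear factors, and also
  a product of two quadratics in \<open>u^2\<close>. If the quadratic factors have nonzero linear
  terms, then \<open>r = a2*b0 = a0*b2\<close> satisfies \<open>r^2 = A*C\<close>, and
  \<open>A*(2*r-B)\<close> is the square of \<open>a1*b2\<close>.\<close>

lemma irreducible_biquadratic:
  fixes A B C :: int
  assumes disc: "B^2 < 4*A*C" and cont: "content [:C, 0, B, 0, A:] = 1"
    and nsq: "\<And>r s. r^2 = A*C \<Longrightarrow> s^2 \<noteq> A*(2*r-B)"
  shows "irreducible [:C, 0, B, 0, A:]"
proof (rule irreducibleI)
  have A0: "A \<noteq> 0" using assms(1) by auto
  show "[:C, 0, B, 0, A:] \<noteq> 0" using A0 by simp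
  show "\<not> is_unit [:C, 0, B, 0, A:]" using A0 by (simp add: is_unit_poly_iff)
  have aux: "is_unit a \<or> is_unit b" if ab: "[:C, 0, B, 0, A:] = a * b" and le: "degree a \<le> degree b" for a b
  proof -
    have "a \<noteq> 0" "b \<noteq> 0" using ab A0 by auto
    hence deg: "degree a + degree b = 4" using arg_cong[OF ab, of degree] A0 by (simp add: degree_mult_eq)
    consider "degree a = 0" | "degree a = 1" "degree b = 3" | "degree a = 2" "degree b = 2" using deg le by linarith
    thus ?thesis
    proof cases
      case 1
      thus ?thesis using const_factor_unit[of a b] cont ab by simp
    next
      case 2
      define x y where "x = poly.coeff a 0" and "y = poly.coeff a 1"
      define b0 b1 b2 b3 where "b0 = poly.coeff b 0" and "b1 = poly.coeff b 1" and "b2 = poly.coeff b 2" and "b3 = poly.coeff b 3"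
      have "a = [:x, y:]" "b = [:b0, b1, b2, b3:]"
        using poly_of_degree_1[of a] poly_of_degree_3[of b] 2
        unfolding x_def y_def b0_def b1_def b2_def b3_def by simp_all
      hence e: "C = x*b0" "0 = x*b1+y*b0" "B = x*b2+y*b1" "0 = x*b3+y*b2" "A = y*b3"
        using ab by (simp_all add: ac_simps)
      have "A*(x^2)^2 + B*x^2*y^2 + C*(y^2)^2 = (x*b3+y*b2)*(y*x^3) + (x*b1+y*b0)*(x*y^3)"
        unfolding e(1,3,5) by (simp add: algebra_simps power2_eq_square power3_eq_cube)
      hence "A*(x^2)^2 + B*x^2*y^2 + C*(y^2)^2 = 0" unfolding e(2,4)[symmetric] by simp
      moreover have "y^2 \<noteq> 0" using e A0 by auto
      ultimately show ?thesis using binary_form_pos[OF disc] by blast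
    next
      case 3
      define a0 a1 a2 b0 b1 b2 where "a0 = poly.coeff a 0" and "a1 = poly.coeff a 1" and "a2 = poly.coeff a 2"
        and "b0 = poly.coeff b 0" and "b1 = poly.coeff b 1" and "b2 = poly.coeff b 2"
      have "a = [:a0, a1, a2:]" "b = [:b0, b1, b2:]"
        using poly_of_degree_2[of a] poly_of_degree_2[of b] 3
        unfolding a0_def a1_def a2_def b0_def b1_def b2_def by simp_all
      hence e: "C = a0*b0" "a0*b1+a1*b0 = 0" "B = a0*b2+a1*b1+a2*b0" "a1*b2+a2*b1 = 0" "A = a2*b2"
        using ab by (simp_all add: ac_simps)
      show ?thesis
      proof (cases "a1 = 0")
        case True
        hence "b1 = 0" using e A0 by auto
        hence "B^2 - 4*A*C = (a2*b0-a0*b2)^2" unfolding e using True by (simp add: algebra_simps power2_eq_square)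
        thus ?thesis using disc by (smt (verit) zero_le_power2)
      next
        case False
        have "a1*(a2*b0-a0*b2) = a2*(a0*b1+a1*b0) - a0*(a1*b2+a2*b1)" by (simp add: algebra_simps)
        hence eq: "a2*b0 = a0*b2" using False unfolding e by simp
        have 1: "(a2*b0)^2 = A*C" unfolding e using eq by (simp add: power2_eq_square algebra_simps)
        have "A*(2*(a2*b0)-B) - (a1*b2)^2 = a2*b2*(a2*b0-a0*b2) - a1*b2*(a1*b2+a2*b1)"
          unfolding e(3,5) by (simp add: power2_eq_square algebra_simps)
        hence "(a1*b2)^2 = A*(2*(a2*b0)-B)" using eq e(4) by simp
        thus ?thesis using nsq[OF 1] by blast
      qed
    qed
  qed
  fix a b assume "[:C, 0, B, 0, A:] = a * b"
  thus "is_unit a \<or> is_unit b" using aux[of a b] aux[of b a] by (metis linear mult.commute)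
qed

lemma int_poly_unit:
  fixes v :: "int poly"
  assumes "is_unit v" shows "v = 1 \<or> v = -1"
proof -
  obtain k where k: "v = [:k:]" "k dvd 1" using iffD1[OF is_unit_poly_iff assms] by blast
  have "\<bar>k\<bar> = 1" using k(2) by simp
  hence "k = 1 \<or> k = -1" by linarith
  thus ?thesis using k(1) by (auto simp: one_pCons)
qed

lemma powlist_Cons: "powlist (f # fs) (e # es) = f ^ e * powlist fs es"
  by (simp add: powlist_def lessThan_Suc_eq_insert_0 prod.atLeast1_atMost_eq image_iff prod.reindex)

lemma powlist_Nil [simp]: "powlist [] es = 1" by (simp add: powlist_def)

lemma powlist_square:
  assumes "list_all2 (\<lambda>a b. even (a + b)) es ms" "length fs = length es"
  shows "\<exists>s. powlist fs es * powlist fs ms = s^2"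
  using assms
proof (induction arbitrary: fs rule: list_all2_induct)
  case Nil
  thus ?case by (intro exI[of _ 1]) simp
next
  case (Cons x xs y ys)
  then obtain g gs where fs: "fs = g # gs" by (cases fs) auto
  obtain s where s: "powlist gs xs * powlist gs ys = s^2" using Cons fs by auto
  obtain k where k: "x + y = 2 * k" using Cons.hyps(1) by (elim evenE)
  have "powlist fs (x # xs) * powlist fs (y # ys) = g^(x+y) * (powlist gs xs * powlist gs ys)"
    unfolding fs powlist_Cons by (simp add: power_add ac_simps)
  also have "\<dots> = (g^k * s)^2" unfolding k s by (simp add: power_mult_distrib power_even_eq)
  finally show ?case by blast
qed

text \<open>A common prime of \<open>N\<close> and \<open>G*P*Q\<close> cannot divide
  \<open>Q\<close>, since it would divide \<open>P\<close> too; if it divides \<open>P\<close> it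
  divides \<open>d\<close>, and otherwise \<open>G\<close>. The extra entry \<open>[:-1:]\<close>
  records the unit, and the power \<open>m\<close> allows for repeated primes in
  \<open>d*G\<close>.\<close>

lemma descent_decomposition:
  fixes c d :: int and G P Q N w :: "int poly"
  assumes cop: "coprime P Q" and N: "N = P^2 + [:c:] * P * Q + [:d:] * Q^2"
    and sq: "G * P * Q * N = w^2" and nonsquare: "\<And>k. k^2 \<noteq> c^2 - 4*d"
    and fs: "\<forall>f\<in>set fs. prime_elem f" and dG: "[:d:] * G dvd prod_list fs ^ m"
  obtains es t where "length es = Suc (length fs)" "descent_datum c d G P Q N w t ([:-1:] # fs) es"
proof -
  have N0: "N \<noteq> 0"
  proof
    assume "N = 0"
    hence "poly N 0 = 0" by simp
    hence "poly P 0 ^ 2 + c * poly P 0 * poly Q 0 + d * poly Q 0 ^ 2 = 0" by (simp add: N)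
    hence "poly P 0 = 0 \<and> poly Q 0 = 0" using binary_form_anisotropic nonsquare by blast
    thus False using coprime_no_common_root[OF cop] by blast
  qed
  have "\<exists>e v t. is_unit v \<and> N = v * (\<Prod>i<length fs. (fs ! i) ^ e i) * t^2"
  proof (rule square_class_decomposition[OF N0])
    show "N * (G * P * Q) = w^2" using sq by (simp add: ac_simps)
    show "prime_elem (fs ! i)" if "i < length fs" for i using fs that by simp
    fix p assume p: "prime_elem p" "p dvd N" "p dvd G * P * Q"
    have unit: "\<not> (p dvd P \<and> p dvd Q)" using cop p(1) coprime_common_divisor prime_elem_not_unit by blast
    have 1: "[:d:] * Q^2 = N - P * (P + [:c:] * Q)" unfolding N by (simp add: algebra_simps power2_eq_square)
    have 2: "P^2 = N - Q * ([:c:] * P + [:d:] * Q)" unfolding N by (simp add: algebra_simps power2_eq_square)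
    have nQ: "\<not> p dvd Q"
    proof
      assume Q: "p dvd Q"
      hence "p dvd P^2" unfolding 2 using p(2) by (simp add: dvd_diff)
      thus False using unit Q p(1) prime_elem_dvd_power by blast
    qed
    have "p dvd [:d:] * G"
    proof (cases "p dvd P")
      case True
      hence "p dvd [:d:] * Q^2" unfolding 1 using p(2) by (simp add: dvd_diff)
      hence "p dvd [:d:]" using nQ p(1) by (meson prime_elem_dvd_multD prime_elem_dvd_power)
      thus ?thesis by (rule dvd_mult2)
    next
      case False
      hence "p dvd G" using p nQ by (meson prime_elem_dvd_multD)
      thus ?thesis by (rule dvd_mult)
    qed
    hence "p dvd prod_list fs" using dG p(1) by (meson dvd_trans prime_elem_dvd_power)
    hence "\<exists>f\<in>set fs. p dvd f"
    proof (induction fs)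
      case Nil thus ?case using p(1) prime_elem_not_unit by auto
    next
      case (Cons a fs) thus ?case using p(1) by (auto simp: prime_elem_dvd_mult_iff)
    qed
    thus "\<exists>i<length fs. p dvd fs ! i" by (auto simp: in_set_conv_nth)
  qed
  then obtain e v t where v: "is_unit v" and Ne: "N = v * (\<Prod>i<length fs. (fs ! i) ^ e i) * t^2" by blast
  define es where "es = (if v = 1 then 0 else 1) # map e [0..<length fs]"
  have "powlist ([:-1:] # fs) es = v * (\<Prod>i<length fs. (fs ! i) ^ e i)"
    using int_poly_unit[OF v] unfolding es_def powlist_Cons by (auto simp: powlist_def one_pCons)
  hence "N = powlist ([:-1:] # fs) es * t^2" using Ne by simp
  thus ?thesis using that[of es t] cop N sq nonsquare by (simp add: es_def descent_datum_def)
qed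

subsection \<open>Square classes on a curve with a point of order two\<close>

definition is_sq :: "'a::comm_monoid_mult \<Rightarrow> bool" where "is_sq x \<longleftrightarrow> (\<exists>k. x = k^2)"

lemma is_sqI: "x = k^2 \<Longrightarrow> is_sq x" by (auto simp: is_sq_def)

lemma is_sq_square [simp]: "is_sq (x^2)" "is_sq (x * x)"
  by (auto simp: is_sq_def power2_eq_square)

lemma is_sq_1 [simp]: "is_sq 1" using is_sq_square(1)[of 1] by simp

lemma is_sq_mult: "is_sq x \<Longrightarrow> is_sq y \<Longrightarrow> is_sq (x * y)"
  by (auto simp: is_sq_def simp flip: power_mult_distrib)

lemma is_sq_cancel:
  fixes x y :: "'a::field"
  assumes "is_sq (x * y)" "is_sq x" "x \<noteq> 0" shows "is_sq y"
proof -
  obtain k m where "x * y = k^2" "x = m^2" using assms by (auto simp: is_sq_def)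
  hence "y = (k/m)^2" using assms(3) by (simp add: power_divide field_simps)
  thus ?thesis by (rule is_sqI)
qed

lemma is_sq_trans:
  fixes x y z :: "'a::field"
  assumes "is_sq (x * y)" "is_sq (y * z)" "y \<noteq> 0" shows "is_sq (x * z)"
proof (rule is_sq_cancel)
  show "is_sq (y^2 * (x * z))" using is_sq_mult[OF assms(1,2)] by (simp add: power2_eq_square ac_simps)
qed (use assms in auto)

locale ell_curve_2 = ell_curve +
  fixes r :: 'a
  assumes root: "r^3 + A*r + B = 0"
begin

text \<open>Coefficients after moving the 2-torsion point to the origin:
  \<open>y^2 = z*(z^2 + C*z + D)\<close> with \<open>z = x - r\<close>.\<close>

definition "C = 3*r"
definition "D = 3*r^2 + A"
definition "T = Pt r 0"

text \<open>The descent map of the 2-isogeny. At the 2-torsion point \<open>z\<close> vanishes, and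
  the value \<open>D\<close> is the one that keeps the map a homomorphism modulo squares.\<close>

definition dl :: "'a ecpt \<Rightarrow> 'a" where
  "dl R = (case R of Infty \<Rightarrow> 1 | Pt x y \<Rightarrow> if x = r then D else x - r)"

lemma dl_simps [simp]: "dl Infty = 1" "dl (Pt x y) = (if x = r then D else x - r)"
  by (simp_all add: dl_def)

lemma D_nz [simp]: "D \<noteq> 0" using vertical_tangent[of r] root by (simp add: D_def)

lemma dl_nz [simp]: "dl R \<noteq> 0" by (cases R) auto

lemma dl_neg [simp]: "dl (ec_neg R) = dl R" by (cases R) auto

lemma oc_T [simp]: "oc T" using root by (simp add: T_def)

lemma dl_T [simp]: "dl T = D" by (simp add: T_def)

lemma T_T [simp]: "T \<^bold>+ T = Infty" "ec_neg T = T" by (simp_all add: T_def)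

lemma oc_shift: "oc (Pt x y) \<longleftrightarrow> y^2 = (x-r)*((x-r)^2 + C*(x-r) + D)"
proof -
  have B: "B = - (r^3 + A*r)" using root by (metis minus_unique)
  have "(x-r)*((x-r)^2 + C*(x-r) + D) = x^3 + A*x + B"
    unfolding C_def D_def B by (simp add: algebra_simps power2_eq_square power3_eq_cube)
  thus ?thesis by simp
qed

text \<open>For three points on a line the product of the \<open>z\<close> is \<open>v^2\<close>,
  where \<open>v\<close> is the ordinate of the line at \<open>x = r\<close>. If
  \<open>v = 0\<close> the line passes through \<open>T\<close>, and \<open>D\<close> is the product
  of the two other values of \<open>z\<close>.\<close>

lemma dl_hom: assumes "oc P" "oc Q" shows "is_sq (dl P * dl Q * dl (P \<^bold>+ Q))"
  using assms
proof (cases rule: ad_cases)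
  case opp
  thus ?thesis by simp
next
  case (line x1 y1 x2 y2 l x3)
  have a: "A = x1*x2+x1*x3+x2*x3 + 2*l*(y1 - l*x1)" using line(7) by (simp add: algebra_simps)
  have b: "B = (y1-l*x1)^2 - x1*x2*x3" using line(8) by (simp add: algebra_simps)
  have s: "l^2 = x1+x2+x3" using line(6) by (simp add: algebra_simps)
  define v where "v = l*(r-x1)+y1"
  have "(x1-r)*(x2-r)*(x3-r) - v^2 = - (r^3 + A*r + B) + (x1+x2+x3-l^2)*r^2"
    unfolding a b v_def by (simp add: algebra_simps power2_eq_square power3_eq_cube)
  hence v: "(x1-r)*(x2-r)*(x3-r) = v^2" using root s by simp
  have "D - 2*l*v - ((x1-r)*(x2-r)+(x1-r)*(x3-r)+(x2-r)*(x3-r)) = 2*r*(x1+x2+x3-l^2)"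
    unfolding D_def v_def unfolding a by (simp add: algebra_simps power2_eq_square power3_eq_cube)
  hence d: "D = (x1-r)*(x2-r)+(x1-r)*(x3-r)+(x2-r)*(x3-r) + 2*l*v" using s by (simp add: algebra_simps)
  show ?thesis
  proof (cases "v = 0")
    case False
    hence "x1 \<noteq> r" "x2 \<noteq> r" "x3 \<noteq> r" using v by auto
    thus ?thesis unfolding line(4) unfolding line(1,2) using v by simp
  next
    case True
    hence "x1 = r \<or> x2 = r \<or> x3 = r" using v by auto
    moreover have "is_sq (a * b * a * b)" "is_sq (a * (a * b) * b)" for a b :: 'a
      by (rule is_sqI[of _ "a*b"], simp add: power2_eq_square)+
    ultimately show ?thesis unfolding line(4) unfolding line(1,2) using d D_nz True by auto
  qed
qed auto

lemma dl_double: "oc P \<Longrightarrow> is_sq (dl (P \<^bold>+ P))"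
  using is_sq_cancel[OF dl_hom[of P P]] by simp

text \<open>The half is sought as \<open>(r+s, k*s)\<close>, on the line of slope \<open>k\<close>
  through \<open>T\<close>. That line meets the curve again where
  \<open>s^2 + (C-k^2)*s + D = 0\<close>; the hypothesis on \<open>k\<close> makes the discriminant
  \<open>(2*t*k)^2\<close>, which gives \<open>s\<close>. The tangent there has slope
  \<open>k + t\<close>.\<close>

lemma halve:
  assumes oc: "oc (Pt x y)" and t: "x - r = t^2" "t \<noteq> 0" and k: "C + 2*t^2 + 2*y/t = k^2"
    and disc: "C^2 \<noteq> 4*D"
  shows "\<exists>S. oc S \<and> S \<^bold>+ S = Pt x y"
proof -
  define q where "q = y/t"
  have y: "y = t*q" using t by (simp add: q_def)
  have "t^2*q^2 = t^2*(t^4+C*t^2+D)" using oc unfolding oc_shift t(1) y by (simp add: power_mult_distrib flip: power_mult)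
  hence q2: "q^2 = t^4+C*t^2+D" using t(2) by simp
  have k2: "k^2 = C+2*t^2+2*q" using k by (simp add: q_def)
  define s where "s = (k^2-C)/2+t*k"
  have s': "s = t^2+q+t*k" unfolding s_def k2 by (simp add: field_simps)
  have "s^2+(C-k^2)*s+D = (t^2+q+t*k)^2 - 2*(t^2+q)*(t^2+q+t*k) + D" unfolding s' k2 by (simp add: algebra_simps)
  also have "\<dots> = t^2*k^2 - (t^4 + 2*t^2*q) - q^2 + D" by (simp add: algebra_simps power2_eq_square power4_eq_xxxx)
  also have "\<dots> = 0" unfolding k2 q2 by (simp add: algebra_simps power2_eq_square power4_eq_xxxx)
  finally have s2: "s^2+(C-k^2)*s+D = 0" .
  hence D: "D = (k^2-C)*s - s^2" by (simp add: algebra_simps eq_neg_iff_add_eq_0)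
  have s0: "s \<noteq> 0" using s2 D_nz by auto
  have k0: "k \<noteq> 0"
  proof
    assume "k = 0"
    hence "C + 2*s = 0" and D': "D = -C*s - s^2" using D by (simp_all add: s_def)
    have "4*(-C*s - s^2) - C^2 = - ((C+2*s)^2)" by (simp add: algebra_simps power2_eq_square)
    hence "4*D = C^2" unfolding D'[symmetric] \<open>C + 2*s = 0\<close> by simp
    thus False using disc by simp
  qed
  have ocS: "oc (Pt (r+s) (k*s))" unfolding oc_shift by (simp add: D algebra_simps power2_eq_square)
  define l where "l = k + t"
  have "3*(r+s)^2+A = D + 2*C*s + 3*s^2" unfolding D_def C_def by (simp add: algebra_simps power2_eq_square)
  also have "\<dots> = s*(2*s + C + k^2)" unfolding D by (simp add: algebra_simps power2_eq_square)
  also have "2*s + C + k^2 = 2*k*l" unfolding s_def l_def by (simp add: field_simps power2_eq_square)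
  finally have "l = (3*(r+s)^2+A)/(2*(k*s))" using s0 k0 by simp
  from ec_add_tangent[OF _ this] s0 k0
  have SS: "Pt (r+s) (k*s) \<^bold>+ Pt (r+s) (k*s) = Pt (l^2-(r+s)-(r+s)) (l*((r+s)-(l^2-(r+s)-(r+s)))-k*s)" by simp
  have x: "l^2-(r+s)-(r+s) = x"
  proof -
    have "l^2-(r+s)-(r+s) = r + (l^2 - C - 2*s)" by (simp add: C_def)
    also have "l^2 - C - 2*s = t^2" unfolding l_def s' using k2 by (simp add: algebra_simps power2_eq_square)
    finally show ?thesis using t(1) by (simp add: algebra_simps)
  qed
  have x': "x = r + t^2" using t(1) by (simp add: algebra_simps)
  have "l*((r+s)-x)-k*s = y" unfolding x' l_def y s' using k2 by (simp add: algebra_simps power2_eq_square)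
  hence "Pt (r+s) (k*s) \<^bold>+ Pt (r+s) (k*s) = Pt x y" using SS unfolding x by (simp only:)
  thus ?thesis using ocS by blast
qed

text \<open>A point of trivial class is the image of \<open>(X, 2*t*X)\<close> on the isogenous
  curve \<open>Y^2 = X*(X^2 - 2*C*X + C^2-4*D)\<close>. If \<open>X\<close> has the class of
  \<open>C^2-4*D\<close> instead of the trivial one, the sign of \<open>t\<close> is changed: this
  replaces \<open>X\<close> by \<open>X'\<close>, and \<open>X*X' = C^2-4*D\<close>.\<close>

lemma halving:
  assumes dual: "\<And>X Y. X \<noteq> 0 \<Longrightarrow> X*(X^2 - 2*C*X + (C^2-4*D)) = Y^2 \<Longrightarrow> is_sq X \<or> is_sq (X * (C^2-4*D))"
    and D: "\<not> is_sq D" and disc: "C^2 \<noteq> 4*D" and R: "oc R" "is_sq (dl R)"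
  shows "\<exists>S. oc S \<and> S \<^bold>+ S = R"
proof (cases R)
  case Infty
  thus ?thesis by (intro exI[of _ Infty]) simp
next
  case (Pt x y)
  have xr: "x \<noteq> r" using R(2) D Pt by auto
  then obtain t where t: "x - r = t^2" using R(2) Pt by (auto simp: is_sq_def)
  have t0: "t \<noteq> 0" using t xr by auto
  define q where "q = y/t"
  have y: "y = t*q" using t0 by (simp add: q_def)
  have "t^2*q^2 = t^2*(t^4+C*t^2+D)" using R(1) unfolding Pt oc_shift t y by (simp add: power_mult_distrib flip: power_mult)
  hence q2: "q^2 = t^4+C*t^2+D" using t0 by simp
  define X X' where "X = C + 2*t^2 + 2*q" and "X' = C + 2*t^2 - 2*q"
  have XX: "X * X' = C^2-4*D"
  proof -
    have "X * X' = (C+2*t^2)^2 - 4*q^2" unfolding X_def X'_def by (simp add: algebra_simps power2_eq_square)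
    thus ?thesis unfolding q2 by (simp add: algebra_simps power2_eq_square power4_eq_xxxx)
  qed
  have X0: "X \<noteq> 0" using XX disc by auto
  have "X*(X^2 - 2*C*X + (C^2-4*D)) = (2*t*X)^2"
    unfolding XX[symmetric] unfolding X_def X'_def by (simp add: algebra_simps power2_eq_square)
  from dual[OF X0 this] consider "is_sq X" | "is_sq X'"
  proof
    assume "is_sq (X * (C^2-4*D))"
    hence "is_sq (X^2 * X')" unfolding XX[symmetric] by (simp add: power2_eq_square mult.assoc)
    from is_sq_cancel[OF this] X0 show ?thesis using that by simp
  qed (use that in auto)
  thus ?thesis
  proof cases
    case 1
    then obtain k where "X = k^2" by (auto simp: is_sq_def)
    thus ?thesis using halve[of x y t k] R(1) t t0 disc unfolding Pt X_def q_def by simp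
  next
    case 2
    then obtain k where "X' = k^2" by (auto simp: is_sq_def)
    thus ?thesis using halve[of x y "-t" k] R(1) t t0 disc unfolding Pt X'_def q_def by simp
  qed
qed

end

subsection \<open>The height of a rational function\<close>

text \<open>The degree of \<open>X\<close> as a rational function. As a minimum over all fractions
  it is bounded above by any representation, reduced or not.\<close>

definition hgt :: "Qu \<Rightarrow> nat" where
  "hgt X = (LEAST n. \<exists>p q. q \<noteq> 0 \<and> X = Fract p q \<and> degree p \<le> n \<and> degree q \<le> n)"

lemma hgt_le: "q \<noteq> 0 \<Longrightarrow> hgt (Fract p q) \<le> max (degree p) (degree q)"
  unfolding hgt_def by (rule Least_le) (intro exI[of _ p] exI[of _ q], simp)

lemma hgt_0 [simp]: "hgt 0 = 0"
  using hgt_le[of 1 0] by (simp add: Zero_fract_def)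

lemma hgt_attained:
  obtains p q where "q \<noteq> 0" "X = Fract p q" "degree p \<le> hgt X" "degree q \<le> hgt X"
proof -
  obtain P Q where "X = Fract P Q" "Q \<noteq> 0" by (cases X) auto
  hence "\<exists>p q. q \<noteq> 0 \<and> X = Fract p q \<and> degree p \<le> max (degree P) (degree Q) \<and> degree q \<le> max (degree P) (degree Q)"
    by (intro exI[of _ P] exI[of _ Q]) auto
  from LeastI[of "\<lambda>n. \<exists>p q. q \<noteq> 0 \<and> X = Fract p q \<and> degree p \<le> n \<and> degree q \<le> n", OF this, folded hgt_def] that
  show ?thesis by blast
qed

lemma hgt_coprime:
  assumes "q \<noteq> 0" "coprime p q" shows "hgt (Fract p q) = max (degree p) (degree q)"
proof (rule antisym[OF hgt_le[OF assms(1)]])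
  obtain a b where ab: "b \<noteq> 0" "Fract p q = Fract a b" "degree a \<le> hgt (Fract p q)" "degree b \<le> hgt (Fract p q)"
    by (rule hgt_attained)
  have eq: "p * b = a * q" using ab(1,2) assms(1) by (simp add: eq_fract)
  hence "q dvd p * b" by simp
  hence "q dvd b" using assms(2) by (simp add: coprime_dvd_mult_right_iff coprime_commute)
  then obtain k where k: "b = q * k" by auto
  hence "p * k * q = a * q" using eq by (simp add: ac_simps)
  hence a: "a = p * k" using assms(1) by simp
  have k0: "k \<noteq> 0" using k ab(1) by auto
  have "degree q \<le> degree b" unfolding k using k0 assms(1) by (simp add: degree_mult_eq)
  moreover have "degree p \<le> degree a" unfolding a using k0 by (cases "p = 0") (simp_all add: degree_mult_eq)
  ultimately show "max (degree p) (degree q) \<le> hgt (Fract p q)" using ab(3,4) by simp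
qed

lemma coprime_fraction:
  fixes X :: Qu
  obtains p q where "q \<noteq> 0" "X = Fract p q" "coprime p q" "hgt X = max (degree p) (degree q)"
proof -
  obtain P Q where PQ: "X = Fract P Q" "Q \<noteq> 0" by (cases X) auto
  define g where "g = gcd P Q"
  have "g \<noteq> 0" using PQ by (simp add: g_def)
  then obtain p q where *: "P = p * g" "Q = q * g" "coprime p q"
    using gcd_coprime_exists[of P Q] unfolding g_def by blast
  have q0: "q \<noteq> 0" using PQ * by auto
  have "X = Fract p q" using PQ * \<open>g \<noteq> 0\<close> q0 by (simp add: eq_fract)
  thus ?thesis using that[of q p] q0 *(3) hgt_coprime by simp
qed

lemma coprime_by_primes:
  fixes a b :: "'a::factorial_ring_gcd"
  assumes "a \<noteq> 0 \<or> b \<noteq> 0" "\<And>p. prime_elem p \<Longrightarrow> p dvd a \<Longrightarrow> p dvd b \<Longrightarrow> False"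
  shows "coprime a b"
proof (rule ccontr)
  assume "\<not> coprime a b"
  hence "\<not> is_unit (gcd a b)" by (simp add: coprime_iff_gcd_eq_1)
  moreover have "gcd a b \<noteq> 0" using assms(1) by simp
  ultimately obtain p where "p dvd gcd a b" "prime p" using prime_divisor_exists by blast
  thus False using assms(2)[of p] by auto
qed

lemma coeff_mult_bound:
  fixes p q :: "'a::comm_semiring_0 poly"
  assumes "degree p \<le> m" "degree q \<le> n"
  shows "poly.coeff (p * q) (m + n) = poly.coeff p m * poly.coeff q n"
proof (cases "degree p = m \<and> degree q = n")
  case True
  thus ?thesis using coeff_mult_degree_sum[of p q] by auto
next
  case False
  hence "degree p + degree q < m + n" using assms by auto
  hence "degree (p * q) < m + n" using degree_mult_le[of p q] by linarith
  moreover have "poly.coeff p m * poly.coeff q n = 0" using False assms by (auto simp: coeff_eq_0)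
  ultimately show ?thesis by (simp add: coeff_eq_0)
qed

text \<open>No cancellation can occur: a common prime would divide \<open>p\<close> and
  \<open>q\<close>, or one of the units \<open>d\<close>, 4, \<open>c^2-4*d\<close>. The degree does
  not drop either, because the top coefficient of \<open>p^2 - d*q^2\<close> is a value of the form
  \<open>x^2 - d*y^2\<close>, which is anisotropic over the rationals.\<close>

lemma hgt_duplication:
  fixes c d :: rat
  assumes d: "\<And>x y. x^2 = d * y^2 \<Longrightarrow> x = 0 \<and> y = 0" and cd: "c^2 - 4*d \<noteq> 0"
    and q: "q \<noteq> 0" "coprime p q" and den: "4 * p * q * (p^2 + [:c:] * p * q + [:d:] * q^2) \<noteq> 0"
  shows "hgt (Fract ((p^2 - [:d:] * q^2)^2) (4 * p * q * (p^2 + [:c:] * p * q + [:d:] * q^2))) \<ge> 4 * max (degree p) (degree q)"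
proof -
  define cc dd :: "rat poly" where "cc = [:c:]" and "dd = [:d:]"
  define L where "L = p^2 - dd * q^2"
  define N where "N = p^2 + cc * p * q + dd * q^2"
  have d0: "d \<noteq> 0" using d[of 0 1] by auto
  have u: "is_unit dd" "is_unit (4::rat poly)" "is_unit (cc^2 - 4*dd)"
    using d0 cd by (simp_all add: cc_def dd_def is_unit_pCons_iff numeral_poly power2_eq_square)
  have npq: "\<not> (x dvd p \<and> x dvd q)" if "prime_elem x" for x
    using that q(2) coprime_common_divisor prime_elem_not_unit by blast
  have "coprime (L^2) (4 * p * q * N)"
  proof (rule coprime_by_primes)
    show "L^2 \<noteq> 0 \<or> 4 * p * q * N \<noteq> 0" using den unfolding N_def cc_def dd_def by blast
    fix x assume x: "prime_elem x" "x dvd L^2" "x dvd 4 * p * q * N"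
    have L: "x dvd L" using x prime_elem_dvd_power by blast
    have nu: "\<not> x dvd dd" "\<not> x dvd 4" "\<not> x dvd cc^2 - 4*dd" using u x(1) dvd_unit_imp_unit prime_elem_not_unit by blast+
    have nq: "\<not> x dvd q"
    proof
      assume Q: "x dvd q"
      have "p^2 = L + q * (dd * q)" by (simp add: L_def power2_eq_square algebra_simps)
      hence "x dvd p^2" using L Q by simp
      thus False using npq[OF x(1)] Q x(1) prime_elem_dvd_power by blast
    qed
    have np: "\<not> x dvd p"
    proof
      assume P: "x dvd p"
      have "dd * q^2 = p * p - L" by (simp add: L_def power2_eq_square algebra_simps)
      hence "x dvd dd * q^2" using L P by simp
      thus False using nu(1) nq x(1) by (meson prime_elem_dvd_multD prime_elem_dvd_power)
    qed
    have "x dvd N" using x(1,3) nu(2) np nq by (meson prime_elem_dvd_multD)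
    moreover have "N - L = q * (cc * p + 2 * dd * q)" by (simp add: L_def N_def power2_eq_square algebra_simps)
    ultimately have "x dvd q * (cc * p + 2 * dd * q)" using L by (metis dvd_diff)
    hence M: "x dvd cc * p + 2 * dd * q" using nq x(1) by (meson prime_elem_dvd_multD)
    have "dd * (cc^2 - 4*dd) * q^2 = (cc * p - 2 * dd * q) * (cc * p + 2 * dd * q) - cc^2 * L"
      by (simp add: L_def power2_eq_square algebra_simps)
    hence "x dvd dd * (cc^2 - 4*dd) * q^2" using L M by simp
    thus False using nu nq x(1) by (meson prime_elem_dvd_multD prime_elem_dvd_power)
  qed
  hence "hgt (Fract (L^2) (4 * p * q * N)) \<ge> degree (L^2)"
    using hgt_coprime[of "4 * p * q * N" "L^2"] den unfolding N_def cc_def dd_def by simp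
  moreover have "degree (L^2) \<ge> 4 * max (degree p) (degree q)"
  proof -
    define h where "h = max (degree p) (degree q)"
    have "poly.coeff L (h + h) = (poly.coeff p h)^2 - d * (poly.coeff q h)^2"
      unfolding L_def dd_def power2_eq_square by (simp add: coeff_mult_bound h_def)
    moreover have "poly.coeff p h \<noteq> 0 \<or> poly.coeff q h \<noteq> 0"
    proof (cases "degree p \<le> degree q")
      case True thus ?thesis using q(1) by (simp add: h_def max_def)
    next
      case False
      hence "p \<noteq> 0" by auto
      thus ?thesis using False by (simp add: h_def max_def)
    qed
    ultimately have "poly.coeff L (h + h) \<noteq> 0" using d[of "poly.coeff p h" "poly.coeff q h"] by auto
    hence "degree L \<ge> h + h" "L \<noteq> 0" using le_degree by auto
    thus ?thesis by (simp add: power2_eq_square degree_mult_eq h_def)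
  qed
  ultimately show ?thesis unfolding L_def N_def cc_def dd_def by linarith
qed

text \<open>Gauss's lemma for the quadratic with roots \<open>X\<close> and \<open>Y\<close>: for
  reduced fractions \<open>p/q\<close> and \<open>r/s\<close> the coefficients \<open>q*s\<close>,
  \<open>p*s+r*q\<close>, \<open>p*r\<close> have no common factor, so \<open>a\<close>,
  \<open>b\<close>, \<open>c\<close> are their multiples by one polynomial \<open>k\<close>. One of
  the three has degree \<open>hgt X + hgt Y\<close>.\<close>

lemma hgt_pair:
  fixes a b c :: "rat poly"
  assumes a: "a \<noteq> 0" and sum: "X + Y = Fract b a" and prod: "X * Y = Fract c a"
    and deg: "degree a \<le> n" "degree b \<le> n" "degree c \<le> n"
  shows "hgt X + hgt Y \<le> n"
proof -
  obtain p q where X: "q \<noteq> 0" "X = Fract p q" "coprime p q" "hgt X = max (degree p) (degree q)"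
    by (rule coprime_fraction)
  obtain r s where Y: "s \<noteq> 0" "Y = Fract r s" "coprime r s" "hgt Y = max (degree r) (degree s)"
    by (rule coprime_fraction)
  define a' b' c' where "a' = q * s" and "b' = p * s + r * q" and "c' = p * r"
  have a'0: "a' \<noteq> 0" using X Y by (simp add: a'_def)
  have "X + Y = Fract b' a'" "X * Y = Fract c' a'" using X Y by (simp_all add: a'_def b'_def c'_def)
  hence eq: "b' * a = b * a'" "c' * a = c * a'" using sum prod a a'0 by (simp_all add: eq_fract)
  have cop: "coprime a' (gcd b' c')"
  proof (rule coprime_by_primes)
    fix x assume x: "prime_elem x" "x dvd a'" "x dvd gcd b' c'"
    have np: "\<not> (x dvd p \<and> x dvd q)" "\<not> (x dvd r \<and> x dvd s)"
      using x(1) X(3) Y(3) coprime_common_divisor prime_elem_not_unit by blast+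
    have b: "x dvd p * s + r * q" and c: "x dvd p * r" using x(3) by (simp_all add: b'_def c'_def)
    have "x dvd q \<or> x dvd s" using x(1,2) unfolding a'_def by (simp add: prime_elem_dvd_mult_iff)
    thus False
    proof
      assume Q: "x dvd q"
      hence "x dvd p * s" using b by (simp add: dvd_add_left_iff)
      thus False using c np Q x(1) by (auto simp: prime_elem_dvd_mult_iff)
    next
      assume S: "x dvd s"
      hence "x dvd r * q" using b by (simp add: dvd_add_right_iff)
      thus False using c np S x(1) by (auto simp: prime_elem_dvd_mult_iff)
    qed
  qed (use a'0 in simp)
  have "a' dvd b' * a" "a' dvd c' * a" using eq by simp_all
  hence "a' dvd gcd (a * b') (a * c')" by (simp add: mult.commute)
  hence "a' dvd a * gcd b' c'" by (simp add: gcd_mult_distrib)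
  hence "a' dvd a" using cop by (simp add: coprime_dvd_mult_left_iff)
  then obtain k where k: "a = a' * k" by auto
  have k0: "k \<noteq> 0" using a k by auto
  have "b' * k * a' = b * a'" "c' * k * a' = c * a'" using eq unfolding k by (simp_all add: ac_simps)
  hence bc: "b = b' * k" "c = c' * k" using a'0 by simp_all
  have mono: "degree f \<le> degree (f * k)" for f using k0 by (cases "f = 0") (simp_all add: degree_mult_eq)
  have n: "degree a' \<le> n" "degree b' \<le> n" "degree c' \<le> n"
    using deg mono[of a'] mono[of b'] mono[of c'] unfolding bc k by linarith+
  \<comment> \<open>\<open>q*s\<close> attains the degree if neither fraction has a pole at
    infinity, \<open>p*r\<close> if neither vanishes there; otherwise one has a pole and the other a
    zero, and one summand of the middle coefficient dominates.\<close>
  show ?thesis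
  proof (cases "degree p \<le> degree q \<and> degree r \<le> degree s")
    case True
    thus ?thesis using n(1) X Y unfolding a'_def by (simp add: degree_mult_eq)
  next
    case F1: False
    show ?thesis
    proof (cases "degree q \<le> degree p \<and> degree s \<le> degree r \<and> p \<noteq> 0 \<and> r \<noteq> 0")
      case True
      thus ?thesis using n(3) X Y unfolding c'_def by (simp add: degree_mult_eq)
    next
      case False
      then consider "degree q < degree p" "degree r < degree s \<or> r = 0" | "degree s < degree r" "degree p < degree q \<or> p = 0"
        using F1 by force
      thus ?thesis
      proof cases
        case 1
        hence p0: "p \<noteq> 0" by auto
        have "degree (r * q) < degree (p * s)"
          using 1 p0 X(1) Y(1) by (cases "r = 0") (auto simp: degree_mult_eq)
        hence "degree b' = degree p + degree s" unfolding b'_def using p0 Y(1) by (simp add: degree_add_eq_left degree_mult_eq)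
        thus ?thesis using n(2) 1 X Y by auto
      next
        case 2
        hence r0: "r \<noteq> 0" by auto
        have "degree (p * s) < degree (r * q)"
          using 2 r0 X(1) Y(1) by (cases "p = 0") (auto simp: degree_mult_eq)
        hence "degree b' = degree r + degree q" unfolding b'_def using r0 X(1) by (simp add: degree_add_eq_right degree_mult_eq)
        thus ?thesis using n(2) 2 X Y by auto
      qed
    qed
  qed
qed

lemma fraction_identities:
  fixes P Q R S c d :: "'a::field"
  assumes "Q \<noteq> 0" "S \<noteq> 0"
  shows "(2*(P/Q+R/S)*(P/Q*(R/S) + d) + 4*c*(P/Q)*(R/S)) / (P/Q-R/S)^2 =
      (2*(P*S+R*Q)*(P*R+d*(Q*S)) + 4*c*(P*R)*(Q*S)) / (P*S-R*Q)^2"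
    and "((P/Q*(R/S) - d) / (P/Q-R/S))^2 = (P*R-d*(Q*S))^2 / (P*S-R*Q)^2"
proof -
  have 1: "P/Q-R/S = (P*S-R*Q)/(Q*S)" "P/Q*(R/S) - d = (P*R-d*(Q*S))/(Q*S)" "P/Q+R/S = (P*S+R*Q)/(Q*S)"
    "P/Q*(R/S) + d = (P*R+d*(Q*S))/(Q*S)"
    using assms by (simp_all add: field_simps)
  have 2: "2*((P*S+R*Q)/(Q*S))*((P*R+d*(Q*S))/(Q*S)) + 4*c*(P/Q)*(R/S) = (2*(P*S+R*Q)*(P*R+d*(Q*S)) + 4*c*(P*R)*(Q*S))/(Q*S)^2"
    using assms by (simp add: field_simps power2_eq_square)
  show "(2*(P/Q+R/S)*(P/Q*(R/S) + d) + 4*c*(P/Q)*(R/S)) / (P/Q-R/S)^2 =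
      (2*(P*S+R*Q)*(P*R+d*(Q*S)) + 4*c*(P*R)*(Q*S)) / (P*S-R*Q)^2"
    unfolding 1 2 power_divide using assms by simp
  show "((P/Q*(R/S) - d) / (P/Q-R/S))^2 = (P*R-d*(Q*S))^2 / (P*S-R*Q)^2"
    unfolding 1 using assms by (simp add: power_divide)
qed

text \<open>Sum and product have the common denominator \<open>(p*s-r*q)^2\<close>, and all three
  polynomials are quadratic in \<open>(p,q)\<close> and in \<open>(r,s)\<close>; this bounds their
  degrees for \<open>hgt_pair\<close>.\<close>

lemma hgt_sum_bound:
  fixes c d :: rat and X Y V W :: Qu
  assumes "X \<noteq> Y"
    and "V + W = (2*(X+Y)*(X*Y + to_fract [:d:]) + 4 * to_fract [:c:] * X * Y) / (X-Y)^2"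
    and "V * W = ((X*Y - to_fract [:d:])/(X-Y))^2"
  shows "hgt V + hgt W \<le> 2 * hgt X + 2 * hgt Y"
proof -
  obtain p q where X: "q \<noteq> 0" "X = Fract p q" "degree p \<le> hgt X" "degree q \<le> hgt X" by (rule hgt_attained)
  obtain r s where Y: "s \<noteq> 0" "Y = Fract r s" "degree r \<le> hgt Y" "degree s \<le> hgt Y" by (rule hgt_attained)
  define cc dd where "cc = [:c:]" and "dd = [:d:]"
  define a b e where "a = (p*s - r*q)^2" and "b = 2*(p*s+r*q)*(p*r+dd*(q*s)) + 4*cc*(p*r)*(q*s)" and "e = (p*r - dd*(q*s))^2"
  have XY: "X = to_fract p / to_fract q" "Y = to_fract r / to_fract s" using X Y by (simp_all add: Fract_conv_to_fract)
  have nz: "to_fract q \<noteq> 0" "to_fract s \<noteq> 0" using X Y by simp_all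
  have a0: "p*s - r*q \<noteq> 0" using assms(1) X(1,2) Y(1,2) by (simp add: eq_fract)
  have tf: "to_fract (2 :: rat poly) = 2" "to_fract (4 :: rat poly) = 4"
  proof -
    show 2: "to_fract (2 :: rat poly) = 2" by (simp only: one_add_one[symmetric] to_fract_add to_fract_1)
    have "(4 :: rat poly) = 2 + 2" by simp
    hence "to_fract (4 :: rat poly) = 2 + 2" by (simp only: to_fract_add 2)
    thus "to_fract (4 :: rat poly) = 4" by simp
  qed
  have sum: "V + W = Fract b a"
    unfolding assms(2) Fract_conv_to_fract unfolding XY fraction_identities(1)[OF nz]
    by (simp add: tf a_def b_def cc_def dd_def power2_eq_square del: mult_pCons_left mult_pCons_right)
  have prod: "V * W = Fract e a"
    unfolding assms(3) Fract_conv_to_fract unfolding XY fraction_identities(2)[OF nz]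
    by (simp add: a_def e_def cc_def dd_def power2_eq_square del: mult_pCons_left mult_pCons_right)
  let ?n = "2 * hgt X + 2 * hgt Y"
  have m: "degree (f * g) \<le> hgt X + hgt Y" if "degree f \<le> hgt X" "degree g \<le> hgt Y" for f g :: "rat poly"
    using degree_mult_le[of f g] that by linarith
  have ps: "degree (p*s) \<le> hgt X + hgt Y" "degree (r*q) \<le> hgt X + hgt Y" "degree (p*r) \<le> hgt X + hgt Y" "degree (q*s) \<le> hgt X + hgt Y"
    using m[of p s] m[of q r] m[of p r] m[of q s] X Y by (simp_all add: mult.commute)
  have dq: "degree (dd*(q*s)) \<le> hgt X + hgt Y" using ps(4) degree_mult_le[of dd "q*s"] by (simp add: dd_def del: mult_pCons_left)
  have m2: "degree (f * g) \<le> ?n" if "degree f \<le> hgt X + hgt Y" "degree g \<le> hgt X + hgt Y" for f g :: "rat poly"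
    using degree_mult_le[of f g] that by linarith
  have "degree a \<le> ?n" unfolding a_def power2_eq_square by (intro m2 degree_diff_le ps)
  moreover have "degree e \<le> ?n" unfolding e_def power2_eq_square by (intro m2 degree_diff_le ps dq)
  moreover have "degree b \<le> ?n"
  proof -
    have "b = (p*s+r*q)*(2*(p*r+dd*(q*s))) + (4*cc*(p*r))*(q*s)" by (simp add: b_def algebra_simps)
    moreover have "degree (2*(p*r+dd*(q*s))) \<le> hgt X + hgt Y"
      using degree_add_le[OF ps(3) dq] degree_mult_le[of 2 "p*r+dd*(q*s)"] by (simp del: mult_pCons_left)
    moreover have "degree (4*cc*(p*r)) \<le> hgt X + hgt Y"
      using ps(3) degree_mult_le[of "4*cc" "p*r"] degree_mult_le[of 4 "cc"] by (simp add: cc_def del: mult_pCons_left mult_pCons_right)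
    ultimately show ?thesis by (metis degree_add_le m2 ps(1,2,4))
  qed
  ultimately show ?thesis using hgt_pair[OF _ sum prod] a0 by (simp add: a_def)
qed

subsection \<open>From square classes and heights to generators\<close>

lemma is_sq_cancel_square: "is_sq (x^2 * y) \<Longrightarrow> x \<noteq> 0 \<Longrightarrow> is_sq y" for x y :: "'a::field"
  using is_sq_cancel[of "x^2" y] by simp

text \<open>\<open>V\<close> and \<open>W\<close> belong to the sum and the difference of two
  points. They differ in the sign of \<open>b\<close>, which drops out of the sum and enters the
  product as \<open>b^2 = 4*N1*N2\<close>; the twist \<open>g\<close> cancels, and the formulas are
  those of the constant curve.\<close>

lemma chord_pair:
  fixes X1 X2 c d g Y1 Y2 :: "'a::field_char_0"
  assumes Y1: "Y1^2 = g * (X1*(X1^2+c*X1+d))" and Y2: "Y2^2 = g * (X2*(X2^2+c*X2+d))" and g: "g \<noteq> 0" and ne: "X1 \<noteq> X2"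
    and V: "V = (Y2-Y1)^2/(g*(X1-X2)^2) - c - X1 - X2" and W: "W = (-Y2-Y1)^2/(g*(X1-X2)^2) - c - X1 - X2"
  shows "V + W = (2*(X1+X2)*(X1*X2+d) + 4*c*X1*X2) / (X1-X2)^2" "V * W = ((X1*X2-d)/(X1-X2))^2"
proof -
  define E m N1 N2 b where "E = X1-X2" and "m = c + X1 + X2" and "N1 = X1*(X1^2+c*X1+d)" and "N2 = X2*(X2^2+c*X2+d)"
    and "b = 2*(Y1*Y2)/g"
  have E0: "E \<noteq> 0" using ne by (simp add: E_def)
  have b2: "b^2 = 4*N1*N2" unfolding b_def power_divide power_mult_distrib Y1 Y2 using g by (simp add: N1_def N2_def power2_eq_square)
  have "(Y2-Y1)^2 = g*(N1+N2-b)" "(-Y2-Y1)^2 = g*(N1+N2+b)"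
    using Y1 Y2 g unfolding N1_def N2_def b_def by (simp_all add: algebra_simps power2_eq_square)
  hence V': "V = (N1+N2-b)/E^2 - m" and W': "W = (N1+N2+b)/E^2 - m" unfolding V W E_def[symmetric] m_def using g by simp_all
  have "V + W = (2*(N1+N2) - 2*m*E^2)/E^2" unfolding V' W' using E0 by (simp add: field_simps)
  also have "2*(N1+N2) - 2*m*E^2 = 2*(X1+X2)*(X1*X2+d) + 4*c*X1*X2"
    unfolding N1_def N2_def m_def E_def by (simp add: algebra_simps power2_eq_square)
  finally show "V + W = (2*(X1+X2)*(X1*X2+d) + 4*c*X1*X2) / (X1-X2)^2" unfolding E_def .
  have "V * W = ((N1+N2-m*E^2)^2 - b^2)/(E^2*E^2)" unfolding V' W' using E0 by (simp add: field_simps power2_eq_square)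
  also have "(N1+N2-m*E^2)^2 - b^2 = E^2 * (X1*X2-d)^2"
    unfolding b2 N1_def N2_def m_def E_def by (simp add: algebra_simps power2_eq_square)
  also have "E^2 * (X1*X2-d)^2 / (E^2*E^2) = ((X1*X2-d)/E)^2" using E0 by (simp add: power_divide power2_eq_square)
  finally show "V * W = ((X1*X2-d)/(X1-X2))^2" unfolding E_def .
qed

lemma duplication_fraction:
  fixes P Q c d :: "'a::field"
  assumes "Q \<noteq> 0"
  shows "((P/Q)^2 - d)^2 / (4*(P/Q)*((P/Q)^2 + c*(P/Q) + d)) = (P^2-d*Q^2)^2 / (4*P*Q*(P^2+c*P*Q+d*Q^2))"
proof -
  have 1: "(P/Q)^2 - d = (P^2-d*Q^2)/Q^2" "(P/Q)^2 + c*(P/Q) + d = (P^2+c*P*Q+d*Q^2)/Q^2"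
    using assms by (simp_all add: field_simps power2_eq_square)
  have "((P^2-d*Q^2)/Q^2)^2 / (4*(P/Q)*((P^2+c*P*Q+d*Q^2)/Q^2)) = (P^2-d*Q^2)^2*(Q^3) / (4*P*(P^2+c*P*Q+d*Q^2)*(Q^3*Q))"
    by (simp add: power_divide power2_eq_square power3_eq_cube ac_simps)
  also have "\<dots> = (P^2-d*Q^2)^2 / (4*P*(P^2+c*P*Q+d*Q^2)*Q)" using assms by simp
  finally show ?thesis unfolding 1 by (simp add: ac_simps)
qed

text \<open>The arithmetic input: \<open>selmer\<close> bounds the classes on the curve,
  \<open>selmer_dual\<close> those on the isogenous curve, \<open>low\<close> starts the height
  induction, \<open>indep\<close> separates the classes of \<open>P\<close>, \<open>Q\<close> and
  \<open>T\<close>. Exponents below 2 are coordinates modulo squares, and \<open>of_int d\<close>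
  represents the class of \<open>T\<close> because \<open>D = d*g^2\<close>.\<close>

locale descent_twist = ell_curve_2 A B r for A B r :: Qu +
  fixes g :: Qu and c d :: int and P Q :: "Qu ecpt"
  assumes g0: "g \<noteq> 0" and C: "C = of_int c * g" and D: "D = of_int d * g^2" and cd: "c^2 - 4*d = -20"
    and ocP: "oc P" and ocQ: "oc Q"
    and selmer: "\<And>X y. X \<noteq> 0 \<Longrightarrow> g * X * (X^2 + of_int c * X + of_int d) = y^2 \<Longrightarrow>
      \<exists>i j k. i < 2 \<and> j < 2 \<and> k < 2 \<and> is_sq (g * X * dl P ^ i * dl Q ^ j * of_int d ^ k)"
    and selmer_dual: "\<And>X y. X \<noteq> 0 \<Longrightarrow> g * X * (X^2 - 2 * of_int c * X - 20) = y^2 \<Longrightarrow> is_sq (g * X) \<or> is_sq (-5 * (g * X))"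
    and low: "\<And>X y. g * X * (X^2 + of_int c * X + of_int d) = y^2 \<Longrightarrow> hgt X < 4 \<Longrightarrow> X = 0"
    and indep: "\<And>i j k. i < 2 \<Longrightarrow> j < 2 \<Longrightarrow> k < 2 \<Longrightarrow> is_sq (dl P ^ i * dl Q ^ j * of_int d ^ k) \<Longrightarrow> i = 0 \<and> j = 0 \<and> k = 0"
    and minus5: "\<not> is_sq (-5 :: Qu)"
    and d_nsq: "\<And>x y :: rat. x^2 = of_int d * y^2 \<Longrightarrow> x = 0 \<and> y = 0"
begin

definition hh :: "Qu ecpt \<Rightarrow> nat" where
  "hh R = (case R of Infty \<Rightarrow> 0 | Pt x y \<Rightarrow> hgt ((x - r) / g))"

lemma hh_simps [simp]: "hh Infty = 0" "hh (Pt x y) = hgt ((x - r) / g)"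
  by (simp_all add: hh_def)

lemma hh_T [simp]: "hh T = 0" by (simp add: T_def)

lemma disc: "C^2 - 4*D = -20 * g^2"
proof -
  have "C^2 - 4*D = of_int (c^2 - 4*d) * g^2" unfolding C D by (simp add: algebra_simps power2_eq_square)
  thus ?thesis unfolding cd by simp
qed

lemma oc_X: assumes "oc (Pt x y)" "X = (x - r)/g"
  shows "g * X * (X^2 + of_int c * X + of_int d) = (y/g)^2" "x - r = g * X"
proof -
  show x: "x - r = g * X" using assms(2) g0 by simp
  have "y^2 = (g*X)*((g*X)^2 + C*(g*X) + D)" using assms(1) unfolding oc_shift x .
  also have "\<dots> = g^3 * (X * (X^2 + of_int c * X + of_int d))" unfolding C D by (simp add: algebra_simps power2_eq_square power3_eq_cube)
  finally show "g * X * (X^2 + of_int c * X + of_int d) = (y/g)^2" using g0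
    by (simp add: power_divide field_simps power2_eq_square power3_eq_cube)
qed

lemma D_nsq: "\<not> is_sq D"
proof
  assume "is_sq D"
  hence "is_sq (of_int d :: Qu)" using is_sq_cancel[of "g^2" "of_int d"] g0 unfolding D by (simp add: mult.commute)
  thus False using indep[of 0 0 1] by simp
qed

lemma two_torsion: assumes "oc S" "S \<^bold>+ S = Infty" shows "S = Infty \<or> S = T"
proof (cases S)
  case (Pt x y)
  have "S = ec_neg S" using ad_eq_Infty assms by blast
  hence y: "y = 0" using Pt by (auto simp: eq_neg_iff_add_eq_0)
  have *: "(x-r)*((x-r)^2 + C*(x-r) + D) = 0" using assms(1) y unfolding Pt oc_shift by simp
  have "x = r"
  proof (rule ccontr)
    assume "x \<noteq> r"
    hence 0: "(x-r)^2 + C*(x-r) + D = 0" using * by simp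
    have "(2*(x-r)+C)^2 = 4*((x-r)^2 + C*(x-r) + D) + (C^2-4*D)" by (simp add: algebra_simps power2_eq_square)
    hence "(2*(x-r)+C)^2 = (2*g)^2 * -5" unfolding 0 disc by (simp add: power_mult_distrib)
    hence "is_sq ((2*g)^2 * -5)" by (metis is_sqI)
    from is_sq_cancel[OF this is_sq_square(1)] g0 minus5 show False by simp
  qed
  thus ?thesis using Pt y by (simp add: T_def)
qed simp

lemma halving': "oc R \<Longrightarrow> is_sq (dl R) \<Longrightarrow> \<exists>S. oc S \<and> S \<^bold>+ S = R"
proof (rule halving)
  fix X Y assume X: "X \<noteq> 0" "X*(X^2 - 2*C*X + (C^2-4*D)) = Y^2"
  define V where "V = X / g"
  have XV: "X = g * V" using g0 by (simp add: V_def)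
  have "g * V * (V^2 - 2 * of_int c * V - 20) = (Y/g)^2"
    using X(2) g0 unfolding disc unfolding C XV by (simp add: field_simps power2_eq_square)
  from selmer_dual[OF _ this] X(1) XV have "is_sq X \<or> is_sq (-5 * X)" by auto
  thus "is_sq X \<or> is_sq (X * (C^2-4*D))"
  proof
    assume "is_sq (-5 * X)"
    from is_sq_mult[OF is_sq_square(1)[of "2*g"] this] show ?thesis unfolding disc by (simp add: power_mult_distrib ac_simps)
  qed simp
qed (use D_nsq disc g0 in auto)

lemma to_fract_of_int: "to_fract [:rat_of_int a:] = of_int a"
  using emb_const[of a] by (simp add: emb_def map_poly_pCons)

lemma to_fract_4: "to_fract (4 :: rat poly) = 4"
  using to_fract_of_int[of 4] by (simp add: numeral_poly)

lemma hh_double: assumes "oc S" shows "4 * hh S \<le> hh (S \<^bold>+ S)"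
proof (cases S)
  case (Pt x y)
  show ?thesis
  proof (cases "S = T")
    case False
    define X where "X = (x-r)/g"
    note X = oc_X[OF assms[unfolded Pt] X_def]
    have y0: "y \<noteq> 0"
    proof
      assume "y = 0"
      hence "S \<^bold>+ S = Infty" using Pt by simp
      thus False using two_torsion[OF assms] False Pt by auto
    qed
    define N where "N = X^2 + of_int c * X + of_int d"
    have XN: "g * X * N \<noteq> 0" unfolding N_def X(1) using y0 g0 by simp
    define l where "l = (3*x^2+A)/(2*y)"
    have SS: "S \<^bold>+ S = Pt (l^2-x-x) (l*(x-(l^2-x-x))-y)" unfolding Pt by (rule ec_add_tangent[OF y0 l_def])
    have x: "x = g*X + r" using X(2) by (simp add: algebra_simps)
    have num: "3*x^2+A = g^2*(3*X^2 + 2*of_int c*X + of_int d)"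
    proof -
      have "3*x^2+A = 3*(g*X)^2 + 2*C*(g*X) + D" unfolding x C_def D_def by (simp add: algebra_simps power2_eq_square)
      thus ?thesis unfolding C D by (simp add: algebra_simps power2_eq_square)
    qed
    have y2: "y^2 = g^2 * (g * X * N)" unfolding N_def X(1) using g0 by (simp add: power_divide)
    have "(g^2*M)^2/(2^2*(g^2*(g*X*N))) = M^2*g/(4*(X*N))" for M
      using XN by (simp add: field_simps power2_eq_square)
    hence "l^2 = (3*X^2 + 2*of_int c*X + of_int d)^2 * g / (4 * (X * N))"
      unfolding l_def num power_divide power_mult_distrib[of 2 y] y2 .
    moreover have "(l^2-x-x-r)/g = l^2/g - 2*X - of_int c"
    proof -
      have "l^2-x-x-r = l^2 - 2*g*X - C" unfolding x C_def by simp
      thus ?thesis unfolding C using g0 by (simp add: field_simps)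
    qed
    ultimately have "(l^2-x-x-r)/g = (3*X^2 + 2*of_int c*X + of_int d)^2 / (4 * (X * N)) - 2*X - of_int c" using g0 by simp
    also have "\<dots> = ((3*X^2 + 2*of_int c*X + of_int d)^2 - (2*X + of_int c) * (4 * (X * N))) / (4 * (X * N))"
      using XN by (simp add: field_simps)
    also have "(3*X^2 + 2*of_int c*X + of_int d)^2 - (2*X + of_int c) * (4 * (X * N)) = (X^2 - of_int d)^2"
      unfolding N_def by (simp add: algebra_simps power2_eq_square)
    \<comment> \<open>The twist has cancelled: this is the duplication formula of the constant
      curve.\<close>
    finally have hX: "(l^2-x-x-r)/g = (X^2 - of_int d)^2 / (4*X*(X^2 + of_int c * X + of_int d))" unfolding N_def by (simp add: mult.assoc)
    obtain p q where pq: "q \<noteq> 0" "X = Fract p q" "coprime p q" "hgt X = max (degree p) (degree q)" by (rule coprime_fraction)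
    define cc dd where "cc = [:rat_of_int c:]" and "dd = [:rat_of_int d:]"
    have XF: "X = to_fract p / to_fract q" using pq by (simp add: Fract_conv_to_fract)
    have tf: "to_fract cc = of_int c" "to_fract dd = of_int d" by (simp_all add: cc_def dd_def to_fract_of_int)
    have q0: "to_fract q \<noteq> 0" using pq by simp
    define F where "F = 4 * p * q * (p^2 + cc * p * q + dd * q^2)"
    have F: "to_fract F = 4 * to_fract p * to_fract q * (to_fract p^2 + of_int c * to_fract p * to_fract q + of_int d * to_fract q^2)"
      by (simp add: F_def tf[symmetric] to_fract_4 power2_eq_square)
    have fr: "(l^2-x-x-r)/g = Fract ((p^2 - dd * q^2)^2) F"
      unfolding hX XF duplication_fraction[OF q0] Fract_conv_to_fract F by (simp add: tf[symmetric] power2_eq_square)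
    have "X * N * (to_fract q^4 * 4) = to_fract F" unfolding F N_def XF using q0 by (simp add: field_simps power2_eq_square power4_eq_xxxx)
    hence F0: "F \<noteq> 0" using XN q0 by auto
    have "rat_of_int (c^2 - 4*d) \<noteq> 0" unfolding cd by simp
    hence cd': "(of_int c)^2 - 4 * of_int d \<noteq> (0::rat)" by simp
    have "4 * max (degree p) (degree q) \<le> hgt (Fract ((p^2 - dd * q^2)^2) F)"
      using hgt_duplication[OF d_nsq cd' pq(1,3) F0[unfolded F_def cc_def dd_def]]
      unfolding F_def cc_def dd_def .
    thus ?thesis unfolding SS unfolding Pt hh_simps fr X_def[symmetric] pq(4) .
  qed simp
qed simp

text \<open>The two heights add up to at most \<open>2*hh R + 2*hh S\<close>, so one of them is at
  most half of that. If the abscissas agree, one of the two points is \<open>Infty\<close>, of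
  height 0.\<close>

lemma hh_sign:
  assumes "oc R" "oc S"
  shows "hh (R \<^bold>+ S) \<le> hh R + hh S \<or> hh (R \<^bold>+ ec_neg S) \<le> hh R + hh S"
proof (cases R)
  case R: (Pt x1 y1)
  show ?thesis
  proof (cases S)
    case S: (Pt x2 y2)
    show ?thesis
    proof (cases "x1 = x2")
      case True
      hence "R = S \<or> R = ec_neg S" using x_eq_cases assms R S by blast
      thus ?thesis by auto
    next
      case False
      define X1 X2 where "X1 = (x1-r)/g" and "X2 = (x2-r)/g"
      note X1 = oc_X[OF assms(1)[unfolded R] X1_def] and X2 = oc_X[OF assms(2)[unfolded S] X2_def]
      have ne: "X1 \<noteq> X2" using False g0 by (simp add: X1_def X2_def)
      have x12: "x2 - x1 = - (g*(X1-X2))" using X1(2) X2(2) by (simp add: algebra_simps)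
      have quot: "(((y - y1)/(x2-x1))^2 - x1 - x2 - r)/g = (y/g-y1/g)^2/(g*(X1-X2)^2) - of_int c - X1 - X2" for y
      proof -
        have "((y - y1)/(x2-x1))^2 = g * ((y/g-y1/g)^2/(g*(X1-X2)^2))"
          unfolding x12 diff_divide_distrib[symmetric] power_divide using g0 ne
          by (simp add: power_mult_distrib power2_eq_square)
        moreover have "- x1 - x2 - r = - (g * X1) - g * X2 - of_int c * g"
          using X1(2) X2(2) C[unfolded C_def] by (simp add: algebra_simps)
        ultimately have "((y - y1)/(x2-x1))^2 - x1 - x2 - r = g * ((y/g-y1/g)^2/(g*(X1-X2)^2) - of_int c - X1 - X2)"
          by (simp add: algebra_simps)
        thus ?thesis using g0 by simp
      qed
      define V W where "V = (y2/g-y1/g)^2/(g*(X1-X2)^2) - of_int c - X1 - X2"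
        and "W = (-(y2/g)-y1/g)^2/(g*(X1-X2)^2) - of_int c - X1 - X2"
      have hV: "hh (R \<^bold>+ S) = hgt V"
        unfolding R S ec_add_chord[OF False refl] hh_simps quot V_def ..
      have hW: "hh (R \<^bold>+ ec_neg S) = hgt W"
        unfolding R S ec_neg.simps ec_add_chord[OF False refl] hh_simps quot W_def by simp
      have "(y1/g)^2 = g * (X1 * (X1^2 + of_int c * X1 + of_int d))" "(y2/g)^2 = g * (X2 * (X2^2 + of_int c * X2 + of_int d))"
        using X1(1) X2(1) by (simp_all add: mult.assoc)
      note VW = chord_pair[OF this g0 ne V_def W_def]
      have "hgt V + hgt W \<le> 2 * hgt X1 + 2 * hgt X2"
        by (rule hgt_sum_bound[OF ne, where c = "of_int c" and d = "of_int d"]) (use VW in \<open>simp_all add: to_fract_of_int\<close>)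
      thus ?thesis unfolding hV hW unfolding R S hh_simps X1_def[symmetric] X2_def[symmetric] by linarith
    qed
  qed simp
qed simp

section \<open>Generation by descent on the height, and independence\<close>

definition span :: "Qu ecpt set" where
  "span = {X. \<exists>k l m. X = (ec_zmul A k P \<^bold>+ ec_zmul A l Q) \<^bold>+ ec_zmul A m T}"

lemma span_add:
  assumes "X \<in> span" "Y \<in> span" shows "X \<^bold>+ Y \<in> span"
proof -
  obtain k l m where X: "X = (ec_zmul A k P \<^bold>+ ec_zmul A l Q) \<^bold>+ ec_zmul A m T" using assms(1) by (auto simp: span_def)
  obtain k' l' m' where Y: "Y = (ec_zmul A k' P \<^bold>+ ec_zmul A l' Q) \<^bold>+ ec_zmul A m' T" using assms(2) by (auto simp: span_def)
  define a b e a' b' e' where "a = ec_zmul A k P" and "b = ec_zmul A l Q" and "e = ec_zmul A m T"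
    and "a' = ec_zmul A k' P" and "b' = ec_zmul A l' Q" and "e' = ec_zmul A m' T"
  note defs = this
  have oc: "oc a" "oc b" "oc e" "oc a'" "oc b'" "oc e'" unfolding defs using ocP ocQ by auto
  have four: "(u \<^bold>+ v) \<^bold>+ (u' \<^bold>+ v') = (u \<^bold>+ u') \<^bold>+ (v \<^bold>+ v')" if "oc u" "oc v" "oc u'" "oc v'" for u v u' v'
  proof -
    have "(u \<^bold>+ v) \<^bold>+ (u' \<^bold>+ v') = u \<^bold>+ (v \<^bold>+ (u' \<^bold>+ v'))" by (rule ad_assoc) (use that in auto)
    also have "v \<^bold>+ (u' \<^bold>+ v') = u' \<^bold>+ (v \<^bold>+ v')" by (rule ad_left_commute) (use that in auto)
    also have "u \<^bold>+ (u' \<^bold>+ (v \<^bold>+ v')) = (u \<^bold>+ u') \<^bold>+ (v \<^bold>+ v')" by (rule ad_assoc[symmetric]) (use that in auto)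
    finally show ?thesis .
  qed
  have "X \<^bold>+ Y = ((a \<^bold>+ b) \<^bold>+ (a' \<^bold>+ b')) \<^bold>+ (e \<^bold>+ e')" unfolding X Y defs[symmetric] by (rule four) (use oc in auto)
  also have "(a \<^bold>+ b) \<^bold>+ (a' \<^bold>+ b') = (a \<^bold>+ a') \<^bold>+ (b \<^bold>+ b')" by (rule four) (use oc in auto)
  finally have "X \<^bold>+ Y = (ec_zmul A (k+k') P \<^bold>+ ec_zmul A (l+l') Q) \<^bold>+ ec_zmul A (m+m') T"
    unfolding defs using zmul_add ocP ocQ oc_T by simp
  thus ?thesis unfolding span_def by blast
qed

lemma span_multiples: "ec_zmul A k P \<in> span" "ec_zmul A k Q \<in> span" "ec_zmul A k T \<in> span"
proof -
  have "ec_zmul A k P = (ec_zmul A k P \<^bold>+ ec_zmul A 0 Q) \<^bold>+ ec_zmul A 0 T" by simp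
  thus "ec_zmul A k P \<in> span" unfolding span_def by blast
  have "ec_zmul A k Q = (ec_zmul A 0 P \<^bold>+ ec_zmul A k Q) \<^bold>+ ec_zmul A 0 T" by simp
  thus "ec_zmul A k Q \<in> span" unfolding span_def by blast
  have "ec_zmul A k T = (ec_zmul A 0 P \<^bold>+ ec_zmul A 0 Q) \<^bold>+ ec_zmul A k T" by simp
  thus "ec_zmul A k T \<in> span" unfolding span_def by blast
qed

lemma span_basic: "Infty \<in> span" "P \<in> span" "Q \<in> span" "T \<in> span" "ec_neg P \<in> span" "ec_neg Q \<in> span"
  using span_multiples(1)[of 0] span_multiples(1)[of 1] span_multiples(2)[of 1] span_multiples(3)[of 1]
    span_multiples(1)[of "-1"] span_multiples(2)[of "-1"] by simp_all

text \<open>\<open>S\<close> and \<open>-S\<close> change the square class in the same way, so the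
  sign is free to be chosen for the height.\<close>

lemma adjust:
  assumes R: "oc R" and S: "oc S" "S \<in> span" "ec_neg S \<in> span" "hh S \<le> n" and i: "i < 2"
  shows "\<exists>U. oc U \<and> hh U \<le> hh R + n \<and> is_sq (dl U * (dl R * dl S ^ i)) \<and> (U \<in> span \<longrightarrow> R \<in> span)"
proof (cases "i = 0")
  case True
  thus ?thesis using R by (intro exI[of _ R]) simp
next
  case False
  hence i: "i = 1" using i by simp
  obtain S' where S': "S' = S \<or> S' = ec_neg S" "hh (R \<^bold>+ S') \<le> hh R + hh S" using hh_sign[OF R S(1)] by blast
  have oc: "oc S'" using S' S by auto
  have "is_sq (dl R * dl S' * dl (R \<^bold>+ S'))" using dl_hom[OF R oc] .
  hence "is_sq (dl (R \<^bold>+ S') * (dl R * dl S ^ i))" using S'(1) i by (auto simp: ac_simps)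
  moreover have "R \<in> span" if "R \<^bold>+ S' \<in> span"
  proof -
    have "ec_neg S' \<in> span" using S' S by auto
    from span_add[OF that this] show ?thesis using ad_cancel[OF R oc] by simp
  qed
  ultimately show ?thesis using S'(2) S(4) oc R by (intro exI[of _ "R \<^bold>+ S'"]) auto
qed

lemma generation:
  assumes "hh P \<le> 4" "hh Q \<le> 4" "oc R" shows "R \<in> span"
  using assms(3)
proof (induction "hh R" arbitrary: R rule: less_induct)
  case less
  show ?case
  proof (cases "hh R < 4")
    case True
    show ?thesis
    proof (cases R)
      case Infty
      thus ?thesis using span_basic by simp
    next
      case (Pt x y)
      have "(x-r)/g = 0" using low[OF oc_X(1)[OF less.prems[unfolded Pt] refl]] True Pt by simp
      hence x: "x = r" using g0 by simp
      have "y^2 = 0" using less.prems unfolding Pt oc_shift x by simp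
      thus ?thesis using span_basic x Pt by (simp add: T_def)
    qed
  next
    case False
    then obtain x y where Pt: "R = Pt x y" by (cases R) auto
    define X where "X = (x-r)/g"
    note X = oc_X[OF less.prems[unfolded Pt] X_def]
    have X0: "X \<noteq> 0" using False Pt by (auto simp: X_def[symmetric])
    have dlR: "dl R = g * X" using X0 X(2) g0 unfolding Pt by auto
    obtain i j k where ijk: "i < 2" "j < 2" "k < 2" "is_sq (dl R * dl P ^ i * dl Q ^ j * of_int d ^ k)"
      using selmer[OF X0 X(1)] unfolding dlR by blast
    obtain U where U: "oc U" "hh U \<le> hh R + 4" "is_sq (dl U * (dl R * dl P ^ i))" "U \<in> span \<longrightarrow> R \<in> span"
      using adjust[OF less.prems ocP span_basic(2,5) assms(1) ijk(1)] by blast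
    obtain V where V: "oc V" "hh V \<le> hh U + 4" "is_sq (dl V * (dl U * dl Q ^ j))" "V \<in> span \<longrightarrow> U \<in> span"
      using adjust[OF U(1) ocQ span_basic(3,6) assms(2) ijk(2)] by blast
    obtain W where W: "oc W" "hh W \<le> hh V + 0" "is_sq (dl W * (dl V * D ^ k))" "W \<in> span \<longrightarrow> V \<in> span"
      using adjust[OF V(1) oc_T, of 0 k] span_basic(4) ijk(3) by auto
    have Dk: "is_sq (D ^ k * of_int d ^ k)"
      unfolding D by (rule is_sqI[of _ "(of_int d * g)^k"]) (simp add: power_mult_distrib power2_eq_square)
    define v u a b e f where "v = dl V" and "u = dl U" and "a = dl P ^ i" and "b = dl Q ^ j" and "e = D ^ k" and "f = (of_int d :: Qu) ^ k"
    have nz: "v \<noteq> 0" "u \<noteq> 0" "dl R \<noteq> 0" "a \<noteq> 0" "b \<noteq> 0" "e \<noteq> 0" "f \<noteq> 0"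
      using D_nz D unfolding v_def u_def a_def b_def e_def f_def by auto
    \<comment> \<open>In this product of squares every class except that of \<open>W\<close> occurs
      twice.\<close>
    have "is_sq ((dl W * (v * e)) * (v * (u * b)) * (u * (dl R * a)) * (dl R * a * b * f) * (e * f))"
      using is_sq_mult[OF is_sq_mult[OF is_sq_mult[OF is_sq_mult[OF W(3) V(3)] U(3)] ijk(4)] Dk]
      unfolding v_def u_def a_def b_def e_def f_def .
    also have "(dl W * (v * e)) * (v * (u * b)) * (u * (dl R * a)) * (dl R * a * b * f) * (e * f) = (v * u * e * b * a * f * dl R)^2 * dl W"
      by (simp add: power2_eq_square ac_simps)
    finally have "is_sq (dl W)" by (rule is_sq_cancel_square) (use nz in simp)
    then obtain S where S: "oc S" "S \<^bold>+ S = W" using halving' W(1) by blast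
    \<comment> \<open>\<open>P\<close> and \<open>Q\<close> cost 4 each and \<open>T\<close>
      nothing, so the half has height at most \<open>(hh R + 8)/4\<close>, which is below
      \<open>hh R\<close> since \<open>hh R\<close> is at least 4.\<close>
    have "4 * hh S \<le> hh R + 8" using hh_double[OF S(1)] S(2) W(2) V(2) U(2) by simp
    hence "hh S < hh R" using False by linarith
    from less.hyps[OF this S(1)] have "W \<in> span" using span_add S(2) by blast
    thus ?thesis using W(4) V(4) U(4) by blast
  qed
qed

lemma zmul_double: "oc X \<Longrightarrow> ec_zmul A (2 * k) X = ec_zmul A k X \<^bold>+ ec_zmul A k X"
  unfolding mult_2 by (rule zmul_add)

lemma dl_zmul:
  assumes "oc X" shows "is_sq (dl (ec_zmul A k X) * dl X ^ (if even k then 0 else 1))"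
proof (cases "even k")
  case True
  then obtain m where "k = 2 * m" by (elim evenE)
  thus ?thesis using dl_double[of "ec_zmul A m X"] assms by (simp add: zmul_double)
next
  case False
  then obtain m where k: "k = 2 * m + 1" by (elim oddE)
  have "ec_zmul A k X = ec_zmul A (2*m) X \<^bold>+ X" unfolding k using zmul_add[OF assms, of "2*m" 1] by simp
  hence "is_sq (dl (ec_zmul A (2*m) X) * (dl X * dl (ec_zmul A k X)))"
    using dl_hom[of "ec_zmul A (2*m) X" X] assms by (simp add: ac_simps)
  moreover have "is_sq (dl (ec_zmul A (2*m) X))" using dl_double[of "ec_zmul A m X"] assms by (simp add: zmul_double)
  ultimately have "is_sq (dl X * dl (ec_zmul A k X))" using is_sq_cancel dl_nz by blast
  thus ?thesis using False by (simp add: mult.commute)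
qed

text \<open>Halving a relation may leave \<open>T\<close> instead of zero, hence the disjunction. A
  relation with value \<open>T\<close> is impossible because the class of \<open>d\<close> is
  independent of those of \<open>P\<close> and \<open>Q\<close>.\<close>

lemma independence:
  assumes "ec_zmul A k P \<^bold>+ ec_zmul A l Q = Infty \<or> ec_zmul A k P \<^bold>+ ec_zmul A l Q = T"
  shows "k = 0 \<and> l = 0"
  using assms
proof (induction "nat (\<bar>k\<bar> + \<bar>l\<bar>)" arbitrary: k l rule: less_induct)
  case less
  define p q where "p = ec_zmul A k P" and "q = ec_zmul A l Q"
  have oc: "oc p" "oc q" using ocP ocQ by (simp_all add: p_def q_def)
  define i j :: nat where "i = (if even k then 0 else 1)" and "j = (if even l then 0 else 1)"
  have ij: "i < 2" "j < 2" by (simp_all add: i_def j_def)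
  have "is_sq ((dl p * dl q * dl (p \<^bold>+ q)) * (dl p * dl P ^ i) * (dl q * dl Q ^ j))"
    using is_sq_mult[OF is_sq_mult[OF dl_hom[OF oc] dl_zmul[OF ocP, of k, folded p_def]] dl_zmul[OF ocQ, of l, folded q_def]]
    unfolding i_def j_def .
  also have "(dl p * dl q * dl (p \<^bold>+ q)) * (dl p * dl P ^ i) * (dl q * dl Q ^ j) = (dl p * dl q)^2 * (dl P ^ i * dl Q ^ j * dl (p \<^bold>+ q))"
    by (simp add: power2_eq_square ac_simps)
  finally have sq: "is_sq (dl P ^ i * dl Q ^ j * dl (p \<^bold>+ q))" by (rule is_sq_cancel_square) simp
  have "p \<^bold>+ q \<noteq> T"
  proof
    assume "p \<^bold>+ q = T"
    hence "is_sq (g^2 * (dl P ^ i * dl Q ^ j * of_int d ^ 1))" using sq by (simp add: D ac_simps)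
    hence "is_sq (dl P ^ i * dl Q ^ j * of_int d ^ 1)" by (rule is_sq_cancel_square) (rule g0)
    from indep[OF ij _ this] show False by simp
  qed
  hence O: "p \<^bold>+ q = Infty" using less.prems unfolding p_def q_def by blast
  hence "is_sq (dl P ^ i * dl Q ^ j * of_int d ^ 0)" using sq by simp
  from indep[OF ij _ this] have "i = 0 \<and> j = 0" by simp
  hence "even k" "even l" unfolding i_def j_def by (auto split: if_splits)
  then obtain k' l' where kl: "k = 2 * k'" "l = 2 * l'" by (elim evenE)
  define p' q' where "p' = ec_zmul A k' P" and "q' = ec_zmul A l' Q"
  have oc': "oc p'" "oc q'" using ocP ocQ by (simp_all add: p'_def q'_def)
  have "(p' \<^bold>+ q') \<^bold>+ (p' \<^bold>+ q') = p' \<^bold>+ (q' \<^bold>+ (p' \<^bold>+ q'))" by (rule ad_assoc) (use oc' in auto)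
  also have "q' \<^bold>+ (p' \<^bold>+ q') = p' \<^bold>+ (q' \<^bold>+ q')" by (rule ad_left_commute) (use oc' in auto)
  also have "p' \<^bold>+ (p' \<^bold>+ (q' \<^bold>+ q')) = (p' \<^bold>+ p') \<^bold>+ (q' \<^bold>+ q')" by (rule ad_assoc[symmetric]) (use oc' in auto)
  also have "\<dots> = p \<^bold>+ q" unfolding p_def q_def kl p'_def q'_def using ocP ocQ by (simp add: zmul_double)
  finally have "(p' \<^bold>+ q') \<^bold>+ (p' \<^bold>+ q') = Infty" using O by simp
  hence T: "p' \<^bold>+ q' = Infty \<or> p' \<^bold>+ q' = T" using two_torsion oc' by auto
  show ?case
  proof (rule ccontr)
    assume ne: "\<not> (k = 0 \<and> l = 0)"
    hence "nat (\<bar>k'\<bar> + \<bar>l'\<bar>) < nat (\<bar>k\<bar> + \<bar>l\<bar>)" using kl by auto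
    from less.hyps[OF this] T have "k' = 0 \<and> l' = 0" unfolding p'_def q'_def by blast
    thus False using ne kl by simp
  qed
qed

lemma T_torsion: "ec_torsion A B (ec_zmul A m T)"
proof -
  have "ec_zmul A m T \<^bold>+ ec_zmul A m T = (T \<^bold>+ T) [^]\<^bsub>EG\<^esub> m"
    using EG.int_pow_distrib[of T T m] by (simp add: ec_zmul_eq)
  also have "\<dots> = Infty" using EG.int_pow_one[of m] by simp
  finally have "ec_nmul A 2 (ec_zmul A m T) = Infty" by (simp add: numeral_2_eq_2)
  thus ?thesis unfolding ec_torsion_def by (intro conjI exI[of _ 2]) auto
qed

theorem free_generators:
  assumes "hh P \<le> 4" "hh Q \<le> 4" shows "ec_free_generators A B [P, Q]"
  unfolding ec_free_generators_def
proof (intro conjI allI impI)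
  show "\<forall>P\<in>set [P, Q]. oc P" using ocP ocQ by simp
next
  fix cs assume cs: "length cs = length [P, Q]" "ec_lincomb A cs [P, Q] = Infty"
  then obtain k l where kl: "cs = [k, l]" by (auto simp: length_Suc_conv)
  have "ec_zmul A k P \<^bold>+ ec_zmul A l Q = Infty" using cs(2) unfolding kl by simp
  thus "\<forall>c\<in>set cs. c = 0" using independence kl by auto
next
  fix R assume "oc R"
  hence "R \<in> span" using generation assms by blast
  then obtain k l m where "R = (ec_zmul A k P \<^bold>+ ec_zmul A l Q) \<^bold>+ ec_zmul A m T" by (auto simp: span_def)
  hence "length [k, l] = length [P, Q] \<and> ec_torsion A B (ec_zmul A m T) \<and> R = ec_lincomb A [k, l] [P, Q] \<^bold>+ ec_zmul A m T"
    using T_torsion by simp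
  thus "\<exists>cs T. length cs = length [P, Q] \<and> ec_torsion A B T \<and> R = ec_lincomb A cs [P, Q] \<^bold>+ T" by blast
qed

end

subsection \<open>The twists in question\<close>

text \<open>With \<open>s = u^2+1\<close> one has \<open>u^4+u^2+1 = s^2-u^2\<close>; clearing
  denominators, \<open>a^4*s^4*(X^3+a*X+b)\<close> is exactly \<open>g\<close>.\<close>

lemma on_twist_P:
  fixes u a b g :: "'a::field"
  assumes "a \<noteq> 0" "u^2 + 1 \<noteq> 0"
    and g: "g = - a * b * (u^2+1) * (b^2 * (u^4+u^2+1)^3 + a^3 * u^4 * (u^2+1)^2)"
  shows "(1 / (a^2 * (u^2+1)^2) * g^2)^2 = (- (b * (u^2+u+1) * (u^2-u+1)) / (a * (u^2+1)) * g)^3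
    + a * g^2 * (- (b * (u^2+u+1) * (u^2-u+1)) / (a * (u^2+1)) * g) + b * g^3"
proof -
  define s X where "s = u^2+1" and "X = - (b * (u^2+u+1) * (u^2-u+1)) / (a * s)"
  have s0: "s \<noteq> 0" using assms by (simp add: s_def)
  have "X = - (b * (s^2 - u^2)) / (a * s)" unfolding X_def s_def by (simp add: algebra_simps power2_eq_square)
  hence aX: "a * s * X = - (b * (s^2 - u^2))" using assms(1) s0 by simp
  have "a^4 * s^4 * (X^3 + a*X + b) = a*s*(a*s*X)^3 + a^4*s^3*(a*s*X) + a^4*s^4*b"
    by (simp add: algebra_simps power2_eq_square power3_eq_cube power4_eq_xxxx)
  also have "\<dots> = g" unfolding aX unfolding g s_def by (simp add: algebra_simps power2_eq_square power3_eq_cube power4_eq_xxxx)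
  finally have "X^3 + a*X + b = g / (a^4 * s^4)" using assms(1) s0 by (simp add: field_simps)
  hence "g^3 * (X^3 + a*X + b) = (1 / (a^2 * s^2) * g^2)^2"
    by (simp add: power_divide eval_nat_numeral ac_simps)
  thus ?thesis unfolding s_def[symmetric] X_def[symmetric] by (simp add: algebra_simps power2_eq_square power3_eq_cube)
qed

lemma on_twist_Q:
  fixes u a b g :: "'a::field"
  assumes "a \<noteq> 0" "u^2 + 1 \<noteq> 0" "u \<noteq> 0"
    and g: "g = - a * b * (u^2+1) * (b^2 * (u^4+u^2+1)^3 + a^3 * u^4 * (u^2+1)^2)"
  shows "(1 / (a^2 * u^3 * (u^2+1)^2) * g^2)^2 = (- (b * (u^2+u+1) * (u^2-u+1)) / (a * u^2 * (u^2+1)) * g)^3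
    + a * g^2 * (- (b * (u^2+u+1) * (u^2-u+1)) / (a * u^2 * (u^2+1)) * g) + b * g^3"
proof -
  define s X where "s = u^2+1" and "X = - (b * (u^2+u+1) * (u^2-u+1)) / (a * u^2 * s)"
  have s0: "s \<noteq> 0" using assms by (simp add: s_def)
  have "X = - (b * (s^2 - u^2)) / (a * u^2 * s)" unfolding X_def s_def by (simp add: algebra_simps power2_eq_square)
  hence aX: "a * u^2 * s * X = - (b * (s^2 - u^2))" using assms(1,3) s0 by simp
  have "a^4 * u^6 * s^4 * (X^3 + a*X + b) = a*s*(a*u^2*s*X)^3 + a^4*u^4*s^3*(a*u^2*s*X) + a^4*u^6*s^4*b"
    by (simp add: algebra_simps power2_eq_square power3_eq_cube power4_eq_xxxx eval_nat_numeral)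
  also have "\<dots> = g" unfolding aX unfolding g s_def by (simp add: algebra_simps power2_eq_square power3_eq_cube power4_eq_xxxx eval_nat_numeral)
  finally have "X^3 + a*X + b = g / (a^4 * u^6 * s^4)" using assms(1,3) s0 by (simp add: field_simps)
  hence "g^3 * (X^3 + a*X + b) = (1 / (a^2 * u^3 * s^2) * g^2)^2"
    by (simp add: power_divide eval_nat_numeral ac_simps)
  thus ?thesis unfolding s_def[symmetric] X_def[symmetric] by (simp add: algebra_simps power2_eq_square power3_eq_cube)
qed

lemma emb_uu: "emb [:0, 1:] = uu" by (simp add: emb_pCons)

lemma is_sq_emb_const: "is_sq (of_int n :: Qu) \<Longrightarrow> \<exists>k. k^2 = n"
proof -
  assume "is_sq (of_int n :: Qu)"
  then obtain Y where "emb [:n:] = Y^2" by (auto simp: is_sq_def emb_const)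
  then obtain w where "[:n:] = w^2" by (rule emb_square)
  hence "poly [:n:] 0 = poly w 0 ^ 2" by simp
  thus ?thesis by auto
qed

lemma is_sq_emb_eval: "is_sq (emb p) \<Longrightarrow> \<exists>k. k^2 = poly p n"
proof -
  assume "is_sq (emb p)"
  then obtain Y where "emb p = Y^2" by (auto simp: is_sq_def)
  then obtain w where "p = w^2" by (rule emb_square)
  thus ?thesis by (intro exI[of _ "poly w n"]) simp
qed

lemma hgt_emb_le:
  assumes "q \<noteq> 0" shows "hgt (emb p / emb q) \<le> max (degree p) (degree q)"
proof -
  have "emb p / emb q = Fract (map_poly rat_of_int p) (map_poly rat_of_int q)"
    by (simp add: emb_def Fract_conv_to_fract)
  moreover have "map_poly rat_of_int q \<noteq> 0" using assms by (simp add: map_poly_eq_0_iff)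
  ultimately show ?thesis using hgt_le[of "map_poly rat_of_int q" "map_poly rat_of_int p"]
    by (simp add: degree_map_poly)
qed

lemma rational_anisotropic:
  fixes d :: int and x y :: rat
  assumes "\<And>k. k^2 \<noteq> d" "x^2 = of_int d * y^2" shows "x = 0 \<and> y = 0"
proof (cases "y = 0")
  case False
  obtain a b where ab: "quotient_of (x/y) = (a, b)" by (cases "quotient_of (x/y)")
  have b: "b > 0" "x/y = of_int a / of_int b" using quotient_of_denom_pos[OF ab] quotient_of_div[OF ab] by auto
  have "(x/y)^2 = of_int d" using assms(2) False by (simp add: power_divide)
  hence "of_int (a^2) = (of_int (d * b^2) :: rat)" using b by (simp add: power_divide field_simps)
  hence eq: "a^2 = d * b^2" by (simp only: of_int_eq_iff)
  hence "b dvd a" by (metis dvd_triv_right pos2 pow_divides_pow_iff)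
  then obtain k where k: "a = b * k" by (elim dvdE)
  have "k^2 = d" using eq b(1) unfolding k by (simp add: power_mult_distrib)
  thus ?thesis using assms(1) by blast
qed (use assms(2) in simp)

lemma prod_primes_dvd:
  fixes M :: "'a::factorial_semiring"
  assumes "\<forall>f\<in>set hs. prime_elem f \<and> f dvd M" "sorted_wrt (\<lambda>f g. \<not> g dvd f) hs"
  shows "prod_list hs dvd M"
  using assms
proof (induction hs arbitrary: M)
  case (Cons h hs)
  then obtain M' where M': "M = h * M'" by auto
  have "f dvd M'" if "f \<in> set hs" for f
  proof -
    have "f dvd h * M'" "prime_elem f" "\<not> f dvd h" using Cons.prems that M' by auto
    thus ?thesis using prime_elem_dvd_multD by blast
  qed
  hence "prod_list hs dvd M'" using Cons by auto
  thus ?case unfolding M' by (simp add: mult_dvd_mono)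
qed simp

text \<open>Each prime of \<open>hs\<close> divides \<open>k * prod_list hs\<close> exactly once, so
  the square needs it again in \<open>M\<close>.\<close>

lemma squarefree_cofactor:
  fixes M w k :: "'a::factorial_semiring"
  assumes pr: "\<forall>f\<in>set hs. prime_elem f \<and> \<not> f dvd k" and sw: "sorted_wrt (\<lambda>f g. \<not> g dvd f \<and> \<not> f dvd g) hs"
    and eq: "k * prod_list hs * M = w^2"
  shows "prod_list hs dvd M"
proof (rule prod_primes_dvd)
  show "sorted_wrt (\<lambda>f g. \<not> g dvd f) hs" using sw by (rule sorted_wrt_mono_rel[rotated]) auto
  show "\<forall>f\<in>set hs. prime_elem f \<and> f dvd M"
  proof
    fix f assume f: "f \<in> set hs"
    hence pf: "prime_elem f" "\<not> f dvd k" using pr by auto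
    obtain xs ys where hs: "hs = xs @ f # ys" using f by (meson split_list)
    define G where "G = k * (prod_list xs * prod_list ys)"
    have nd: "\<not> f dvd x" if "x \<in> set xs \<or> x \<in> set ys" for x
      using sw that unfolding hs by (auto simp: sorted_wrt_append)
    have nl: "\<not> f dvd prod_list zs" if "\<forall>x\<in>set zs. \<not> f dvd x" for zs
      using that
    proof (induction zs)
      case Nil thus ?case using pf(1) prime_elem_not_unit by auto
    next
      case (Cons z zs) thus ?case using pf(1) by (auto simp: prime_elem_dvd_mult_iff)
    qed
    have nG: "\<not> f dvd G" unfolding G_def using pf nl[of xs] nl[of ys] nd by (auto simp: prime_elem_dvd_mult_iff)
    have eq': "f * (G * M) = w^2" using eq unfolding hs G_def by (simp add: ac_simps)
    hence "f dvd w^2" by (metis dvd_triv_left)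
    hence "f dvd w" using pf(1) prime_elem_dvd_power by blast
    then obtain v where v: "w = f * v" by auto
    have "f * (G * M) = f * (f * v^2)" unfolding eq' v by (simp add: power2_eq_square ac_simps)
    hence "G * M = f * v^2" using pf(1) by auto
    hence "f dvd G * M" by simp
    thus "prime_elem f \<and> f dvd M" using nG pf prime_elem_dvd_multD by blast
  qed
qed

text \<open>\<open>xpoly\<close> is the abscissa of \<open>P\<close> and \<open>u\<^sup>2\<close> times that of \<open>Q\<close>.\<close>

definition kpoly :: "int \<Rightarrow> int \<Rightarrow> int poly" where
  "kpoly a b = [:b:]^2 * ([:0,1:]^4 + [:0,1:]^2 + 1)^3 + [:a:]^3 * [:0,1:]^4 * ([:0,1:]^2 + 1)^2"

definition gpoly :: "int \<Rightarrow> int \<Rightarrow> int poly" where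
  "gpoly a b = - [:a:] * [:b:] * ([:0,1:]^2 + 1) * kpoly a b"

definition xpoly :: "int \<Rightarrow> int \<Rightarrow> int poly" where
  "xpoly a b = [:b:]^2 * ([:0,1:]^4 + [:0,1:]^2 + 1) * kpoly a b"

lemma emb_kpoly: "emb (kpoly a b) = of_int b^2 * (uu^4+uu^2+1)^3 + of_int a^3 * uu^4 * (uu^2+1)^2"
  and emb_gpoly: "emb (gpoly a b) = gfun a b"
  and emb_xpoly: "emb (xpoly a b) = of_int b^2 * (uu^4+uu^2+1) * emb (kpoly a b)"
proof -
  show 1: "emb (kpoly a b) = of_int b^2 * (uu^4+uu^2+1)^3 + of_int a^3 * uu^4 * (uu^2+1)^2"
    by (simp only: kpoly_def emb_add emb_mult emb_power emb_1 emb_uu emb_const)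
  show "emb (gpoly a b) = gfun a b"
    by (simp only: gpoly_def gfun_def emb_add emb_mult emb_power emb_uminus emb_1 emb_uu emb_const 1)
  show "emb (xpoly a b) = of_int b^2 * (uu^4+uu^2+1) * emb (kpoly a b)"
    by (simp only: xpoly_def emb_add emb_mult emb_power emb_uminus emb_1 emb_uu emb_const)
qed

lemma uu_nz: "uu \<noteq> 0" "uu^2 + 1 \<noteq> 0"
proof -
  have "emb [:0, 1:] \<noteq> 0" "emb [:1, 0, 1:] \<noteq> 0" by (simp_all only: emb_eq_0_iff) simp_all
  thus "uu \<noteq> 0" "uu^2 + 1 \<noteq> 0" by (simp_all add: emb_pCons power2_eq_square add.commute)
qed

lemma Pg_x: assumes "a \<noteq> 0"
  shows "\<exists>y. Pg a b = Pt (emb (xpoly a b)) y" "\<exists>y. Qg a b = Pt (emb (xpoly a b) / uu^2) y"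
proof -
  have w: "(uu^2+uu+1) * (uu^2-uu+1) = uu^4+uu^2+1" by (simp add: algebra_simps power2_eq_square power4_eq_xxxx)
  have g: "gfun a b = - of_int a * of_int b * (uu^2+1) * emb (kpoly a b)" unfolding gfun_def emb_kpoly ..
  have cancel: "- (B * W) / (A * S) * (- A * B * S * K) = B^2 * W * K" if "A \<noteq> 0" "S \<noteq> 0" for A B S W K :: Qu
    using that by (simp add: field_simps power2_eq_square)
  have a: "of_int a \<noteq> (0::Qu)" using assms by simp
  have x: "- (of_int b * (uu^2+uu+1) * (uu^2-uu+1)) / (of_int a * (uu^2+1)) * gfun a b = emb (xpoly a b)"
    unfolding emb_xpoly g mult.assoc[of "of_int b" "uu^2+uu+1"] w by (rule cancel[OF a uu_nz(2)])
  thus "\<exists>y. Pg a b = Pt (emb (xpoly a b)) y" unfolding Pg_def by simp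
  have "- (of_int b * (uu^2+uu+1) * (uu^2-uu+1)) / (of_int a * uu^2 * (uu^2+1)) * gfun a b
      = (- (of_int b * (uu^2+uu+1) * (uu^2-uu+1)) / (of_int a * (uu^2+1)) * gfun a b) / uu^2"
    by (simp add: ac_simps)
  also note x
  finally show "\<exists>y. Qg a b = Pt (emb (xpoly a b) / uu^2) y" unfolding Qg_def by simp
qed

section \<open>From explicit data for one pair of coefficients to free generators\<close>

text \<open>\<open>WP*kP^2\<close> and \<open>WQ*kQ^2\<close> are \<open>z\<close> at
  \<open>P\<close> and \<open>u^2*z\<close> at \<open>Q\<close>, so \<open>WP\<close> and
  \<open>WQ\<close> are their square classes; \<open>nP/mP\<close> and \<open>nQ/mQ\<close> are the
  values of \<open>z/g\<close>, visibly of degree at most 4. \<open>fs\<close> and \<open>gs\<close>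
  hold the primes of \<open>d*\<kappa>*prod_list hs\<close> and
  \<open>-20*\<kappa>*prod_list hs\<close>: the isogenous curve has the coefficients
  \<open>-2*c\<close> and \<open>c^2-4*d = -20\<close>, with discriminant \<open>16*d\<close>. The
  square \<open>\<rho>^2\<close> in \<open>g\<close> is split off because it does not affect
  classes.\<close>

locale twist_case =
  fixes a b e c d \<kappa> \<rho> :: int and WP WQ kP kQ nP nQ mP mQ :: "int poly" and fs gs hs :: "int poly list" and m :: nat
  assumes root_e: "e^3 + a*e + b = 0" and a0: "a \<noteq> 0" and rho0: "\<rho> \<noteq> 0"
    and c_eq: "c = 3*e" and d_eq: "d = 3*e^2 + a" and cd: "c^2 - 4*d = -20" and d_nonsq: "\<And>k. k^2 \<noteq> d" "\<And>k. k^2 \<noteq> 16*d"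
    and sing: "4*a^3 + 27*b^2 \<noteq> 0"
    and G: "gpoly a b = [:\<rho>^2:] * ([:\<kappa>:] * prod_list hs)"
    and zP: "xpoly a b - [:e:] * gpoly a b = WP * kP^2" and zQ: "xpoly a b - [:e:] * [:0,1:]^2 * gpoly a b = WQ * kQ^2"
    and hP: "WP * kP^2 * mP = nP * gpoly a b" "mP \<noteq> 0" "degree nP \<le> 4" "degree mP \<le> 4"
    and hQ: "WQ * kQ^2 * mQ = nQ * ([:0,1:]^2 * gpoly a b)" "mQ \<noteq> 0" "degree nQ \<le> 4" "degree mQ \<le> 4"
    and kPQ: "kP \<noteq> 0" "kQ \<noteq> 0"
    and primes: "\<forall>f\<in>set fs. prime_elem f" "\<forall>f\<in>set gs. prime_elem f" "\<forall>f\<in>set hs. prime_elem f \<and> \<not> f dvd [:\<kappa>:]"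
    and distinct_primes: "sorted_wrt (\<lambda>f g. \<not> g dvd f \<and> \<not> f dvd g) hs" and deg: "degree (prod_list hs) = 14"
    and bad: "[:d:] * ([:\<kappa>:] * prod_list hs) dvd prod_list fs ^ m" "[:-20:] * ([:\<kappa>:] * prod_list hs) dvd prod_list gs ^ m"
    and parity: "\<And>P Q N w t es. descent_datum c d ([:\<kappa>:] * prod_list hs) P Q N w t ([:-1:] # fs) es \<Longrightarrow> length es = Suc (length fs) \<Longrightarrow>
        \<exists>i j k ms. i < 2 \<and> j < 2 \<and> k < 2 \<and> list_all2 (\<lambda>a b. even (a + b)) es ms \<and> powlist ([:-1:] # fs) ms = WP^i * WQ^j * [:d:]^k"
    and parity_dual: "\<And>P Q N w t es. descent_datum (-2*c) (-20) ([:\<kappa>:] * prod_list hs) P Q N w t ([:-1:] # gs) es \<Longrightarrow> length es = Suc (length gs) \<Longrightarrow>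
        \<exists>k ms. k < 2 \<and> list_all2 (\<lambda>a b. even (a + b)) es ms \<and> powlist ([:-1:] # gs) ms = [:-5:]^k"
    and independent: "\<And>i j k. i < 2 \<Longrightarrow> j < 2 \<Longrightarrow> k < 2 \<Longrightarrow> (\<And>n. \<exists>v. v^2 = poly (WP^i * WQ^j * [:d:]^k) n) \<Longrightarrow> i = 0 \<and> j = 0 \<and> k = 0"
begin

abbreviation "g \<equiv> gfun a b"
abbreviation "G0 \<equiv> [:\<kappa>:] * prod_list hs"

lemma gG: "g = of_int \<rho>^2 * emb G0"
  unfolding emb_gpoly[symmetric] G emb_mult[of "[:\<rho>^2:]"] emb_const by simp

lemma G0_nz: "G0 \<noteq> 0"
proof
  assume "G0 = 0"
  hence "\<kappa> = 0 \<or> prod_list hs = 0" by simp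
  thus False
  proof
    assume "\<kappa> = 0"
    hence "hs = []" using primes(3) by (cases hs) auto
    thus False using deg by simp
  qed (use deg in simp)
qed

lemma g_nz: "g \<noteq> 0"
proof -
  have "emb G0 \<noteq> 0" using G0_nz emb_eq_0_iff by blast
  thus ?thesis unfolding gG using rho0 by (simp del: emb_mult)
qed

text \<open>The curve equation times \<open>q^4/\<rho>^2\<close> is free of denominators, and
  \<open>emb_square\<close> puts its square root into \<open>Z[u]\<close>.\<close>

lemma emb_norm_form:
  assumes "q \<noteq> 0" "X = emb p / emb q" and eq: "g * X * (X^2 + of_int c' * X + of_int d') = y^2"
    and N: "N = p^2 + [:c':] * p * q + [:d':] * q^2"
  obtains w where "emb N = emb q^2 * (X^2 + of_int c' * X + of_int d')" "G0 * (p * q * N) = w^2"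
proof -
  have q0: "emb q \<noteq> 0" using assms by simp
  have "emb N = emb p^2 + of_int c' * emb p * emb q + of_int d' * emb q^2"
    unfolding N by (simp only: emb_add emb_mult emb_power emb_const)
  hence embN: "emb N = emb q^2 * (X^2 + of_int c' * X + of_int d')"
    unfolding assms(2) using q0 by (simp add: field_simps power2_eq_square)
  have P: "emb p = X * emb q" using assms(2) q0 by simp
  have "emb (G0 * (p * q * N)) = (g * X * (X^2 + of_int c' * X + of_int d')) * emb q^4 / of_int \<rho>^2"
    unfolding emb_mult[of G0] emb_mult[of "p * q"] emb_mult[of p] embN P gG using rho0
    by (simp add: field_simps power2_eq_square power4_eq_xxxx)
  also have "\<dots> = (y * emb q^2 / of_int \<rho>)^2" unfolding eq by (simp add: power_divide power_mult_distrib flip: power_mult)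
  finally obtain w where "G0 * (p * q * N) = w^2" by (rule emb_square)
  thus ?thesis using that embN by blast
qed

text \<open>\<open>g*X*N\<close> is a square, so the class of \<open>z = g*X\<close> is that of
  \<open>N\<close>; any \<open>ms\<close> congruent to \<open>es\<close> modulo 2 represents
  it.\<close>

lemma descent:
  assumes X: "X \<noteq> 0" and eq: "g * X * (X^2 + of_int c' * X + of_int d') = y^2"
    and ns: "\<And>k. k^2 \<noteq> c'^2 - 4*d'" and pr: "\<forall>f\<in>set ls. prime_elem f" and bd: "[:d':] * G0 dvd prod_list ls ^ m"
  obtains P Q N w t es where "descent_datum c' d' G0 P Q N w t ([:-1:] # ls) es" "length es = Suc (length ls)"
    "\<And>ms. list_all2 (\<lambda>a b. even (a + b)) es ms \<Longrightarrow> is_sq (g * X * emb (powlist ([:-1:] # ls) ms))"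
proof -
  obtain P Q where PQ: "Q \<noteq> 0" "X = emb P / emb Q" "coprime P Q" by (rule emb_coprime_quotient)
  define N where "N = P^2 + [:c':] * P * Q + [:d':] * Q^2"
  obtain w where embN: "emb N = emb Q^2 * (X^2 + of_int c' * X + of_int d')" and "G0 * (P * Q * N) = w^2"
    using emb_norm_form[OF PQ(1,2) eq N_def] by blast
  hence w: "G0 * P * Q * N = w^2" by (simp only: mult.assoc)
  obtain es t where es: "length es = Suc (length ls)" "descent_datum c' d' G0 P Q N w t ([:-1:] # ls) es"
    using descent_decomposition[OF PQ(3) N_def w ns pr bd] by blast
  interpret descent_datum c' d' G0 P Q N w t "[:-1:] # ls" es by (rule es(2))
  have N0: "N \<noteq> 0" using N_root[of 0] by auto
  have "is_sq (g * X * emb (powlist ([:-1:] # ls) ms))" if ms: "list_all2 (\<lambda>a b. even (a + b)) es ms" for ms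
  proof -
    obtain s where s: "powlist ([:-1:] # ls) es * powlist ([:-1:] # ls) ms = s^2"
      using powlist_square[OF ms, of "[:-1:] # ls"] es(1) by auto
    have "N * powlist ([:-1:] # ls) ms = (powlist ([:-1:] # ls) es * powlist ([:-1:] # ls) ms) * t^2"
      unfolding fac by (simp only: ac_simps)
    hence "N * powlist ([:-1:] # ls) ms = (s * t)^2" unfolding s by (simp add: power_mult_distrib)
    hence "emb N * emb (powlist ([:-1:] # ls) ms) = emb (s * t)^2" by (metis emb_mult emb_power)
    hence 1: "is_sq (emb N * emb (powlist ([:-1:] # ls) ms))" by (rule is_sqI)
    have "g * X * emb N = (y * emb Q)^2" unfolding embN power_mult_distrib eq[symmetric] by (simp add: ac_simps)
    hence 2: "is_sq (g * X * emb N)" by (rule is_sqI)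
    show ?thesis using is_sq_trans[OF 2 1] N0 by simp
  qed
  thus ?thesis using that es by blast
qed

abbreviation "A \<equiv> of_int a * g^2"
abbreviation "B \<equiv> of_int b * g^3"
abbreviation "R \<equiv> of_int e * g"

sublocale E: ell_curve_2 A B R
proof
  have "4 * A^3 + 27 * B^2 = of_int (4*a^3 + 27*b^2) * g^6"
    by (simp add: algebra_simps power_mult_distrib flip: power_mult)
  moreover have "of_int (4*a^3 + 27*b^2) \<noteq> (0::Qu)" using sing by (simp only: of_int_eq_0_iff not_False_eq_True)
  ultimately show "4 * A^3 + 27 * B^2 \<noteq> 0" using g_nz by (metis mult_eq_0_iff power_eq_0_iff)
  have "R^3 + A * R + B = of_int (e^3 + a*e + b) * g^3" by (simp add: algebra_simps power2_eq_square power3_eq_cube)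
  thus "R^3 + A * R + B = 0" unfolding root_e by simp
qed

lemma C_D: "E.C = of_int c * g" "E.D = of_int d * g^2"
  unfolding E.C_def E.D_def c_eq d_eq by (simp_all add: algebra_simps power_mult_distrib)

lemma words_nz: "emb WP \<noteq> 0" "emb WQ \<noteq> 0" "emb kP \<noteq> 0" "emb kQ \<noteq> 0"
proof -
  have W: "WP \<noteq> 0" "WQ \<noteq> 0" using independent[of 1 0 0] independent[of 0 1 0] by force+
  thus "emb WP \<noteq> 0" "emb WQ \<noteq> 0" by simp_all
  show "emb kP \<noteq> 0" "emb kQ \<noteq> 0" using kPQ by simp_all
qed

lemma zP': "emb (xpoly a b) - R = emb WP * emb kP^2" and zQ': "emb (xpoly a b) / uu^2 - R = emb WQ * (emb kQ / uu)^2"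
proof -
  show "emb (xpoly a b) - R = emb WP * emb kP^2"
    using arg_cong[OF zP, of emb] by (simp only: emb_diff emb_mult emb_power emb_const emb_gpoly)
  have "emb (xpoly a b) - of_int e * uu^2 * g = emb WQ * emb kQ^2"
    using arg_cong[OF zQ, of emb] by (simp only: emb_diff emb_mult emb_power emb_const emb_gpoly emb_uu)
  thus "emb (xpoly a b) / uu^2 - R = emb WQ * (emb kQ / uu)^2" using uu_nz(1) by (simp add: field_simps)
qed

lemma dl_P: "E.dl (Pg a b) = emb WP * emb kP^2" and dl_Q: "E.dl (Qg a b) = emb WQ * (emb kQ / uu)^2"
proof -
  obtain y where y: "Pg a b = Pt (emb (xpoly a b)) y" using Pg_x(1)[OF a0] by blast
  have "emb (xpoly a b) \<noteq> R" using zP' words_nz(1,3) by (metis diff_self mult_eq_0_iff power_eq_0_iff)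
  thus "E.dl (Pg a b) = emb WP * emb kP^2" unfolding y using zP' by simp
  obtain y' where y': "Qg a b = Pt (emb (xpoly a b) / uu^2) y'" using Pg_x(2)[OF a0] by blast
  have "emb (xpoly a b) / uu^2 \<noteq> R"
    using zQ' words_nz(2,4) uu_nz(1) by (metis diff_self divide_eq_0_iff mult_eq_0_iff power_eq_0_iff)
  thus "E.dl (Qg a b) = emb WQ * (emb kQ / uu)^2" unfolding y' using zQ' by simp
qed

lemma dl_word: "E.dl (Pg a b)^i * E.dl (Qg a b)^j * of_int d^k = emb (WP^i * WQ^j * [:d:]^k) * (emb kP^i * (emb kQ / uu)^j)^2"
  unfolding dl_P dl_Q emb_mult emb_power emb_const by (simp add: power_mult_distrib power_mult[symmetric] mult.commute[of 2] ac_simps)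

lemma low_height:
  assumes eq: "g * X * (X^2 + of_int c * X + of_int d) = y^2" and h: "hgt X < 4" shows "X = 0"
proof (rule ccontr)
  assume X0: "X \<noteq> 0"
  obtain p' q' where pq': "q' \<noteq> 0" "X = Fract p' q'" "degree p' \<le> hgt X" "degree q' \<le> hgt X" by (rule hgt_attained)
  obtain p q where pq: "q \<noteq> 0" "Fract p' q' = emb p / emb q" "degree p = degree p'" "degree q = degree q'"
    using emb_quotient[OF pq'(1)] by blast
  have dpq: "degree p \<le> 3" "degree q \<le> 3" using pq pq' h by simp_all
  have X: "X = emb p / emb q" using pq' pq by simp
  have q0: "emb q \<noteq> 0" using pq by simp
  define N where "N = p^2 + [:c:] * p * q + [:d:] * q^2"
  define M where "M = p * q * N"
  obtain w where embN: "emb N = emb q^2 * (X^2 + of_int c * X + of_int d)" and w: "G0 * M = w^2"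
    using emb_norm_form[OF pq(1) X eq N_def] unfolding M_def by blast
  have dvd: "prod_list hs dvd M" by (rule squarefree_cofactor[OF primes(3) distinct_primes w])
  have "M \<noteq> 0"
  proof
    assume "M = 0"
    hence "N = 0" using X0 X pq(1) unfolding M_def by auto
    hence "X^2 + of_int c * X + of_int d = 0" using embN q0 by simp
    moreover have "(2*X + of_int c)^2 = 4*(X^2 + of_int c * X + of_int d) + of_int (c^2 - 4*d)"
      by (simp add: algebra_simps power2_eq_square)
    ultimately have "of_int (-20) = (2*X + of_int c)^2" unfolding cd by simp
    hence "is_sq (of_int (-20) :: Qu)" by (rule is_sqI)
    then obtain k :: int where "k^2 = -20" using is_sq_emb_const by blast
    thus False using zero_le_power2[of k] by linarith
  qed
  hence "14 \<le> degree M" using dvd_imp_degree_le[OF dvd] deg by simp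
  \<comment> \<open>\<open>p\<close> and \<open>q\<close> have degree at most 3 and \<open>N\<close>
    at most 6, which stays below 14.\<close>
  moreover have "degree M \<le> 12"
  proof -
    have dm: "degree (x * y) \<le> k + l" if "degree x \<le> k" "degree y \<le> l" for x y :: "int poly" and k l
      using degree_mult_le[of x y] that by linarith
    have "degree ([:c:] * p * q) \<le> 0 + 3 + 3" "degree ([:d:] * (q * q)) \<le> 0 + (3 + 3)" "degree (p * p) \<le> 3 + 3"
      by (intro dm dpq; simp)+
    hence "degree N \<le> 0 + 3 + 3" unfolding N_def power2_eq_square by (intro degree_add_le) simp_all
    hence "degree M \<le> (3 + 3) + (0 + 3 + 3)" unfolding M_def using dpq by (intro dm)
    thus ?thesis by simp
  qed
  ultimately show False by simp
qed

theorem twist_free_generators: "ec_free_generators A B [Pg a b, Qg a b]"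
proof -
  interpret descent_twist A B R g c d "Pg a b" "Qg a b"
  proof unfold_locales
    show "g \<noteq> 0" by (rule g_nz)
    show "E.C = of_int c * g" "E.D = of_int d * g^2" by (rule C_D)+
    show "c^2 - 4*d = -20" by (rule cd)
    have aQ: "of_int a \<noteq> (0::Qu)" using a0 by simp
    show "on_curve A B (Pg a b)" unfolding Pg_def on_curve.simps by (rule on_twist_P[OF aQ uu_nz(2) gfun_def])
    show "on_curve A B (Qg a b)" unfolding Qg_def on_curve.simps by (rule on_twist_Q[OF aQ uu_nz(2,1) gfun_def])
    show "\<exists>i j k. i < 2 \<and> j < 2 \<and> k < 2 \<and> is_sq (g * X * E.dl (Pg a b)^i * E.dl (Qg a b)^j * of_int d^k)"
      if X: "X \<noteq> 0" and eq: "g * X * (X^2 + of_int c * X + of_int d) = y^2" for X y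
    proof -
      have ns: "k^2 \<noteq> c^2 - 4*d" for k :: int unfolding cd using zero_le_power2[of k] by linarith
      obtain P Q N w t es where es: "descent_datum c d G0 P Q N w t ([:-1:] # fs) es" "length es = Suc (length fs)"
        "\<And>ms. list_all2 (\<lambda>a b. even (a + b)) es ms \<Longrightarrow> is_sq (g * X * emb (powlist ([:-1:] # fs) ms))"
        using descent[OF X eq ns primes(1) bad(1)] by blast
      obtain i j k ms where ms: "i < 2" "j < 2" "k < 2" "list_all2 (\<lambda>a b. even (a + b)) es ms"
        "powlist ([:-1:] # fs) ms = WP^i * WQ^j * [:d:]^k" using parity[OF es(1,2)] by blast
      have "is_sq (g * X * emb (WP^i * WQ^j * [:d:]^k))" using es(3)[OF ms(4)] unfolding ms(5) .
      from is_sq_mult[OF this is_sq_square(1)[of "emb kP^i * (emb kQ / uu)^j"]]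
      have "is_sq (g * X * (E.dl (Pg a b)^i * E.dl (Qg a b)^j * of_int d^k))" unfolding dl_word by (simp only: mult.assoc)
      hence "is_sq (g * X * E.dl (Pg a b)^i * E.dl (Qg a b)^j * of_int d^k)" by (simp only: mult.assoc)
      thus ?thesis using ms by blast
    qed
    show "is_sq (g * X) \<or> is_sq (-5 * (g * X))" if X: "X \<noteq> 0" and eq: "g * X * (X^2 - 2 * of_int c * X - 20) = y^2" for X y
    proof -
      have "(-2*c)^2 - 4*(-20) = 16*d" using cd by (simp add: power_mult_distrib)
      hence ns: "k^2 \<noteq> (-2*c)^2 - 4*(-20)" for k :: int using d_nonsq(2) by simp
      have eq': "g * X * (X^2 + of_int (-2*c) * X + of_int (-20)) = y^2" using eq by simp
      obtain P Q N w t es where es: "descent_datum (-2*c) (-20) G0 P Q N w t ([:-1:] # gs) es" "length es = Suc (length gs)"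
        "\<And>ms. list_all2 (\<lambda>a b. even (a + b)) es ms \<Longrightarrow> is_sq (g * X * emb (powlist ([:-1:] # gs) ms))"
        using descent[OF X eq' ns primes(2) bad(2)] by blast
      obtain k ms where ms: "k < 2" "list_all2 (\<lambda>a b. even (a + b)) es ms" "powlist ([:-1:] # gs) ms = [:-5:]^k"
        using parity_dual[OF es(1,2)] by blast
      have "is_sq (g * X * emb ([:-5:]^k))" using es(3)[OF ms(2)] unfolding ms(3) .
      hence *: "is_sq (g * X * of_int (-5)^k)" unfolding emb_power emb_const .
      have "k = 0 \<or> k = 1" using ms(1) by auto
      thus ?thesis using * by (auto simp: mult.commute)
    qed
    show "X = 0" if "g * X * (X^2 + of_int c * X + of_int d) = y^2" "hgt X < 4" for X y using low_height that by blast
    show "i = 0 \<and> j = 0 \<and> k = 0" if ijk: "i < 2" "j < 2" "k < 2"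
      and sq: "is_sq (E.dl (Pg a b)^i * E.dl (Qg a b)^j * of_int d^k)" for i j k
    proof (rule independent[OF ijk])
      have "is_sq ((emb kP^i * (emb kQ / uu)^j)^2 * emb (WP^i * WQ^j * [:d:]^k))" using sq unfolding dl_word by (simp only: mult.commute)
      hence "is_sq (emb (WP^i * WQ^j * [:d:]^k))" by (rule is_sq_cancel_square) (use words_nz uu_nz in simp)
      thus "\<exists>v. v^2 = poly (WP^i * WQ^j * [:d:]^k) n" for n by (rule is_sq_emb_eval)
    qed
    show "\<not> is_sq (-5 :: Qu)"
    proof
      assume "is_sq (-5 :: Qu)"
      hence "is_sq (of_int (-5) :: Qu)" by simp
      then obtain k :: int where "k^2 = -5" using is_sq_emb_const by blast
      thus False using zero_le_power2[of k] by linarith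
    qed
    show "x = 0 \<and> y = 0" if "x^2 = of_int d * y^2" for x y :: rat
      by (rule rational_anisotropic[OF d_nonsq(1) that])
  qed
  obtain y where y: "Pg a b = Pt (emb (xpoly a b)) y" using Pg_x(1)[OF a0] by blast
  obtain y' where y': "Qg a b = Pt (emb (xpoly a b) / uu^2) y'" using Pg_x(2)[OF a0] by blast
  have "emb WP * emb kP^2 * emb mP = emb nP * g"
    using arg_cong[OF hP(1), of emb] by (simp only: emb_mult emb_power emb_gpoly)
  hence "(emb (xpoly a b) - R) / g = emb nP / emb mP" unfolding zP' using g_nz hP(2) by (simp add: frac_eq_eq)
  hence 1: "hh (Pg a b) \<le> 4" unfolding y hh_simps using hgt_emb_le[OF hP(2), of nP] hP(3,4) by simp
  have "emb WQ * emb kQ^2 * emb mQ = emb nQ * (uu^2 * g)"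
    using arg_cong[OF hQ(1), of emb] by (simp only: emb_mult emb_power emb_gpoly emb_uu)
  hence "(emb (xpoly a b) / uu^2 - R) / g = emb nQ / emb mQ" unfolding zQ' power_divide using g_nz hQ(2) uu_nz(1)
    by (simp add: frac_eq_eq ac_simps)
  hence 2: "hh (Qg a b) \<le> 4" unfolding y' hh_simps using hgt_emb_le[OF hQ(2), of nQ] hQ(3,4) by simp
  show ?thesis by (rule free_generators[OF 1 2])
qed

end

lemma nonsquare_neg: "n < 0 \<Longrightarrow> k^2 \<noteq> (n::int)"
  using zero_le_power2[of k] by linarith

lemma marked_sum_Cons: "marked_sum (b # ss) (e # es) = (if b then e else 0) + marked_sum ss es"
  unfolding marked_sum_def by (simp add: sum.lessThan_Suc_shift del: sum.lessThan_Suc cong: if_cong)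

lemma marked_sum_Nil [simp]: "marked_sum [] es = 0" by (simp add: marked_sum_def)

lemma poly_dvd_eval: "f dvd g \<Longrightarrow> poly f n dvd poly g n" for f g :: "'a::comm_ring_1 poly"
  by (auto elim!: dvdE)

lemma bad_primes_dvd:
  fixes d \<kappa> k :: int
  assumes "prod_list fs = [:k:] * H" "d * \<kappa> dvd k^2"
  shows "[:d:] * ([:\<kappa>:] * H) dvd prod_list fs ^ 2"
proof -
  have "[:d * \<kappa>:] * H dvd [:k^2:] * H^2" using assms(2) by (intro mult_dvd_mono) simp_all
  moreover have "[:d:] * ([:\<kappa>:] * H) = [:d * \<kappa>:] * H" "[:k^2:] * H^2 = prod_list fs ^ 2"
    unfolding assms(1) by (simp_all add: power_mult_distrib power2_eq_square mult.commute)
  ultimately show ?thesis by simp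
qed

section \<open>The case \<open>(a, b) = (2, 12)\<close>\<close>

lemma primes_2_12:
  "prime_elem ([:1, 0, 1:] :: int poly)" "prime_elem ([:2, 0, 2, 0, 3:] :: int poly)"
  "prime_elem ([:3, 0, 2, 0, 2:] :: int poly)" "prime_elem ([:3, 0, 4, 0, 3:] :: int poly)"
proof -
  have "s^2 \<noteq> 3 * (2 * r - 4)" if "r^2 = 3 * 3" for r s :: int
  proof -
    have "r = 3 \<or> r = -3" using that power2_eq_iff[of r 3] by simp
    thus ?thesis using nonsquare_between[of 2 6 s] nonsquare_neg[of "-30" s] by (elim disjE) simp_all
  qed
  thus "prime_elem ([:3, 0, 4, 0, 3:] :: int poly)"
    by (intro irreducible_imp_prime_elem irreducible_biquadratic) (simp_all add: content_def gcd_non_0_int)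
  have "r^2 \<noteq> 3 * 2" "r^2 \<noteq> 2 * 3" for r :: int using nonsquare_between[of 2 6 r] by simp_all
  thus "prime_elem ([:2, 0, 2, 0, 3:] :: int poly)" "prime_elem ([:3, 0, 2, 0, 2:] :: int poly)"
    by (intro irreducible_imp_prime_elem irreducible_biquadratic; simp add: content_def gcd_non_0_int)+
  show "prime_elem ([:1, 0, 1:] :: int poly)"
    by (intro irreducible_imp_prime_elem irreducible_quadratic) (simp_all add: content_def gcd_non_0_int)
qed

text \<open>The test points are chosen so that the five equations on the eight exponents leave a
  three-dimensional solution space, spanned by the classes of \<open>P\<close>, \<open>Q\<close> and
  \<open>T\<close>. In each test \<open>G'\<close> is \<open>G(u)/p\<close>, and \<open>r\<close>,
  \<open>r'\<close> are the roots of \<open>X^2 - 6*X + 14\<close> modulo \<open>p\<close>. Among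
  the constants, 2 and 7 come from \<open>d = 14\<close> and 3 from the constant factor of
  \<open>G\<close>.\<close>

lemma parity_2_12:
  assumes "descent_datum (-6) 14 ([:-3:] * prod_list [[:1, 0, 1:], [:2, 0, 2, 0, 3:], [:3, 0, 2, 0, 2:], [:3, 0, 4, 0, 3:]]) P Q N w t
      [[:-1:], [:2:], [:3:], [:7:], [:1, 0, 1:], [:2, 0, 2, 0, 3:], [:3, 0, 2, 0, 2:], [:3, 0, 4, 0, 3:]] es" (is "descent_datum ?c ?d ?G _ _ _ _ _ ?fs _")
    and l: "length es = 8"
  shows "\<exists>i j k. i < 2 \<and> j < 2 \<and> k < 2 \<and> list_all2 (\<lambda>a b. even (a + b)) es [0, k+i+j, i+j, k, 0, j, i, i+j]"
proof -
  interpret descent_datum ?c ?d ?G P Q N w t ?fs es by fact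
  obtain e0 e1 e2 e3 e4 e5 e6 e7 where es: "es = [e0, e1, e2, e3, e4, e5, e6, e7]"
    using l by (auto simp: length_Suc_conv numeral_eq_Suc)
  have t0: "even (es ! 4)" "even (marked_sum [False, True, False, True, True, False, False, True] es)"
    by (rule test_inert[where u = 5 and p = 13 and h = 6 and j = 4 and G' = "-29799135708"
      and vs = "[-1, 2, 3, 7, 2, 1927, 1303, 1978]"
      and ss = "[False, True, False, True, True, False, False, True]"]; simp)+
  have t1: "even (marked_sum [True, True, True, True, True, False, False, False] es)"
    by (rule test_split[where u = 2 and p = 43 and h = 21 and j = 6 and G' = "-58290"
      and vs = "[-1, 2, 3, 7, 5, 58, 1, 67]"
      and r = 12 and r' = 37]; simp)
  have t2: "even (marked_sum [True, False, False, False, True, False, False, False] es)"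
    by (rule test_split[where u = 3 and p = 47 and h = 23 and j = 7 and G' = "-8663220"
      and vs = "[-1, 2, 3, 7, 10, 263, 183, 6]"
      and r = 21 and r' = 32]; simp)
  have t3: "even (marked_sum [True, True, True, True, True, True, True, True] es)"
    by (rule test_split[where u = 2 and p = 67 and h = 33 and j = 7 and G' = "-37410"
      and vs = "[-1, 2, 3, 7, 5, 58, 43, 1]"
      and r = 17 and r' = 56]; simp)
  \<comment> \<open>The witnesses are the exponents of the factors occurring in one generator only:
    \<open>[:3, 0, 2, 0, 2:]\<close> in \<open>P\<close>, \<open>[:2, 0, 2, 0, 3:]\<close> in
    \<open>Q\<close>, \<open>[:7:]\<close> in \<open>T\<close>.\<close>
  show ?thesis
    using t0 t1 t2 t3 unfolding es
    by (intro exI[of _ "e6 mod 2"] exI[of _ "e5 mod 2"] exI[of _ "e3 mod 2"] conjI) (simp_all add: marked_sum_Cons, argo?)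
qed

text \<open>The same method for the isogenous curve: 5 replaces 7 because \<open>d\<close> becomes
  -20, and only the line spanned by the class of -5 is left. Its coordinate is the exponent of
  -1.\<close>

lemma parity_2_12_dual:
  assumes "descent_datum (12) (-20) ([:-3:] * prod_list [[:1, 0, 1:], [:2, 0, 2, 0, 3:], [:3, 0, 2, 0, 2:], [:3, 0, 4, 0, 3:]]) P Q N w t
      [[:-1:], [:2:], [:3:], [:5:], [:1, 0, 1:], [:2, 0, 2, 0, 3:], [:3, 0, 2, 0, 2:], [:3, 0, 4, 0, 3:]] es" (is "descent_datum ?c ?d ?G _ _ _ _ _ ?fs _")
    and l: "length es = 8"
  shows "\<exists>k. k < 2 \<and> list_all2 (\<lambda>a b. even (a + b)) es [k, 0, 0, k, 0, 0, 0, 0]"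
proof -
  interpret descent_datum ?c ?d ?G P Q N w t ?fs es by fact
  obtain e0 e1 e2 e3 e4 e5 e6 e7 where es: "es = [e0, e1, e2, e3, e4, e5, e6, e7]"
    using l by (auto simp: length_Suc_conv numeral_eq_Suc)
  have t0: "even (es ! 7)" "even (marked_sum [True, False, False, True, False, False, True, True] es)"
    by (rule test_inert[where u = 5 and p = 23 and h = 11 and j = 7 and G' = "-16842989748"
      and vs = "[-1, 2, 3, 5, 26, 1927, 1303, 86]"
      and ss = "[True, False, False, True, False, False, True, True]"]; simp)+
  have t1: "even (es ! 7)" "even (marked_sum [True, False, False, True, False, True, False, True] es)"
    by (rule test_inert[where u = 9 and p = 23 and h = 11 and j = 7 and G' = "-56438591187780"
      and vs = "[-1, 2, 3, 5, 82, 19847, 13287, 870]"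
      and ss = "[True, False, False, True, False, True, False, True]"]; simp)+
  have t2: "even (es ! 5)" "even (marked_sum [False, True, True, False, False, True, True, False] es)"
    by (rule test_inert[where u = 2 and p = 29 and h = 14 and j = 5 and G' = "-86430"
      and vs = "[-1, 2, 3, 5, 5, 2, 43, 67]"
      and ss = "[False, True, True, False, False, True, True, False]"]; simp)+
  have t3: "even (es ! 4)" "even (marked_sum [False, True, True, False, False, True, True, True] es)"
    by (rule test_inert[where u = 12 and p = 29 and h = 14 and j = 4 and G' = "-2458208973233070"
      and vs = "[-1, 2, 3, 5, 5, 62498, 41763, 62787]"
      and ss = "[False, True, True, False, False, True, True, True]"]; simp)+
  have t4: "even (es ! 5)" "even (marked_sum [False, False, True, False, True, True, False, False] es)"
    by (rule test_inert[where u = 5 and p = 41 and h = 20 and j = 5 and G' = "-9448506444"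
      and vs = "[-1, 2, 3, 5, 26, 47, 1303, 1978]"
      and ss = "[False, False, True, False, True, True, False, False]"]; simp)+
  show ?thesis
    using t0 t1 t2 t3 t4 unfolding es
    by (intro exI[of _ "e0 mod 2"] conjI) (simp_all add: marked_sum_Cons, argo?)
qed

lemma twist_case_2_12:
  "twist_case (2) 12 (-2) (-6) 14 (-3) 8
    ([:6:] * [:3, 0, 2, 0, 2:] * [:3, 0, 4, 0, 3:]) ([:6:] * [:2, 0, 2, 0, 3:] * [:3, 0, 4, 0, 3:])
    ([:8:] * [:2, 0, 2, 0, 3:]) ([:8:] * [:3, 0, 2, 0, 2:]) ([:-4:] * [:2, 0, 2, 0, 3:]) ([:-4:] * [:3, 0, 2, 0, 2:])
    ([:2:] * [:1, 0, 1:]) ([:0, 0, 2:] * [:1, 0, 1:])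
    [[:2:], [:3:], [:7:], [:1, 0, 1:], [:2, 0, 2, 0, 3:], [:3, 0, 2, 0, 2:], [:3, 0, 4, 0, 3:]]
    [[:2:], [:3:], [:5:], [:1, 0, 1:], [:2, 0, 2, 0, 3:], [:3, 0, 2, 0, 2:], [:3, 0, 4, 0, 3:]]
    [[:1, 0, 1:], [:2, 0, 2, 0, 3:], [:3, 0, 2, 0, 2:], [:3, 0, 4, 0, 3:]] 2"
  (is "twist_case _ _ _ _ _ _ _ ?WP ?WQ _ _ _ _ _ _ ?fs ?gs ?hs _")
proof
  show "k^2 \<noteq> 14" for k :: int using nonsquare_between[of 3 14 k] by simp
  show "k^2 \<noteq> 16 * 14" for k :: int using nonsquare_between[of 14 224 k] by simp
  show "gpoly (2) 12 = [:8^2:] * ([:-3:] * prod_list ?hs)"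
    by (simp add: gpoly_def kpoly_def eval_nat_numeral one_pCons)
  show "xpoly (2) 12 - [:-2:] * gpoly (2) 12 = ?WP * ([:8:] * [:2, 0, 2, 0, 3:])^2"
    by (simp add: xpoly_def gpoly_def kpoly_def eval_nat_numeral one_pCons)
  show "xpoly (2) 12 - [:-2:] * [:0, 1:]^2 * gpoly (2) 12 = ?WQ * ([:8:] * [:3, 0, 2, 0, 2:])^2"
    by (simp add: xpoly_def gpoly_def kpoly_def eval_nat_numeral one_pCons)
  show "?WP * ([:8:] * [:2, 0, 2, 0, 3:])^2 * ([:2:] * [:1, 0, 1:]) = ([:-4:] * [:2, 0, 2, 0, 3:]) * gpoly (2) 12"
    by (simp add: gpoly_def kpoly_def eval_nat_numeral one_pCons)
  show "?WQ * ([:8:] * [:3, 0, 2, 0, 2:])^2 * ([:0, 0, 2:] * [:1, 0, 1:]) = ([:-4:] * [:3, 0, 2, 0, 2:]) * ([:0, 1:]^2 * gpoly (2) 12)"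
    by (simp add: gpoly_def kpoly_def eval_nat_numeral one_pCons)
  show "\<forall>f\<in>set ?fs. prime_elem f" "\<forall>f\<in>set ?gs. prime_elem f"
    using primes_2_12 by (simp_all add: prime_elem_const_poly_iff prime_imp_prime_elem)
  show "\<forall>f\<in>set ?hs. prime_elem f \<and> \<not> f dvd [:-3:]"
    \<comment> \<open>The values of the four factors at 2 are 5, 58, 43, 67; none divides another,
      nor 3.\<close>
    using primes_2_12 by (auto dest!: poly_dvd_eval[where n = 2])
  show "sorted_wrt (\<lambda>f g. \<not> g dvd f \<and> \<not> f dvd g) ?hs"
    by (auto dest!: poly_dvd_eval[where n = 2])
  show "degree (prod_list ?hs) = 14" by simp
  show "[:14:] * ([:-3:] * prod_list ?hs) dvd prod_list ?fs ^ 2"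
    by (rule bad_primes_dvd[where k = 42]) simp_all
  show "[:-20:] * ([:-3:] * prod_list ?hs) dvd prod_list ?gs ^ 2"
    by (rule bad_primes_dvd[where k = 30]) simp_all
next
  fix P Q N w t es
  assume "descent_datum (-6) 14 ([:-3:] * prod_list ?hs) P Q N w t ([:-1:] # ?fs) es" "length es = Suc (length ?fs)"
  then obtain i j k where *: "i < 2" "j < 2" "k < 2" "list_all2 (\<lambda>a b. even (a + b)) es [0, k+i+j, i+j, k, 0, j, i, i+j]"
    using parity_2_12[of P Q N w t es] by auto
  have six: "[:6 :: int:] = [:2:] * [:3:]" and dd: "[:14 :: int:] = [:2:] * [:7:]" by simp_all
  have "powlist ([:-1:] # ?fs) [0, k+i+j, i+j, k, 0, j, i, i+j] = ?WP^i * ?WQ^j * [:14:]^k"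
    unfolding six dd powlist_Cons powlist_Nil power_add power_mult_distrib power_0 by (simp only: ac_simps mult_1_left mult_1_right)
  thus "\<exists>i j k ms. i < 2 \<and> j < 2 \<and> k < 2 \<and> list_all2 (\<lambda>a b. even (a + b)) es ms \<and>
      powlist ([:-1:] # ?fs) ms = ?WP^i * ?WQ^j * [:14:]^k" using * by blast
next
  fix P Q N w t es
  assume "descent_datum (-2 * (-6)) (-20) ([:-3:] * prod_list ?hs) P Q N w t ([:-1:] # ?gs) es" "length es = Suc (length ?gs)"
  then obtain k where *: "k < 2" "list_all2 (\<lambda>a b. even (a + b)) es [k, 0, 0, k, 0, 0, 0, 0]"
    using parity_2_12_dual[of P Q N w t es] by auto
  have five: "[:-5 :: int:] = [:-1:] * [:5:]" by simp
  have "powlist ([:-1:] # ?gs) [k, 0, 0, k, 0, 0, 0, 0] = [:-5:]^k"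
    unfolding five powlist_Cons powlist_Nil power_mult_distrib power_0 by (simp only: ac_simps mult_1_left mult_1_right)
  thus "\<exists>k ms. k < 2 \<and> list_all2 (\<lambda>a b. even (a + b)) es ms \<and> powlist ([:-1:] # ?gs) ms = [:-5:]^k" using * by blast
next
  fix i j k :: nat
  assume "i < 2" "j < 2" "k < 2" and sq: "\<And>n. \<exists>v. v^2 = poly (?WP^i * ?WQ^j * [:14:]^k) n"
  hence "i = 0 \<or> i = 1" "j = 0 \<or> j = 1" "k = 0 \<or> k = 1" by auto
  thus "i = 0 \<and> j = 0 \<and> k = 0"
    \<comment> \<open>The numbers are nonsquare values of the seven nontrivial products. All are
      taken at 0 except 420 for \<open>WQ\<close>, whose value at 0 is 36.\<close>
    using sq[of 0] sq[of 1] nonsquare_between[of 3 14] nonsquare_between[of 20 420] nonsquare_between[of 22 504] nonsquare_between[of 7 54] nonsquare_between[of 27 756] nonsquare_between[of 44 1944] nonsquare_between[of 164 27216] by (elim disjE) simp_all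
qed simp_all

section \<open>The case \<open>(a, b) = (-7, 36)\<close>\<close>

text \<open>Here the palindromic quartic factor is
  \<open>9*u^4 + 2*u^2 + 9 = (3*u^2+3)^2 - (4*u)^2\<close> and splits, so there are five polynomial
  primes where the other cases have four.\<close>

lemma primes_m7_36:
  "prime_elem ([:1, 0, 1:] :: int poly)" "prime_elem ([:16, 0, 16, 0, 9:] :: int poly)"
  "prime_elem ([:9, 0, 16, 0, 16:] :: int poly)" "prime_elem ([:3, 4, 3:] :: int poly)" "prime_elem ([:3, -4, 3:] :: int poly)"
proof -
  have r: "r = 12 \<or> r = -12" if "r^2 = 144" for r :: int using that power2_eq_iff[of r 12] by simp
  have "s^2 \<noteq> 9 * (2 * r - 16)" if "r^2 = 9 * 16" for r s :: int
    using r[of r] that nonsquare_between[of 8 72 s] nonsquare_neg[of "-360" s] by auto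
  thus "prime_elem ([:16, 0, 16, 0, 9:] :: int poly)"
    by (intro irreducible_imp_prime_elem irreducible_biquadratic) (simp_all add: content_def gcd_non_0_int)
  have "s^2 \<noteq> 16 * (2 * r - 16)" if "r^2 = 16 * 9" for r s :: int
    using r[of r] that nonsquare_between[of 11 128 s] nonsquare_neg[of "-640" s] by auto
  thus "prime_elem ([:9, 0, 16, 0, 16:] :: int poly)"
    by (intro irreducible_imp_prime_elem irreducible_biquadratic) (simp_all add: content_def gcd_non_0_int)
  show "prime_elem ([:1, 0, 1:] :: int poly)" "prime_elem ([:3, 4, 3:] :: int poly)" "prime_elem ([:3, -4, 3:] :: int poly)"
    by (intro irreducible_imp_prime_elem irreducible_quadratic; simp add: content_def gcd_non_0_int)+
qed

lemma parity_m7_36: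
  assumes "descent_datum (-12) 41 ([:7:] * prod_list [[:1, 0, 1:], [:16, 0, 16, 0, 9:], [:9, 0, 16, 0, 16:], [:3, 4, 3:], [:3, -4, 3:]]) P Q N w t
      [[:-1:], [:7:], [:41:], [:1, 0, 1:], [:16, 0, 16, 0, 9:], [:9, 0, 16, 0, 16:], [:3, 4, 3:], [:3, -4, 3:]] es" (is "descent_datum ?c ?d ?G _ _ _ _ _ ?fs _")
    and l: "length es = 8"
  shows "\<exists>i j k. i < 2 \<and> j < 2 \<and> k < 2 \<and> list_all2 (\<lambda>a b. even (a + b)) es [0, 0, k, 0, j, i, i+j, i+j]"
proof -
  interpret descent_datum ?c ?d ?G P Q N w t ?fs es by fact
  obtain e0 e1 e2 e3 e4 e5 e6 e7 where es: "es = [e0, e1, e2, e3, e4, e5, e6, e7]"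
    using l by (auto simp: length_Suc_conv numeral_eq_Suc)
  have t0: "even (marked_sum [True, True, False, True, True, True, False, True] es)"
    by (rule test_split[where u = 2 and p = 23 and h = 11 and j = 6 and G' = "18055520"
      and vs = "[-1, 7, 41, 5, 224, 329, 1, 7]"
      and r = 14 and r' = 21]; simp)
  have t1: "even (marked_sum [True, True, False, True, True, True, True, False] es)"
    by (rule test_split[where u = 3 and p = 23 and h = 11 and j = 5 and G' = "2963890440"
      and vs = "[-1, 7, 41, 10, 889, 63, 42, 18]"
      and r = 14 and r' = 21]; simp)
  have t2: "even (es ! 3)" "even (marked_sum [False, False, False, False, False, False, True, True] es)"
    by (rule test_inert[where u = 6 and p = 37 and h = 18 and j = 3 and G' = "21483616119840"
      and vs = "[-1, 7, 41, 1, 12256, 21321, 135, 87]"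
      and ss = "[False, False, False, False, False, False, True, True]"]; simp)+
  have t3: "even (marked_sum [False, True, False, True, False, False, False, False] es)"
    by (rule test_split[where u = 7 and p = 61 and h = 30 and j = 7 and G' = "109477856332600"
      and vs = "[-1, 7, 41, 50, 22409, 39209, 178, 2]"
      and r = 25 and r' = 48]; simp)
  have t4: "even (marked_sum [True, False, False, False, False, False, True, True] es)"
    by (rule test_split[where u = 19 and p = 83 and h = 41 and j = 6 and G' = "88305941923781782760"
      and vs = "[-1, 7, 41, 362, 1178681, 2090921, 14, 1010]"
      and r = 30 and r' = 65]; simp)
  \<comment> \<open>As before, the witnesses belong to factors seen by one generator only, here the
    two quartics and 41.\<close>
  show ?thesis
    using t0 t1 t2 t3 t4 unfolding es
    by (intro exI[of _ "e5 mod 2"] exI[of _ "e4 mod 2"] exI[of _ "e2 mod 2"] conjI) (simp_all add: marked_sum_Cons, argo?)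
qed

lemma parity_m7_36_dual:
  assumes "descent_datum (24) (-20) ([:7:] * prod_list [[:1, 0, 1:], [:16, 0, 16, 0, 9:], [:9, 0, 16, 0, 16:], [:3, 4, 3:], [:3, -4, 3:]]) P Q N w t
      [[:-1:], [:2:], [:5:], [:7:], [:1, 0, 1:], [:16, 0, 16, 0, 9:], [:9, 0, 16, 0, 16:], [:3, 4, 3:], [:3, -4, 3:]] es" (is "descent_datum ?c ?d ?G _ _ _ _ _ ?fs _")
    and l: "length es = 9"
  shows "\<exists>k. k < 2 \<and> list_all2 (\<lambda>a b. even (a + b)) es [k, 0, k, 0, 0, 0, 0, 0, 0]"
proof -
  interpret descent_datum ?c ?d ?G P Q N w t ?fs es by fact
  obtain e0 e1 e2 e3 e4 e5 e6 e7 e8 where es: "es = [e0, e1, e2, e3, e4, e5, e6, e7, e8]"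
    using l by (auto simp: length_Suc_conv numeral_eq_Suc)
  have t0: "even (marked_sum [True, False, True, True, True, True, True, True, True] es)"
    by (rule test_split[where u = 2 and p = 23 and h = 11 and j = 7 and G' = "18055520"
      and vs = "[-1, 2, 5, 7, 5, 224, 329, 1, 7]"
      and r = 4 and r' = 18]; simp)
  have t1: "even (marked_sum [True, False, True, True, True, True, False, True, False] es)"
    by (rule test_split[where u = 3 and p = 23 and h = 11 and j = 6 and G' = "2963890440"
      and vs = "[-1, 2, 5, 7, 10, 889, 63, 42, 18]"
      and r = 4 and r' = 18]; simp)
  have t2: "even (marked_sum [True, False, True, True, True, False, True, True, False] es)"
    by (rule test_split[where u = 4 and p = 23 and h = 11 and j = 5 and G' = "136299391760"
      and vs = "[-1, 2, 5, 7, 17, 112, 4361, 67, 35]"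
      and r = 4 and r' = 18]; simp)
  have t3: "even (marked_sum [True, False, True, True, True, False, True, False, True] es)"
    by (rule test_split[where u = 15 and p = 23 and h = 11 and j = 5 and G' = "11721410560310013864"
      and vs = "[-1, 2, 5, 7, 226, 19967, 813609, 738, 618]"
      and r = 4 and r' = 18]; simp)
  have t4: "even (es ! 8)" "even (marked_sum [False, True, False, False, True, False, True, True, True] es)"
    by (rule test_inert[where u = 5 and p = 29 and h = 14 and j = 8 and G' = "2243082791768"
      and vs = "[-1, 2, 5, 7, 26, 6041, 10409, 98, 2]"
      and ss = "[False, True, False, False, True, False, True, True, True]"]; simp)+
  have t5: "even (es ! 4)" "even (marked_sum [False, True, False, False, False, False, False, True, True] es)"
    by (rule test_inert[where u = 12 and p = 29 and h = 14 and j = 4 and G' = "412972774974995760"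
      and vs = "[-1, 2, 5, 7, 5, 188944, 334089, 483, 387]"
      and ss = "[False, True, False, False, False, False, False, True, True]"]; simp)+
  have t6: "even (es ! 6)" "even (marked_sum [True, False, True, False, True, False, False, True, False] es)"
    by (rule test_inert[where u = 2 and p = 47 and h = 23 and j = 6 and G' = "8835680"
      and vs = "[-1, 2, 5, 7, 5, 224, 7, 23, 7]"
      and ss = "[True, False, True, False, True, False, False, True, False]"]; simp)+
  show ?thesis
    using t0 t1 t2 t3 t4 t5 t6 unfolding es
    by (intro exI[of _ "e0 mod 2"] conjI) (simp_all add: marked_sum_Cons, argo?)
qed

lemma twist_case_m7_36:
  "twist_case (-7) 36 (-4) (-12) 41 (7) 6
    ([:9, 0, 16, 0, 16:] * [:3, 4, 3:] * [:3, -4, 3:]) ([:16, 0, 16, 0, 9:] * [:3, 4, 3:] * [:3, -4, 3:])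
    ([:12:] * [:16, 0, 16, 0, 9:]) ([:12:] * [:9, 0, 16, 0, 16:]) ([:-4:] * [:16, 0, 16, 0, 9:]) ([:-4:] * [:9, 0, 16, 0, 16:])
    ([:-7:] * [:1, 0, 1:]) ([:0, 0, -7:] * [:1, 0, 1:])
    [[:7:], [:41:], [:1, 0, 1:], [:16, 0, 16, 0, 9:], [:9, 0, 16, 0, 16:], [:3, 4, 3:], [:3, -4, 3:]]
    [[:2:], [:5:], [:7:], [:1, 0, 1:], [:16, 0, 16, 0, 9:], [:9, 0, 16, 0, 16:], [:3, 4, 3:], [:3, -4, 3:]]
    [[:1, 0, 1:], [:16, 0, 16, 0, 9:], [:9, 0, 16, 0, 16:], [:3, 4, 3:], [:3, -4, 3:]] 2"
  (is "twist_case _ _ _ _ _ _ _ ?WP ?WQ _ _ _ _ _ _ ?fs ?gs ?hs _")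
proof
  show "k^2 \<noteq> 41" for k :: int using nonsquare_between[of 6 41 k] by simp
  show "k^2 \<noteq> 16 * 41" for k :: int using nonsquare_between[of 25 656 k] by simp
  show "gpoly (-7) 36 = [:6^2:] * ([:7:] * prod_list ?hs)"
    by (simp add: gpoly_def kpoly_def eval_nat_numeral one_pCons)
  show "xpoly (-7) 36 - [:-4:] * gpoly (-7) 36 = ?WP * ([:12:] * [:16, 0, 16, 0, 9:])^2"
    by (simp add: xpoly_def gpoly_def kpoly_def eval_nat_numeral one_pCons)
  show "xpoly (-7) 36 - [:-4:] * [:0, 1:]^2 * gpoly (-7) 36 = ?WQ * ([:12:] * [:9, 0, 16, 0, 16:])^2"
    by (simp add: xpoly_def gpoly_def kpoly_def eval_nat_numeral one_pCons)
  show "?WP * ([:12:] * [:16, 0, 16, 0, 9:])^2 * ([:-7:] * [:1, 0, 1:]) = ([:-4:] * [:16, 0, 16, 0, 9:]) * gpoly (-7) 36"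
    by (simp add: gpoly_def kpoly_def eval_nat_numeral one_pCons)
  show "?WQ * ([:12:] * [:9, 0, 16, 0, 16:])^2 * ([:0, 0, -7:] * [:1, 0, 1:]) = ([:-4:] * [:9, 0, 16, 0, 16:]) * ([:0, 1:]^2 * gpoly (-7) 36)"
    by (simp add: gpoly_def kpoly_def eval_nat_numeral one_pCons)
  show "\<forall>f\<in>set ?fs. prime_elem f" "\<forall>f\<in>set ?gs. prime_elem f"
    using primes_m7_36 by (simp_all add: prime_elem_const_poly_iff prime_imp_prime_elem)
  show "\<forall>f\<in>set ?hs. prime_elem f \<and> \<not> f dvd [:7:]"
    using primes_m7_36 by (auto dest!: poly_dvd_eval[where n = 3])
  show "sorted_wrt (\<lambda>f g. \<not> g dvd f \<and> \<not> f dvd g) ?hs"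
    by (auto dest!: poly_dvd_eval[where n = 3])
  show "degree (prod_list ?hs) = 14" by simp
  show "[:41:] * ([:7:] * prod_list ?hs) dvd prod_list ?fs ^ 2"
    by (rule bad_primes_dvd[where k = 287]) simp_all
  show "[:-20:] * ([:7:] * prod_list ?hs) dvd prod_list ?gs ^ 2"
    by (rule bad_primes_dvd[where k = 70]) simp_all
next
  fix P Q N w t es
  assume "descent_datum (-12) 41 ([:7:] * prod_list ?hs) P Q N w t ([:-1:] # ?fs) es" "length es = Suc (length ?fs)"
  then obtain i j k where *: "i < 2" "j < 2" "k < 2" "list_all2 (\<lambda>a b. even (a + b)) es [0, 0, k, 0, j, i, i+j, i+j]"
    using parity_m7_36[of P Q N w t es] by auto
  have "powlist ([:-1:] # ?fs) [0, 0, k, 0, j, i, i+j, i+j] = ?WP^i * ?WQ^j * [:41:]^k"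
    unfolding powlist_Cons powlist_Nil power_add power_mult_distrib power_0 by (simp only: ac_simps mult_1_left mult_1_right)
  thus "\<exists>i j k ms. i < 2 \<and> j < 2 \<and> k < 2 \<and> list_all2 (\<lambda>a b. even (a + b)) es ms \<and>
      powlist ([:-1:] # ?fs) ms = ?WP^i * ?WQ^j * [:41:]^k" using * by blast
next
  fix P Q N w t es
  assume "descent_datum (-2 * (-12)) (-20) ([:7:] * prod_list ?hs) P Q N w t ([:-1:] # ?gs) es" "length es = Suc (length ?gs)"
  then obtain k where *: "k < 2" "list_all2 (\<lambda>a b. even (a + b)) es [k, 0, k, 0, 0, 0, 0, 0, 0]"
    using parity_m7_36_dual[of P Q N w t es] by auto
  have five: "[:-5 :: int:] = [:-1:] * [:5:]" by simp
  have "powlist ([:-1:] # ?gs) [k, 0, k, 0, 0, 0, 0, 0, 0] = [:-5:]^k"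
    unfolding five powlist_Cons powlist_Nil power_mult_distrib power_0 by (simp only: ac_simps mult_1_left mult_1_right)
  thus "\<exists>k ms. k < 2 \<and> list_all2 (\<lambda>a b. even (a + b)) es ms \<and> powlist ([:-1:] # ?gs) ms = [:-5:]^k" using * by blast
next
  fix i j k :: nat
  assume "i < 2" "j < 2" "k < 2" and sq: "\<And>n. \<exists>v. v^2 = poly (?WP^i * ?WQ^j * [:41:]^k) n"
  hence "i = 0 \<or> i = 1" "j = 0 \<or> j = 1" "k = 0 \<or> k = 1" by auto
  thus "i = 0 \<and> j = 0 \<and> k = 0"
    \<comment> \<open>\<open>WP*WQ\<close> is a square at 0 and at 1, so the value at 2 is used for
      it.\<close>
    using sq[of 0] sq[of 1] sq[of 2] nonsquare_between[of 6 41] nonsquare_between[of 28 820] nonsquare_between[of 76 5904] nonsquare_between[of 28 820] nonsquare_between[of 57 3321] nonsquare_between[of 43706 1910274016] nonsquare_between[of 691 478224] by (elim disjE) simp_all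
qed simp_all

section \<open>The case \<open>(a, b) = (-22, 84)\<close>\<close>

lemma primes_m22_84:
  "prime_elem ([:1, 0, 1:] :: int poly)" "prime_elem ([:18, 0, 18, 0, 7:] :: int poly)"
  "prime_elem ([:7, 0, 18, 0, 18:] :: int poly)" "prime_elem ([:7, 0, -4, 0, 7:] :: int poly)"
proof -
  have "s^2 \<noteq> 7 * (2 * r - -4)" if "r^2 = 7 * 7" for r s :: int
  proof -
    have "r = 7 \<or> r = -7" using that power2_eq_iff[of r 7] by simp
    thus ?thesis using nonsquare_between[of 11 126 s] nonsquare_neg[of "-70" s] by (elim disjE) simp_all
  qed
  thus "prime_elem ([:7, 0, -4, 0, 7:] :: int poly)"
    by (intro irreducible_imp_prime_elem irreducible_biquadratic) (simp_all add: content_def gcd_non_0_int)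
  have "r^2 \<noteq> 7 * 18" "r^2 \<noteq> 18 * 7" for r :: int using nonsquare_between[of 11 126 r] by simp_all
  thus "prime_elem ([:18, 0, 18, 0, 7:] :: int poly)" "prime_elem ([:7, 0, 18, 0, 18:] :: int poly)"
    by (intro irreducible_imp_prime_elem irreducible_biquadratic; simp add: content_def gcd_non_0_int)+
  show "prime_elem ([:1, 0, 1:] :: int poly)"
    by (intro irreducible_imp_prime_elem irreducible_quadratic) (simp_all add: content_def gcd_non_0_int)
qed

text \<open>The constants 2 and 43 come from \<open>d = 86\<close>, and 3, 7, 11 from the constant
  factor 231 of \<open>G\<close>. With ten exponents, seven independent equations reduce to the
  three known classes.\<close>

lemma parity_m22_84:
  assumes "descent_datum (-18) 86 ([:231:] * prod_list [[:1, 0, 1:], [:18, 0, 18, 0, 7:], [:7, 0, 18, 0, 18:], [:7, 0, -4, 0, 7:]]) P Q N w t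
      [[:-1:], [:2:], [:3:], [:7:], [:11:], [:43:], [:1, 0, 1:], [:18, 0, 18, 0, 7:], [:7, 0, 18, 0, 18:], [:7, 0, -4, 0, 7:]] es" (is "descent_datum ?c ?d ?G _ _ _ _ _ ?fs _")
    and l: "length es = 10"
  shows "\<exists>i j k. i < 2 \<and> j < 2 \<and> k < 2 \<and> list_all2 (\<lambda>a b. even (a + b)) es [0, k+i+j, 0, i+j, 0, k, 0, j, i, i+j]"
proof -
  interpret descent_datum ?c ?d ?G P Q N w t ?fs es by fact
  obtain e0 e1 e2 e3 e4 e5 e6 e7 e8 e9 where es: "es = [e0, e1, e2, e3, e4, e5, e6, e7, e8, e9]"
    using l by (auto simp: length_Suc_conv numeral_eq_Suc)
  have t0: "even (es ! 6)" "even (marked_sum [False, False, True, True, True, False, False, True, True, False] es)"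
    by (rule test_inert[where u = 4 and p = 17 and h = 8 and j = 6 and G' = "4122672497790"
      and vs = "[-1, 2, 3, 7, 11, 43, 1, 2098, 4903, 1735]"
      and ss = "[False, False, True, True, True, False, False, True, True, False]"]; simp)+
  have t1: "even (marked_sum [False, True, True, False, True, True, True, False, False, True] es)"
    by (rule test_split[where u = 5 and p = 29 and h = 14 and j = 7 and G' = "50279862380748"
      and vs = "[-1, 2, 3, 7, 11, 43, 26, 167, 11707, 4282]"
      and r = 22 and r' = 25]; simp)
  have t2: "even (es ! 6)" "even (marked_sum [False, True, False, False, False, True, False, False, False, True] es)"
    by (rule test_inert[where u = 6 and p = 37 and h = 18 and j = 6 and G' = "482036377859190"
      and vs = "[-1, 2, 3, 7, 11, 43, 1, 9738, 23983, 8935]"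
      and ss = "[False, True, False, False, False, True, False, False, False, True]"]; simp)+
  have t3: "even (marked_sum [False, False, True, True, True, False, True, False, False, True] es)"
    by (rule test_split[where u = 12 and p = 41 and h = 20 and j = 8 and G' = "6559748759413516590"
      and vs = "[-1, 2, 3, 7, 11, 43, 145, 147762, 9167, 144583]"
      and r = 3 and r' = 15]; simp)
  have t4: "even (marked_sum [False, True, False, True, True, True, False, True, True, True] es)"
    by (rule test_split[where u = 11 and p = 61 and h = 30 and j = 6 and G' = "1310961779508653580"
      and vs = "[-1, 2, 3, 7, 11, 43, 2, 104683, 265723, 102010]"
      and r = 28 and r' = 51]; simp)
  have t5: "even (marked_sum [True, True, True, True, True, True, False, True, True, True] es)"
    by (rule test_split[where u = 13 and p = 67 and h = 33 and j = 9 and G' = "12259820178013859220"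
      and vs = "[-1, 2, 3, 7, 11, 43, 170, 202987, 517147, 2974]"
      and r = 23 and r' = 62]; simp)
  show ?thesis
    using t0 t1 t2 t3 t4 t5 unfolding es
    by (intro exI[of _ "e8 mod 2"] exI[of _ "e7 mod 2"] exI[of _ "e5 mod 2"] conjI) (simp_all add: marked_sum_Cons, argo?)
qed

lemma parity_m22_84_dual:
  assumes "descent_datum (36) (-20) ([:231:] * prod_list [[:1, 0, 1:], [:18, 0, 18, 0, 7:], [:7, 0, 18, 0, 18:], [:7, 0, -4, 0, 7:]]) P Q N w t
      [[:-1:], [:2:], [:3:], [:5:], [:7:], [:11:], [:1, 0, 1:], [:18, 0, 18, 0, 7:], [:7, 0, 18, 0, 18:], [:7, 0, -4, 0, 7:]] es" (is "descent_datum ?c ?d ?G _ _ _ _ _ ?fs _")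
    and l: "length es = 10"
  shows "\<exists>k. k < 2 \<and> list_all2 (\<lambda>a b. even (a + b)) es [k, 0, 0, k, 0, 0, 0, 0, 0, 0]"
proof -
  interpret descent_datum ?c ?d ?G P Q N w t ?fs es by fact
  obtain e0 e1 e2 e3 e4 e5 e6 e7 e8 e9 where es: "es = [e0, e1, e2, e3, e4, e5, e6, e7, e8, e9]"
    using l by (auto simp: length_Suc_conv numeral_eq_Suc)
  have t0: "even (es ! 8)" "even (marked_sum [True, False, False, True, True, True, False, False, False, False] es)"
    by (rule test_inert[where u = 5 and p = 23 and h = 11 and j = 8 and G' = "63396348219204"
      and vs = "[-1, 2, 3, 5, 7, 11, 26, 4843, 509, 4282]"
      and ss = "[True, False, False, True, True, True, False, False, False, False]"]; simp)+
  have t1: "even (es ! 7)" "even (marked_sum [True, False, False, True, True, True, False, True, False, False] es)"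
    by (rule test_inert[where u = 9 and p = 23 and h = 11 and j = 7 and G' = "212892665648784660"
      and vs = "[-1, 2, 3, 5, 7, 11, 82, 2061, 119563, 45610]"
      and ss = "[True, False, False, True, True, True, False, True, False, False]"]; simp)+
  have t2: "even (marked_sum [False, True, True, False, False, True, True, False, False, True] es)"
    by (rule test_split[where u = 5 and p = 29 and h = 14 and j = 7 and G' = "50279862380748"
      and vs = "[-1, 2, 3, 5, 7, 11, 26, 167, 11707, 4282]"
      and r = 6 and r' = 16]; simp)
  have t3: "even (marked_sum [False, False, True, False, True, True, False, True, True, False] es)"
    by (rule test_split[where u = 9 and p = 41 and h = 20 and j = 6 and G' = "119427592924927980"
      and vs = "[-1, 2, 3, 5, 7, 11, 2, 47403, 119563, 45610]"
      and r = 19 and r' = 27]; simp)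
  have t4: "even (marked_sum [False, False, True, False, True, True, True, False, False, True] es)"
    by (rule test_split[where u = 12 and p = 41 and h = 20 and j = 8 and G' = "6559748759413516590"
      and vs = "[-1, 2, 3, 5, 7, 11, 145, 147762, 9167, 144583]"
      and r = 19 and r' = 27]; simp)
  have t5: "even (es ! 9)" "even (marked_sum [True, False, False, True, False, True, False, False, True, False] es)"
    by (rule test_inert[where u = 10 and p = 47 and h = 23 and j = 9 and G' = "451161798678869586"
      and vs = "[-1, 2, 3, 5, 7, 11, 101, 71818, 181807, 1481]"
      and ss = "[True, False, False, True, False, True, False, False, True, False]"]; simp)+
  have t6: "even (marked_sum [False, True, False, False, True, True, False, True, True, True] es)"
    by (rule test_split[where u = 11 and p = 61 and h = 30 and j = 6 and G' = "1310961779508653580"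
      and vs = "[-1, 2, 3, 5, 7, 11, 2, 104683, 265723, 102010]"
      and r = 33 and r' = 53]; simp)
  show ?thesis
    using t0 t1 t2 t3 t4 t5 t6 unfolding es
    by (intro exI[of _ "e0 mod 2"] conjI) (simp_all add: marked_sum_Cons, argo?)
qed

lemma twist_case_m22_84:
  "twist_case (-22) 84 (-6) (-18) 86 (231) 8
    ([:14:] * [:7, 0, 18, 0, 18:] * [:7, 0, -4, 0, 7:]) ([:14:] * [:18, 0, 18, 0, 7:] * [:7, 0, -4, 0, 7:])
    ([:24:] * [:18, 0, 18, 0, 7:]) ([:24:] * [:7, 0, 18, 0, 18:]) ([:-12:] * [:18, 0, 18, 0, 7:]) ([:-12:] * [:7, 0, 18, 0, 18:])
    ([:-22:] * [:1, 0, 1:]) ([:0, 0, -22:] * [:1, 0, 1:])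
    [[:2:], [:3:], [:7:], [:11:], [:43:], [:1, 0, 1:], [:18, 0, 18, 0, 7:], [:7, 0, 18, 0, 18:], [:7, 0, -4, 0, 7:]]
    [[:2:], [:3:], [:5:], [:7:], [:11:], [:1, 0, 1:], [:18, 0, 18, 0, 7:], [:7, 0, 18, 0, 18:], [:7, 0, -4, 0, 7:]]
    [[:1, 0, 1:], [:18, 0, 18, 0, 7:], [:7, 0, 18, 0, 18:], [:7, 0, -4, 0, 7:]] 2"
  (is "twist_case _ _ _ _ _ _ _ ?WP ?WQ _ _ _ _ _ _ ?fs ?gs ?hs _")
proof
  show "k^2 \<noteq> 86" for k :: int using nonsquare_between[of 9 86 k] by simp
  show "k^2 \<noteq> 16 * 86" for k :: int using nonsquare_between[of 37 1376 k] by simp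
  show "gpoly (-22) 84 = [:8^2:] * ([:231:] * prod_list ?hs)"
    by (simp add: gpoly_def kpoly_def eval_nat_numeral one_pCons)
  show "xpoly (-22) 84 - [:-6:] * gpoly (-22) 84 = ?WP * ([:24:] * [:18, 0, 18, 0, 7:])^2"
    by (simp add: xpoly_def gpoly_def kpoly_def eval_nat_numeral one_pCons)
  show "xpoly (-22) 84 - [:-6:] * [:0, 1:]^2 * gpoly (-22) 84 = ?WQ * ([:24:] * [:7, 0, 18, 0, 18:])^2"
    by (simp add: xpoly_def gpoly_def kpoly_def eval_nat_numeral one_pCons)
  show "?WP * ([:24:] * [:18, 0, 18, 0, 7:])^2 * ([:-22:] * [:1, 0, 1:]) = ([:-12:] * [:18, 0, 18, 0, 7:]) * gpoly (-22) 84"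
    by (simp add: gpoly_def kpoly_def eval_nat_numeral one_pCons)
  show "?WQ * ([:24:] * [:7, 0, 18, 0, 18:])^2 * ([:0, 0, -22:] * [:1, 0, 1:]) = ([:-12:] * [:7, 0, 18, 0, 18:]) * ([:0, 1:]^2 * gpoly (-22) 84)"
    by (simp add: gpoly_def kpoly_def eval_nat_numeral one_pCons)
  show "\<forall>f\<in>set ?fs. prime_elem f" "\<forall>f\<in>set ?gs. prime_elem f"
    using primes_m22_84 by (simp_all add: prime_elem_const_poly_iff prime_imp_prime_elem)
  show "\<forall>f\<in>set ?hs. prime_elem f \<and> \<not> f dvd [:231:]"
    using primes_m22_84 by (auto dest!: poly_dvd_eval[where n = 2])
  show "sorted_wrt (\<lambda>f g. \<not> g dvd f \<and> \<not> f dvd g) ?hs"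
    by (auto dest!: poly_dvd_eval[where n = 2])
  show "degree (prod_list ?hs) = 14" by simp
  show "[:86:] * ([:231:] * prod_list ?hs) dvd prod_list ?fs ^ 2"
    by (rule bad_primes_dvd[where k = 19866]) simp_all
  show "[:-20:] * ([:231:] * prod_list ?hs) dvd prod_list ?gs ^ 2"
    by (rule bad_primes_dvd[where k = 2310]) simp_all
next
  fix P Q N w t es
  assume "descent_datum (-18) 86 ([:231:] * prod_list ?hs) P Q N w t ([:-1:] # ?fs) es" "length es = Suc (length ?fs)"
  then obtain i j k where *: "i < 2" "j < 2" "k < 2" "list_all2 (\<lambda>a b. even (a + b)) es [0, k+i+j, 0, i+j, 0, k, 0, j, i, i+j]"
    using parity_m22_84[of P Q N w t es] by auto
  have six: "[:14 :: int:] = [:2:] * [:7:]" and dd: "[:86 :: int:] = [:2:] * [:43:]" by simp_all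
  have "powlist ([:-1:] # ?fs) [0, k+i+j, 0, i+j, 0, k, 0, j, i, i+j] = ?WP^i * ?WQ^j * [:86:]^k"
    unfolding six dd powlist_Cons powlist_Nil power_add power_mult_distrib power_0 by (simp only: ac_simps mult_1_left mult_1_right)
  thus "\<exists>i j k ms. i < 2 \<and> j < 2 \<and> k < 2 \<and> list_all2 (\<lambda>a b. even (a + b)) es ms \<and>
      powlist ([:-1:] # ?fs) ms = ?WP^i * ?WQ^j * [:86:]^k" using * by blast
next
  fix P Q N w t es
  assume "descent_datum (-2 * (-18)) (-20) ([:231:] * prod_list ?hs) P Q N w t ([:-1:] # ?gs) es" "length es = Suc (length ?gs)"
  then obtain k where *: "k < 2" "list_all2 (\<lambda>a b. even (a + b)) es [k, 0, 0, k, 0, 0, 0, 0, 0, 0]"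
    using parity_m22_84_dual[of P Q N w t es] by auto
  have five: "[:-5 :: int:] = [:-1:] * [:5:]" by simp
  have "powlist ([:-1:] # ?gs) [k, 0, 0, k, 0, 0, 0, 0, 0, 0] = [:-5:]^k"
    unfolding five powlist_Cons powlist_Nil power_mult_distrib power_0 by (simp only: ac_simps mult_1_left mult_1_right)
  thus "\<exists>k ms. k < 2 \<and> list_all2 (\<lambda>a b. even (a + b)) es ms \<and> powlist ([:-1:] # ?gs) ms = [:-5:]^k" using * by blast
next
  fix i j k :: nat
  assume "i < 2" "j < 2" "k < 2" and sq: "\<And>n. \<exists>v. v^2 = poly (?WP^i * ?WQ^j * [:86:]^k) n"
  hence "i = 0 \<or> i = 1" "j = 0 \<or> j = 1" "k = 0 \<or> k = 1" by auto
  thus "i = 0 \<and> j = 0 \<and> k = 0"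
    using sq[of 0] sq[of 1] nonsquare_between[of 9 86] nonsquare_between[of 77 6020] nonsquare_between[of 389 151704] nonsquare_between[of 26 686] nonsquare_between[of 242 58996] nonsquare_between[of 1100 1210104] nonsquare_between[of 10201 104068944] by (elim disjE) simp_all
qed simp_all

theorem theorem6p3:
  fixes a b :: int
  assumes "(a, b) \<in> {(2, 12), (-7, 36), (-22, 84)}"
  shows "ec_rank_is (of_int a * gfun a b ^ 2) (of_int b * gfun a b ^ 3) 2
       \<and> ec_free_generators (of_int a * gfun a b ^ 2) (of_int b * gfun a b ^ 3) [Pg a b, Qg a b]"
proof -
  have "ec_free_generators (of_int a * gfun a b ^ 2) (of_int b * gfun a b ^ 3) [Pg a b, Qg a b]"
    using assms twist_case.twist_free_generators[OF twist_case_2_12]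
      twist_case.twist_free_generators[OF twist_case_m7_36] twist_case.twist_free_generators[OF twist_case_m22_84]
    by auto
  thus ?thesis unfolding ec_rank_is_def by (auto intro!: exI[of _ "[Pg a b, Qg a b]"])
qed

end
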